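(* Let $X$ be an orbifold Hirzebruch surface whose complete simplicial fan in $\mathbb{R}^2$ is given, in cyclic order, by the vectors $(a_1,b_1),(a_2,b_2),(a_3,b_3),(a_4,b_4)\in\mathbb{Z}^2$. If either $(a_1,b_1)=\pm(a_3,b_3)$ or $(a_2,b_2)=\pm(a_4,b_4)$, then $X$ is equivariantly a boundary, i.e., $X$ is the boundary of a $5$-dimensional orientable $T^2$-orbifold.
   Context: All orbifolds are smooth and effective. A $T^2$-orbifold is an orbifold with an effective action of $T^2=(S^1)^2$ on its underlying space. Orbifold Hirzebruch surface: the toric variety $X$, with the action of the compact torus $T^2\subset(\mathbb{C}^* )^2$, associated to a complete simplicial fan in $\mathbb{R}^2$ with four rays spanned in cyclic order by vectors $(a_i,b_i)\in\mathbb{Z}^2$, $i=1,\dots,4$, such that $(a_i,b_i),(a_{i+1},b_{i+1})$ are linearly independent for $i=1,\dots,4$, where $(a_5,b_5)=(a_1,b_1)$. The vectors determine the orbifold structure on $X$: $X$ is $T^2$-equivariantly diffeomorphic to the quasitoric orbifold $X(P^2,\xi)$ over a rectangle $P^2$ with vertices $V_0,\dots,V_3$ and edges $V_iV_{i+1}$ ($V_4=V_0$), where $\xi(V_iV_{i+1})=\epsilon_i(a_{i+1},b_{i+1})$, $\epsilon_i=\pm1$, $i=0,\dots,3$. Here $X(P^2,\xi)=(T^2\times P^2)/\sim$, with $(t,p)\sim(s,q)$ iff $p=q$ and $t^{-1}s\in T_F$, $F$ being the face containing $p$ in its relative interior. $T_F$ is trivial for $F=P^2$; it is the circle subgroup of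 $T^2=\mathbb{R}^2/\mathbb{Z}^2$ in direction $\xi(F)$ if $F$ is an edge; and $T_F=T^2$ if $F$ is a vertex. Orbifold charts: for a face $F$, let $K(F)\subset\mathbb{Z}^2$ be generated by the vectors $\xi$ of the edges containing $F$, of rank $k$ equal to the codimension of $F$, and let $\widetilde K(F)=(K(F)\otimes\mathbb{R})\cap\mathbb{Z}^2$. Write $T_K=(K\otimes\mathbb{R})/K$. A neighborhood of an orbit over the relative interior of $F$ is covered by a chart $\mathbb{C}^k\times(\mathbb{C}^* )^{2-k}$ with group $\ker(T_{K(F)}\to T_{\widetilde K(F)})\cong\widetilde K(F)/K(F)$, where $T_{K(F)}$ acts on $\mathbb{C}^k$ in the standard way with respect to the basis given by the $\xi$'s. "Equivariantly a boundary" means there is an orientable $5$-dimensional effective $T^2$-orbifold $W$ with boundary such that $\partial W$ is $T^2$-equivariantly diffeomorphic to $X$. *)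

theory Defs
  imports "HOL-Analysis.Analysis" "HOL-Algebra.Bij"
begin

section \<open>Smooth maps\<close>

primrec Ck_on :: "nat \<Rightarrow> 'a::real_normed_vector set \<Rightarrow> ('a \<Rightarrow> 'b::real_normed_vector) \<Rightarrow> bool" where
  "Ck_on 0 U f \<longleftrightarrow> continuous_on U f"
| "Ck_on (Suc k) U f \<longleftrightarrow>
     (\<forall>x\<in>U. f differentiable (at x)) \<and> (\<forall>v. Ck_on k U (\<lambda>x. frechet_derivative f (at x) v))"

text \<open>On a set that is not open (such as a relatively open subset of a closed half-space),
  smoothness means local extendability to a smooth map on an open set.\<close>

definition smooth_on :: "'a::real_normed_vector set \<Rightarrow> ('a \<Rightarrow> 'b::real_normed_vector) \<Rightarrow> bool" where
  "smooth_on S f \<longleftrightarrow>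
     (\<forall>x\<in>S. \<exists>U g. open U \<and> x \<in> U \<and> (\<forall>k. Ck_on k U g) \<and> (\<forall>y\<in>U \<inter> S. g y = f y))"

definition diffeo_onto_image :: "'a::real_normed_vector set \<Rightarrow> ('a \<Rightarrow> 'b::real_normed_vector) \<Rightarrow> bool" where
  "diffeo_onto_image N h \<longleftrightarrow>
     inj_on h N \<and> smooth_on N h \<and> smooth_on (h ` N) (inv_into N h)"


section \<open>Effective orbifolds, possibly with boundary\<close>

text \<open>The parameter \<open>M\<close> below is the local model: \<open>UNIV\<close> for orbifolds without boundary and a
  closed half-space for orbifolds with boundary.  A chart consists of a relatively open subset
  \<open>cdom\<close> of \<open>M\<close>, a finite group \<open>cgrp\<close> acting on it by diffeomorphisms, and a map \<open>cproj\<close> to the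
  underlying space that induces a homeomorphism from \<open>cdom / cgrp\<close> onto an open set.\<close>

record ('e, 'a) orb_chart =
  cdom :: "'e set"
  cgrp :: "('e \<Rightarrow> 'e) set"
  cproj :: "'e \<Rightarrow> 'a"

text \<open>Chart domains need not be connected.  Effectiveness is therefore required on every nonempty
  open subset of the domain; on a connected domain this is the same as effectiveness, because
  the group is finite.\<close>

definition is_orb_chart ::
  "'e::euclidean_space set \<Rightarrow> 'a topology \<Rightarrow> ('e, 'a) orb_chart \<Rightarrow> bool" where
  "is_orb_chart M X c \<longleftrightarrow>
     openin (top_of_set M) (cdom c) \<and>
     finite (cgrp c) \<and> subgroup (cgrp c) (BijGroup (cdom c)) \<and>
     (\<forall>g\<in>cgrp c. smooth_on (cdom c) g) \<and>
     (\<forall>g\<in>cgrp c. \<forall>V. openin (top_of_set M) V \<and> V \<noteq> {} \<and> V \<subseteq> cdom c \<and> (\<forall>x\<in>V. g x = x)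
         \<longrightarrow> (\<forall>x\<in>cdom c. g x = x)) \<and>
     openin X (cproj c ` cdom c) \<and>
     quotient_map (top_of_set (cdom c)) (subtopology X (cproj c ` cdom c)) (cproj c) \<and>
     (\<forall>x\<in>cdom c. \<forall>y\<in>cdom c. cproj c x = cproj c y \<longleftrightarrow> (\<exists>g\<in>cgrp c. y = g x))"

text \<open>\<open>h\<close> is a diffeomorphism between open subsets of the domains of \<open>c\<close> and \<open>d\<close> that covers the
  map \<open>f\<close> of underlying spaces.\<close>

definition is_lift ::
  "'e::euclidean_space set \<Rightarrow> ('a \<Rightarrow> 'b) \<Rightarrow> ('e, 'a) orb_chart \<Rightarrow> ('e, 'b) orb_chart
     \<Rightarrow> 'e set \<Rightarrow> ('e \<Rightarrow> 'e) \<Rightarrow> bool" where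
  "is_lift M f c d N h \<longleftrightarrow>
     openin (top_of_set M) N \<and> N \<subseteq> cdom c \<and>
     openin (top_of_set M) (h ` N) \<and> h ` N \<subseteq> cdom d \<and>
     diffeo_onto_image N h \<and>
     (\<forall>z\<in>N. cproj d (h z) = f (cproj c z))"

text \<open>Compatibility of charts is stated through changes of charts: any two points of chart domains
  lying over the same point are matched by a diffeomorphism of neighbourhoods over the identity.\<close>

definition is_orbifold ::
  "'e::euclidean_space set \<Rightarrow> 'a topology \<Rightarrow> ('e, 'a) orb_chart set \<Rightarrow> bool" where
  "is_orbifold M X A \<longleftrightarrow>
     Hausdorff_space X \<and> second_countable X \<and>
     (\<forall>c\<in>A. is_orb_chart M X c) \<and>
     topspace X = (\<Union>c\<in>A. cproj c ` cdom c) \<and>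
     (\<forall>c\<in>A. \<forall>d\<in>A. \<forall>x\<in>cdom c. \<forall>y\<in>cdom d. cproj c x = cproj d y
         \<longrightarrow> (\<exists>N h. x \<in> N \<and> h x = y \<and> is_lift M (\<lambda>p. p) c d N h))"

text \<open>Orientability: the chart domains carry orientations (locally constant signs relative to the
  standard orientation) preserved by all changes of charts, hence also by all elements of the
  chart groups.\<close>

definition orientable_orbifold :: "(real^'n) set \<Rightarrow> (real^'n, 'a) orb_chart set \<Rightarrow> bool" where
  "orientable_orbifold M A \<longleftrightarrow>
     (\<exists>sg :: (real^'n, 'a) orb_chart \<Rightarrow> real^'n \<Rightarrow> real.
        (\<forall>c\<in>A. continuous_on (cdom c) (sg c) \<and> sg c ` cdom c \<subseteq> {-1, 1}) \<and>
        (\<forall>c\<in>A. \<forall>d\<in>A. \<forall>N h. is_lift M (\<lambda>p. p) c d N h \<longrightarrow>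
           (\<forall>x\<in>N. \<forall>D. (h has_derivative D) (at x within N) \<longrightarrow>
              sgn (det (matrix D)) = sg c x * sg d (h x))))"


section \<open>Orbifolds with an action of the 2-torus\<close>

text \<open>The torus is $\mathbb{R}^2/\mathbb{Z}^2$; an action of it is given as an action of
  $\mathbb{R}^2$ in which the integer lattice acts trivially.\<close>

definition lattice :: "(real \<times> real) set" where
  "lattice = \<int> \<times> \<int>"

record ('e, 'a) torus_orb =
  tspace :: "'a topology"
  tatlas :: "('e, 'a) orb_chart set"
  tact :: "real \<times> real \<Rightarrow> 'a \<Rightarrow> 'a"

text \<open>Smoothness of the action: near any parameter \<open>t0\<close> the action lifts to charts as a smooth family
  of diffeomorphisms \<open>F t\<close>.\<close>

definition is_torus_orbifold :: "'e::euclidean_space set \<Rightarrow> ('e, 'a) torus_orb \<Rightarrow> bool" where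
  "is_torus_orbifold M X \<longleftrightarrow>
     is_orbifold M (tspace X) (tatlas X) \<and>
     (\<forall>t. \<forall>p\<in>topspace (tspace X). tact X t p \<in> topspace (tspace X)) \<and>
     (\<forall>p\<in>topspace (tspace X). tact X 0 p = p) \<and>
     (\<forall>s t. \<forall>p\<in>topspace (tspace X). tact X (s + t) p = tact X s (tact X t p)) \<and>
     (\<forall>t. (\<forall>p\<in>topspace (tspace X). tact X t p = p) \<longleftrightarrow> t \<in> lattice) \<and>
     (\<forall>c\<in>tatlas X. \<forall>d\<in>tatlas X. \<forall>x\<in>cdom c. \<forall>y\<in>cdom d. \<forall>t0.
        tact X t0 (cproj c x) = cproj d y \<longrightarrow>
        (\<exists>S N F. open S \<and> t0 \<in> S \<and> x \<in> N \<and> F t0 x = y \<and>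
           smooth_on (S \<times> N) (\<lambda>(t, z). F t z) \<and>
           (\<forall>t\<in>S. is_lift M (tact X t) c d N (F t))))"

definition equivariant_diffeo ::
  "'e::euclidean_space set \<Rightarrow> ('e, 'a) torus_orb \<Rightarrow> ('e, 'b) torus_orb \<Rightarrow> ('a \<Rightarrow> 'b) \<Rightarrow> bool" where
  "equivariant_diffeo M X Y f \<longleftrightarrow>
     homeomorphic_map (tspace X) (tspace Y) f \<and>
     (\<forall>t. \<forall>p\<in>topspace (tspace X). f (tact X t p) = tact Y t (f p)) \<and>
     (\<forall>c\<in>tatlas X. \<forall>d\<in>tatlas Y. \<forall>x\<in>cdom c. \<forall>y\<in>cdom d. f (cproj c x) = cproj d y
         \<longrightarrow> (\<exists>N h. x \<in> N \<and> h x = y \<and> is_lift M f c d N h))"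

text \<open>Boundaries.  The coordinates of $\mathbb{R}^{n+1}$ are indexed by \<open>'n option\<close>, the extra
  coordinate \<open>None\<close> being the one that is nonnegative on the half-space.\<close>

definition halfspace :: "(real^('n::finite option)) set" where
  "halfspace = {x. x $ None \<ge> 0}"

definition bd_emb :: "real^'n \<Rightarrow> real^('n::finite option)" where
  "bd_emb x = (\<chi> i. case i of None \<Rightarrow> 0 | Some j \<Rightarrow> x $ j)"

definition bd_drop :: "real^('n::finite option) \<Rightarrow> real^'n" where
  "bd_drop y = (\<chi> j. y $ Some j)"

definition bd_chart :: "(real^('n::finite option), 'a) orb_chart \<Rightarrow> (real^'n, 'a) orb_chart" where
  "bd_chart c =
     \<lparr> cdom = bd_emb -` cdom c,
       cgrp = (\<lambda>g. restrict (\<lambda>x. bd_drop (g (bd_emb x))) (bd_emb -` cdom c)) ` cgrp c,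
       cproj = cproj c \<circ> bd_emb \<rparr>"

definition boundary_orb :: "(real^('n::finite option), 'a) torus_orb \<Rightarrow> (real^'n, 'a) torus_orb" where
  "boundary_orb W =
     \<lparr> tspace = subtopology (tspace W)
                  (\<Union>c\<in>tatlas W. cproj (bd_chart c) ` cdom (bd_chart c)),
       tatlas = bd_chart ` tatlas W,
       tact = tact W \<rparr>"

text \<open>The null-bordism \<open>W\<close> is compact, as usual for bordisms; otherwise \<open>X \<times> [0,1)\<close> would always do.
  The points of \<open>W\<close> are taken from the type \<open>big_point\<close>.  This is no restriction, since a
  second countable Hausdorff space has at most continuum many points.\<close>

type_synonym big_point = "((real \<times> real) \<times> (real \<times> real \<times> real)) set"

definition equivariantly_a_boundary :: "(real^4, 'a) torus_orb \<Rightarrow> bool" where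
  "equivariantly_a_boundary X \<longleftrightarrow>
     (\<exists>(W :: (real^(4 option), big_point) torus_orb) f.
        is_torus_orbifold halfspace W \<and>
        compact_space (tspace W) \<and>
        orientable_orbifold halfspace (tatlas W) \<and>
        equivariant_diffeo UNIV (boundary_orb W) X f)"


section \<open>The quasitoric orbifold over a rectangle\<close>

definition rvec :: "int \<times> int \<Rightarrow> real \<times> real" where
  "rvec w = (of_int (fst w), of_int (snd w))"

definition idet :: "int \<times> int \<Rightarrow> int \<times> int \<Rightarrow> int" where
  "idet u w = fst u * snd w - snd u * fst w"

definition rectangle :: "(real \<times> real) set" where
  "rectangle = {0..1} \<times> {0..1}"

text \<open>Indices of vertices and edges are read modulo 4; edge \<open>i\<close> joins vertices \<open>i\<close> and \<open>i + 1\<close>.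
  A characteristic function \<open>xi\<close> is given by its values on the edges 0, ..., 3.\<close>

definition vertex :: "nat \<Rightarrow> real \<times> real" where
  "vertex i = [(0, 0), (1, 0), (1, 1), (0, 1)] ! (i mod 4)"

definition edge :: "nat \<Rightarrow> (real \<times> real) set" where
  "edge i = closed_segment (vertex i) (vertex (i + 1))"

text \<open>The preimage in $\mathbb{R}^2$ of the subgroup $T_F$ for the face \<open>F\<close> containing \<open>p\<close> in its
  relative interior, i.e. $K(F)\otimes\mathbb{R}+\mathbb{Z}^2$.\<close>

definition face_stab :: "(nat \<Rightarrow> int \<times> int) \<Rightarrow> real \<times> real \<Rightarrow> (real \<times> real) set" where
  "face_stab xi p = {r + n | r n. r \<in> span ((rvec \<circ> xi) ` {i. i < 4 \<and> p \<in> edge i}) \<and> n \<in> lattice}"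

definition qt_class ::
  "(nat \<Rightarrow> int \<times> int) \<Rightarrow> (real \<times> real) \<times> (real \<times> real) \<Rightarrow> ((real \<times> real) \<times> (real \<times> real)) set" where
  "qt_class xi = (\<lambda>(t, p). {(s, q). q = p \<and> s - t \<in> face_stab xi p})"

text \<open>Points are equivalence classes in $\mathbb{R}^2\times P$, so the union of a set of points is its
  preimage under the quotient map.\<close>

definition qt_space :: "(nat \<Rightarrow> int \<times> int) \<Rightarrow> ((real \<times> real) \<times> (real \<times> real)) set topology" where
  "qt_space xi =
     topology (\<lambda>U. U \<subseteq> qt_class xi ` (UNIV \<times> rectangle) \<and>
                   openin (top_of_set (UNIV \<times> rectangle)) (\<Union>U))"

definition qt_act ::
  "real \<times> real \<Rightarrow> ((real \<times> real) \<times> (real \<times> real)) set \<Rightarrow> ((real \<times> real) \<times> (real \<times> real)) set" where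
  "qt_act t C = (\<lambda>(s, p). (t + s, p)) ` C"

definition to_C2 :: "real^4 \<Rightarrow> complex \<times> complex" where
  "to_C2 x = (Complex (x $ 1) (x $ 2), Complex (x $ 3) (x $ 4))"

definition of_C2 :: "complex \<times> complex \<Rightarrow> real^4" where
  "of_C2 z = vector [Re (fst z), Im (fst z), Re (snd z), Im (snd z)]"

text \<open>A diffeomorphism in $r^2$ from $[0,\infty)$ to $[0,1)$, so that the rectangle is
  locally the quotient of $\mathbb{C}^2$ as a manifold with corners.\<close>

definition radial :: "complex \<Rightarrow> real" where
  "radial z = (norm z)\<^sup>2 / (1 + (norm z)\<^sup>2)"

text \<open>Near vertex \<open>i\<close>, the first coordinate vanishes on edge \<open>i - 1\<close> and the second on edge \<open>i\<close>.\<close>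

definition corner_point :: "nat \<Rightarrow> complex \<times> complex \<Rightarrow> real \<times> real" where
  "corner_point i z = vertex i + radial (fst z) *\<^sub>R (vertex (i + 1) - vertex i)
                               + radial (snd z) *\<^sub>R (vertex (i + 3) - vertex i)"

text \<open>The coordinates of the chart with frame \<open>u, w\<close> are rotated by the circles in the directions
  \<open>u\<close> and \<open>w\<close>; the group is the kernel of the homomorphism $T^2\to T^2$ given by the frame.\<close>

definition qt_chart ::
  "(nat \<Rightarrow> int \<times> int) \<Rightarrow> nat \<Rightarrow> (complex \<times> complex) set \<Rightarrow> int \<times> int \<Rightarrow> int \<times> int
     \<Rightarrow> (real^4, ((real \<times> real) \<times> (real \<times> real)) set) orb_chart" where
  "qt_chart xi i D u w =
     \<lparr> cdom = to_C2 -` D,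
       cgrp = {restrict (\<lambda>x. of_C2 (cis (2 * pi * s1) * fst (to_C2 x),
                                    cis (2 * pi * s2) * snd (to_C2 x))) (to_C2 -` D)
               | s1 s2. s1 *\<^sub>R rvec u + s2 *\<^sub>R rvec w \<in> lattice},
       cproj = (\<lambda>x. qt_class xi
                 ((Arg (fst (to_C2 x)) / (2 * pi)) *\<^sub>R rvec u + (Arg (snd (to_C2 x)) / (2 * pi)) *\<^sub>R rvec w,
                  corner_point i (to_C2 x))) \<rparr>"

text \<open>Charts over the vertices, edges and the interior.  For an edge, \<open>w\<close> spans a complement of
  $\widetilde K(F)$ in the integer lattice, which is what the condition on the determinant says; the
  group then acts on the first coordinate only and is isomorphic to $\widetilde K(F)/K(F)$.  For
  the interior, the frame is a basis of the lattice and the group is trivial.\<close>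

definition qt_atlas ::
  "(nat \<Rightarrow> int \<times> int) \<Rightarrow> (real^4, ((real \<times> real) \<times> (real \<times> real)) set) orb_chart set" where
  "qt_atlas xi =
     {qt_chart xi i UNIV (xi ((i + 3) mod 4)) (xi i) | i. i < 4} \<union>
     {qt_chart xi i (UNIV \<times> (- {0})) (xi ((i + 3) mod 4)) w | i w.
        i < 4 \<and> \<bar>idet (xi ((i + 3) mod 4)) w\<bar>
                  = gcd (fst (xi ((i + 3) mod 4))) (snd (xi ((i + 3) mod 4)))} \<union>
     {qt_chart xi 0 ((- {0}) \<times> (- {0})) u w | u w. \<bar>idet u w\<bar> = 1}"

definition quasitoric ::
  "(nat \<Rightarrow> int \<times> int) \<Rightarrow> (real^4, ((real \<times> real) \<times> (real \<times> real)) set) torus_orb" where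
  "quasitoric xi = \<lparr> tspace = qt_space xi, tatlas = qt_atlas xi, tact = qt_act \<rparr>"


section \<open>Orbifold Hirzebruch surfaces\<close>

text \<open>Linear independence of the generators makes the cones strongly convex and polyhedral.\<close>

definition complete_simplicial_fan :: "(real \<times> real) set set \<Rightarrow> bool" where
  "complete_simplicial_fan \<Sigma> \<longleftrightarrow>
     finite \<Sigma> \<and> \<Sigma> \<noteq> {} \<and>
     (\<forall>\<sigma>\<in>\<Sigma>. \<exists>B\<subseteq>lattice. independent B \<and> \<sigma> = convex_cone hull B) \<and>
     (\<forall>\<sigma>\<in>\<Sigma>. \<forall>\<tau>. \<tau> face_of \<sigma> \<and> \<tau> \<noteq> {} \<longrightarrow> \<tau> \<in> \<Sigma>) \<and>
     (\<forall>\<sigma>\<in>\<Sigma>. \<forall>\<tau>\<in>\<Sigma>. (\<sigma> \<inter> \<tau>) face_of \<sigma> \<and> (\<sigma> \<inter> \<tau>) face_of \<tau>) \<and>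
     \<Union>\<Sigma> = UNIV"

definition fan_of :: "(nat \<Rightarrow> int \<times> int) \<Rightarrow> (real \<times> real) set set" where
  "fan_of v = {{0}} \<union> {convex_cone hull {rvec (v i)} | i. i \<in> {1..4}}
                    \<union> {convex_cone hull {rvec (v i), rvec (v (i mod 4 + 1))} | i. i \<in> {1..4}}"

definition hirzebruch_fan :: "(nat \<Rightarrow> int \<times> int) \<Rightarrow> bool" where
  "hirzebruch_fan v \<longleftrightarrow>
     (\<forall>i\<in>{1..4}. idet (v i) (v (i mod 4 + 1)) \<noteq> 0) \<and>
     inj_on (\<lambda>i. convex_cone hull {rvec (v i)}) {1..4} \<and>
     complete_simplicial_fan (fan_of v)"

text \<open>The orbifold structure and torus action of the toric variety of the fan are
  characterised by an equivariant diffeomorphism with the quasitoric orbifold whose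
  characteristic function takes the value \<open>\<plusminus>v (i + 1)\<close> on edge \<open>i\<close>.\<close>

definition orbifold_hirzebruch_surface :: "(nat \<Rightarrow> int \<times> int) \<Rightarrow> (real^4, 'a) torus_orb \<Rightarrow> bool" where
  "orbifold_hirzebruch_surface v X \<longleftrightarrow>
     hirzebruch_fan v \<and> is_torus_orbifold UNIV X \<and>
     (\<exists>xi f. (\<forall>i<4. xi i = v (i + 1) \<or> xi i = - v (i + 1)) \<and>
             equivariant_diffeo UNIV X (quasitoric xi) f)"

end

theory Submission
  imports Defs
begin

text \<open>The rectangle has two opposite edges with the same direction \<open>u\<close> up to sign.  They cut the rectangle
  into intervals that join one of these edges to the other, and over a general interval \<open>X\<close> contains a
  2-sphere on which the circle in the direction \<open>u\<close> rotates.  Filling in these spheres by 3-balls amounts to replacing each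
  interval by a half-disc with this interval as diameter, the half-circle being labelled by \<open>u\<close>.  The resulting
  orbifold is covered by four charts with domain \<open>\<complex> \<times> (\<complex> \<times> [0,\<infinity>))\<close>, since inversion identifies a closed 3-ball
  without a boundary point with a closed half-space.  The changes of charts are inversions and, locally, maps
  that multiply angles by a rational number, so their orientation characters form a coboundary.\<close>

section \<open>Calculus of smooth maps\<close>

text \<open>The charts are indexed by two booleans: \<open>a\<close> names the end of the interval
  [0,1] and \<open>b\<close> the end of the diameter at which a chart is centred. Negating
  \<open>a\<close> contributes the sign \<open>- sgn (ratio a)\<close>, negating \<open>b\<close>
  the sign -1. The two ratios are inverse to each other, so each passage has the same sign in both
  directions, and it does not depend on the other index; a factor for \<open>a\<close> times a
  factor for \<open>b\<close> therefore trivialises the orientation character. A change of charts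
  that multiplies an angle by a rational number exists only locally. It is written through the
  logarithm near points with positive real z, and the torus action carries it to all other points.
  The comparison of the boundary with X uses the lifts of the given diffeomorphism from charts of X
  to the vertex charts of the quasitoric model. Smoothness and continuity then come from the
  orbifold X itself, and the charts of the model need not be compared with each other.\<close>

lemma Ck_on_subset: "Ck_on k U f \<Longrightarrow> V \<subseteq> U \<Longrightarrow> Ck_on k V f"
  by (induction k arbitrary: f) (auto intro: continuous_on_subset)

lemma Ck_on_cong:
  fixes f g :: "'a::real_normed_vector \<Rightarrow> 'b::real_normed_vector"
  assumes "open U" "\<And>x. x \<in> U \<Longrightarrow> f x = g x"
  shows "Ck_on k U f = Ck_on k U g"
  using assms(2)
proof (induction k arbitrary: f g)
  case 0
  then show ?case by (simp cong: continuous_on_cong)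
next
  case (Suc k)
  have ev: "((f has_derivative D) (at x)) = ((g has_derivative D) (at x))" if "x \<in> U" for x D
    using has_derivative_transform_within_open[OF _ \<open>open U\<close> that, of f D UNIV g]
      has_derivative_transform_within_open[OF _ \<open>open U\<close> that, of g D UNIV f] Suc.prems by auto
  have "frechet_derivative f (at x) = frechet_derivative g (at x)" if "x \<in> U" for x
    using ev[OF that] by (simp add: frechet_derivative_def)
  then have "Ck_on k U (\<lambda>x. frechet_derivative f (at x) v) = Ck_on k U (\<lambda>x. frechet_derivative g (at x) v)" for v
    by (intro Suc.IH) auto
  moreover have "(\<forall>x\<in>U. f differentiable (at x)) = (\<forall>x\<in>U. g differentiable (at x))"
    using ev by (auto simp: differentiable_def)
  ultimately show ?case by simp
qed

text \<open>Trades the derivative that \<open>frechet_derivative\<close> selects for an explicit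
  formula, which is what the calculus rules below supply.\<close>

lemma Ck_on_SucI:
  assumes "open U" "\<And>x. x \<in> U \<Longrightarrow> (f has_derivative f' x) (at x)" "\<And>v. Ck_on k U (\<lambda>x. f' x v)"
  shows "Ck_on (Suc k) U f"
proof -
  have "frechet_derivative f (at x) = f' x" if "x \<in> U" for x
    using frechet_derivative_at[OF assms(2)[OF that]] by simp
  then have "Ck_on k U (\<lambda>x. frechet_derivative f (at x) v)" for v
    using assms(3)[of v] Ck_on_cong[OF assms(1), of "\<lambda>x. frechet_derivative f (at x) v" "\<lambda>x. f' x v"] by simp
  then show ?thesis
    using assms(2) by (auto simp: differentiable_def)
qed

lemma Ck_on_Suc_imp: "Ck_on (Suc k) U f \<Longrightarrow> Ck_on k U f"
proof (induction k arbitrary: f)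
  case 0
  then show ?case
    by (auto intro!: differentiable_imp_continuous_on simp: differentiable_on_def differentiable_at_withinI)
next
  case (Suc k)
  \<comment> \<open>Only the outer \<open>Suc\<close> is unfolded, so that the remaining order
    \<open>Suc k\<close> of the derivative fits the induction hypothesis.\<close>
  note Suc.prems[unfolded Ck_on.simps(2)[of "Suc k"]]
  then have d: "\<forall>x\<in>U. f differentiable (at x)"
    and "Ck_on (Suc k) U (\<lambda>x. frechet_derivative f (at x) v)" for v
    by (rule conjunct1, rule conjunct2[THEN spec])
  then have "Ck_on k U (\<lambda>x. frechet_derivative f (at x) v)" for v
    by (intro Suc.IH)
  with d show ?case
    unfolding Ck_on.simps(2) by (intro conjI allI)
qed

lemma Ck_on_has_derivative:
  "Ck_on (Suc k) U f \<Longrightarrow> x \<in> U \<Longrightarrow> (f has_derivative frechet_derivative f (at x)) (at x)"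
  by (simp add: frechet_derivative_works)

lemma Ck_on_frechet_derivative:
  "Ck_on (Suc k) U f \<Longrightarrow> Ck_on k U (\<lambda>x. frechet_derivative f (at x) v)"
  by simp

lemma Ck_on_const: "open U \<Longrightarrow> Ck_on k U (\<lambda>x. c)"
proof (induction k arbitrary: c)
  case (Suc k)
  then show ?case by (intro Ck_on_SucI[where f' = "\<lambda>x v. 0"]) auto
qed simp

lemma Ck_on_bounded_linear:
  assumes "bounded_linear L" "open U" "Ck_on k U f"
  shows "Ck_on k U (\<lambda>x. L (f x))"
  using assms(3)
proof (induction k arbitrary: f)
  case 0
  then show ?case
    using assms(1) by (auto intro: bounded_linear.continuous_on)
next
  case (Suc k)
  show ?case
  proof (rule Ck_on_SucI)
    show "((\<lambda>x. L (f x)) has_derivative (\<lambda>v. L (frechet_derivative f (at x) v))) (at x)" if "x \<in> U" for x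
      by (rule bounded_linear.has_derivative[OF assms(1) Ck_on_has_derivative[OF Suc.prems that]])
    show "Ck_on k U (\<lambda>x. L (frechet_derivative f (at x) v))" for v
      by (rule Suc.IH[OF Ck_on_frechet_derivative[OF Suc.prems]])
  qed fact
qed

lemma Ck_on_add:
  assumes "open U" "Ck_on k U f" "Ck_on k U g"
  shows "Ck_on k U (\<lambda>x. f x + g x)"
  using assms(2,3)
proof (induction k arbitrary: f g)
  case 0
  then show ?case by (auto intro: continuous_intros)
next
  case (Suc k)
  show ?case
  proof (rule Ck_on_SucI)
    show "((\<lambda>x. f x + g x) has_derivative
        (\<lambda>v. frechet_derivative f (at x) v + frechet_derivative g (at x) v)) (at x)" if "x \<in> U" for x
      by (rule has_derivative_add[OF Suc.prems[THEN Ck_on_has_derivative, OF that]])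
    show "Ck_on k U (\<lambda>x. frechet_derivative f (at x) v + frechet_derivative g (at x) v)" for v
      by (intro Suc.IH Ck_on_frechet_derivative Suc.prems)
  qed fact
qed

lemma Ck_on_sum:
  assumes "open U" "\<And>i. i \<in> I \<Longrightarrow> Ck_on k U (f i)"
  shows "Ck_on k U (\<lambda>x. \<Sum>i\<in>I. f i x)"
  using assms(2)
  by (induction I rule: infinite_finite_induct) (auto intro!: Ck_on_const Ck_on_add assms(1))

lemma Ck_on_bilinear:
  assumes "bounded_bilinear B" "open U" "Ck_on k U f" "Ck_on k U g"
  shows "Ck_on k U (\<lambda>x. B (f x) (g x))"
  using assms(3,4)
proof (induction k arbitrary: f g)
  case 0
  then show ?case
    using assms(1) by (auto intro: bounded_bilinear.continuous_on)
next
  case (Suc k)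
  let ?f' = "\<lambda>x v. B (f x) (frechet_derivative g (at x) v) + B (frechet_derivative f (at x) v) (g x)"
  show ?case
  proof (rule Ck_on_SucI)
    show "((\<lambda>x. B (f x) (g x)) has_derivative ?f' x) (at x)" if "x \<in> U" for x
      by (rule bounded_bilinear.FDERIV[OF assms(1) Suc.prems[THEN Ck_on_has_derivative, OF that]])
    show "Ck_on k U (\<lambda>x. ?f' x v)" for v
      by (intro Ck_on_add assms(2) Suc.IH Ck_on_frechet_derivative Suc.prems Suc.prems[THEN Ck_on_Suc_imp])
  qed fact
qed

lemma Ck_on_compose:
  fixes f :: "'a::real_normed_vector \<Rightarrow> 'b::euclidean_space" and g :: "'b \<Rightarrow> 'c::real_normed_vector"
  assumes "open U" "Ck_on k U f" "Ck_on k V g" "f ` U \<subseteq> V"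
  shows "Ck_on k U (\<lambda>x. g (f x))"
  using assms(2-)
proof (induction k arbitrary: f g)
  case 0
  then show ?case by (auto intro: continuous_on_compose2)
next
  case (Suc k)
  let ?Df = "\<lambda>x. frechet_derivative f (at x)" and ?Dg = "\<lambda>x. frechet_derivative g (at x)"
  \<comment> \<open>The induction hypothesis applies to the derivative of \<open>g\<close> in a
    fixed direction only. Expanding the moving direction in a basis of the Euclidean space 'b
    reduces to finitely many fixed ones.\<close>
  have expand: "?Dg (f x) (?Df x v) = (\<Sum>i\<in>Basis. (?Df x v \<bullet> i) *\<^sub>R ?Dg (f x) i)" if "x \<in> U" for x v
  proof -
    have "linear (?Dg (f x))"
      using Ck_on_has_derivative[OF Suc.prems(2)] Suc.prems(3) that
      by (auto intro: has_derivative_linear)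
    then have "?Dg (f x) (\<Sum>i\<in>Basis. (?Df x v \<bullet> i) *\<^sub>R i) = (\<Sum>i\<in>Basis. (?Df x v \<bullet> i) *\<^sub>R ?Dg (f x) i)"
      by (simp add: linear_sum linear_scale)
    then show ?thesis by (simp add: euclidean_representation)
  qed
  show ?case
  proof (rule Ck_on_SucI[where f' = "\<lambda>x v. ?Dg (f x) (?Df x v)"])
    show "((\<lambda>x. g (f x)) has_derivative (\<lambda>v. ?Dg (f x) (?Df x v))) (at x)" if "x \<in> U" for x
      using diff_chain_at[OF Ck_on_has_derivative[OF Suc.prems(1) that] Ck_on_has_derivative[OF Suc.prems(2)]]
        that Suc.prems(3) by (auto simp: o_def)
    have "Ck_on k U (\<lambda>x. \<Sum>i\<in>Basis. (?Df x v \<bullet> i) *\<^sub>R ?Dg (f x) i)" for v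
    proof (intro Ck_on_sum assms(1) Ck_on_bilinear[OF bounded_bilinear_scaleR])
      fix i :: 'b assume "i \<in> Basis"
      show "Ck_on k U (\<lambda>x. ?Df x v \<bullet> i)"
        by (intro Ck_on_bounded_linear[where L = "\<lambda>y. y \<bullet> i"] bounded_linear_inner_left assms(1)
            Ck_on_frechet_derivative Suc.prems)
      show "Ck_on k U (\<lambda>x. ?Dg (f x) i)"
        by (rule Suc.IH[OF Ck_on_Suc_imp[OF Suc.prems(1)] Ck_on_frechet_derivative[OF Suc.prems(2)] Suc.prems(3)])
    qed
    then show "Ck_on k U (\<lambda>x. ?Dg (f x) (?Df x v))" for v
      using Ck_on_cong[OF assms(1), of "\<lambda>x. ?Dg (f x) (?Df x v)"] expand by simp
  qed fact
qed

text \<open>Openness is built in so that the closure rules below carry no separate side condition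
  for it.\<close>

definition Cinf_on :: "'a::real_normed_vector set \<Rightarrow> ('a \<Rightarrow> 'b::real_normed_vector) \<Rightarrow> bool" where
  "Cinf_on U f \<longleftrightarrow> open U \<and> (\<forall>k. Ck_on k U f)"

lemma Cinf_on_linear: "bounded_linear L \<Longrightarrow> Cinf_on U f \<Longrightarrow> Cinf_on U (\<lambda>x. L (f x))"
  by (simp add: Cinf_on_def Ck_on_bounded_linear)

lemma Cinf_on_id: "open U \<Longrightarrow> Cinf_on U (\<lambda>x. x)"
  unfolding Cinf_on_def
proof (intro conjI allI)
  show "Ck_on k U (\<lambda>x. x)" if "open U" for k
    using that by (cases k) (auto intro!: Ck_on_SucI[where f' = "\<lambda>x v. v"] Ck_on_const simp del: Ck_on.simps(2))
qed

lemma Cinf_on_bounded_linear: "bounded_linear L \<Longrightarrow> open U \<Longrightarrow> Cinf_on U L"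
  using Cinf_on_linear[OF _ Cinf_on_id] by auto

lemma Cinf_on_add: "Cinf_on U f \<Longrightarrow> Cinf_on U g \<Longrightarrow> Cinf_on U (\<lambda>x. f x + g x)"
  by (simp add: Cinf_on_def Ck_on_add)

lemma Cinf_on_bilinear: "bounded_bilinear B \<Longrightarrow> Cinf_on U f \<Longrightarrow> Cinf_on U g \<Longrightarrow> Cinf_on U (\<lambda>x. B (f x) (g x))"
  by (simp add: Cinf_on_def Ck_on_bilinear)

lemmas Cinf_on_mult = Cinf_on_bilinear[OF bounded_bilinear_mult]
  and Cinf_on_scaleR = Cinf_on_bilinear[OF bounded_bilinear_scaleR]

lemma Cinf_on_compose:
  fixes f :: "'a::real_normed_vector \<Rightarrow> 'b::euclidean_space"
  shows "Cinf_on U f \<Longrightarrow> Cinf_on V g \<Longrightarrow> f ` U \<subseteq> V \<Longrightarrow> Cinf_on U (\<lambda>x. g (f x))"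
  by (auto simp: Cinf_on_def intro: Ck_on_compose)

lemma Cinf_on_subset: "Cinf_on U f \<Longrightarrow> open V \<Longrightarrow> V \<subseteq> U \<Longrightarrow> Cinf_on V f"
  by (auto simp: Cinf_on_def intro: Ck_on_subset)

text \<open>The derivative is a constant times a product of two copies of the function itself, so
  each order of smoothness yields the next.\<close>

lemma Cinf_on_inverse:
  "Cinf_on (- {0}) (inverse :: 'a::real_normed_field \<Rightarrow> 'a)"
proof -
  have "Ck_on k (- {0}) (inverse :: 'a \<Rightarrow> 'a)" for k
  proof (induction k)
    case 0
    then show ?case by (auto intro!: continuous_on_inverse)
  next
    case (Suc k)
    have "Ck_on k (- {0}) (\<lambda>x :: 'a. (- v) * (inverse x * inverse x))" for v
      by (intro Ck_on_bilinear[OF bounded_bilinear_mult] Ck_on_const Suc) auto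
    then show ?case
      by (intro Ck_on_SucI[where f' = "\<lambda>x v. - (inverse x * v * inverse x)"])
        (auto intro: has_derivative_eq_rhs[OF has_derivative_inverse'] simp: mult_ac fun_eq_iff)
  qed
  then show ?thesis by (simp add: Cinf_on_def open_Compl)
qed

lemma Cinf_on_exp: "Cinf_on UNIV (exp :: complex \<Rightarrow> complex)"
proof -
  have "Ck_on k UNIV (exp :: complex \<Rightarrow> complex)" for k
  proof (induction k)
    case (Suc k)
    show ?case
      by (intro Ck_on_SucI[where f' = "\<lambda>x v. exp x * v"] Ck_on_bilinear[OF bounded_bilinear_mult] Ck_on_const Suc)
        (use DERIV_exp in \<open>auto simp: has_field_derivative_def\<close>)
  qed (auto intro: continuous_intros)
  then show ?thesis by (simp add: Cinf_on_def)
qed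

lemma Cinf_on_Ln: "Cinf_on {z. 0 < Re z} Ln"
proof -
  have op: "open {z. 0 < Re z}"
    by (simp add: open_halfspace_Re_gt)
  have "Ck_on k {z. 0 < Re z} Ln" for k
  proof (cases k)
    case 0
    then show ?thesis by (auto intro!: continuous_intros simp: complex_nonpos_Reals_iff)
  next
    case (Suc m)
    have "Cinf_on {z. 0 < Re z} (inverse :: complex \<Rightarrow> complex)"
      by (rule Cinf_on_subset[OF Cinf_on_inverse op]) auto
    then have "Ck_on m {z. 0 < Re z} (\<lambda>z. inverse z * v)" for v
      by (intro Ck_on_bilinear[OF bounded_bilinear_mult] Ck_on_const op) (auto simp: Cinf_on_def)
    moreover have "(Ln has_derivative (\<lambda>v. inverse z * v)) (at z)" if "0 < Re z" for z
      using has_field_derivative_Ln[of z] that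
      by (auto simp: has_field_derivative_def complex_nonpos_Reals_iff divide_inverse)
    ultimately show ?thesis
      unfolding Suc by (intro Ck_on_SucI[where f' = "\<lambda>z v. inverse z * v"] op) auto
  qed
  with op show ?thesis by (simp add: Cinf_on_def)
qed

section \<open>Smoothness on sets that need not be open, through local extensions\<close>

lemma smooth_on_Cinf: "Cinf_on U f \<Longrightarrow> S \<subseteq> U \<Longrightarrow> smooth_on S f"
  unfolding smooth_on_def Cinf_on_def by blast

lemma smooth_onE:
  assumes "smooth_on S f" "x \<in> S"
  obtains U g where "x \<in> U" "Cinf_on U g" "\<forall>y\<in>U \<inter> S. g y = f y"
  using assms unfolding smooth_on_def Cinf_on_def by metis

lemma smooth_onI:
  assumes "\<And>x. x \<in> S \<Longrightarrow> \<exists>U g. x \<in> U \<and> Cinf_on U g \<and> (\<forall>y\<in>U \<inter> S. g y = f y)"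
  shows "smooth_on S f"
  unfolding smooth_on_def
proof
  fix x assume "x \<in> S"
  from assms[OF this] show "\<exists>U g. open U \<and> x \<in> U \<and> (\<forall>k. Ck_on k U g) \<and> (\<forall>y\<in>U \<inter> S. g y = f y)"
    unfolding Cinf_on_def by blast
qed

lemma Cinf_on_continuous: "Cinf_on U f \<Longrightarrow> continuous_on U f"
  unfolding Cinf_on_def by (metis Ck_on.simps(1))

lemma smooth_on_continuous: "smooth_on S f \<Longrightarrow> continuous_on S f"
proof (unfold continuous_on_eq_continuous_within, rule ballI)
  fix x assume "smooth_on S f" "x \<in> S"
  then obtain U g where U: "x \<in> U" "Cinf_on U g" "\<forall>y\<in>U \<inter> S. g y = f y"
    by (auto elim: smooth_onE)
  then have "isCont g x"
    using Cinf_on_continuous[OF U(2)] by (auto simp: Cinf_on_def continuous_on_eq_continuous_at)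
  then have "continuous (at x within S) g"
    by (rule continuous_at_imp_continuous_at_within)
  moreover have "\<forall>\<^sub>F y in at x within S. g y = f y"
    using U unfolding eventually_at_topological Cinf_on_def by blast
  ultimately show "continuous (at x within S) f"
    using U \<open>x \<in> S\<close> unfolding continuous_within
    by (metis (mono_tags, lifting) IntI tendsto_cong)
qed

lemma smooth_on_cong:
  assumes "smooth_on S f" "\<And>x. x \<in> S \<Longrightarrow> f x = g x"
  shows "smooth_on S g"
proof (rule smooth_onI)
  fix x assume "x \<in> S"
  obtain U h where "x \<in> U" "Cinf_on U h" "\<forall>y\<in>U \<inter> S. h y = f y"
    by (rule smooth_onE[OF assms(1) \<open>x \<in> S\<close>])
  with assms(2) show "\<exists>U h. x \<in> U \<and> Cinf_on U h \<and> (\<forall>y\<in>U \<inter> S. h y = g y)"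
    by (intro exI[of _ U] exI[of _ h]) simp
qed

lemma smooth_on_subset:
  assumes "smooth_on S f" "T \<subseteq> S"
  shows "smooth_on T f"
proof (rule smooth_onI)
  fix x assume "x \<in> T"
  with assms(2) have "x \<in> S" ..
  obtain U h where "x \<in> U" "Cinf_on U h" "\<forall>y\<in>U \<inter> S. h y = f y"
    by (rule smooth_onE[OF assms(1) \<open>x \<in> S\<close>])
  with assms(2) show "\<exists>U h. x \<in> U \<and> Cinf_on U h \<and> (\<forall>y\<in>U \<inter> T. h y = f y)"
    by (intro exI[of _ U] exI[of _ h]) (simp add: subset_iff)
qed

lemma smooth_on_compose:
  fixes f :: "'a::real_normed_vector \<Rightarrow> 'b::euclidean_space"
  assumes f: "smooth_on S f" and g: "smooth_on T g" and "f ` S \<subseteq> T"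
  shows "smooth_on S (\<lambda>x. g (f x))"
proof (rule smooth_onI)
  fix x assume x: "x \<in> S"
  obtain U F where U: "x \<in> U" "Cinf_on U F" "\<forall>y\<in>U \<inter> S. F y = f y"
    using f x by (auto elim: smooth_onE)
  obtain V G where V: "f x \<in> V" "Cinf_on V G" "\<forall>y\<in>V \<inter> T. G y = g y"
    using g x assms(3) smooth_onE[of T g "f x"] by blast
  \<comment> \<open>The extension \<open>F\<close> need not map \<open>U\<close> into the domain of
    \<open>G\<close>, so \<open>U\<close> is shrunk to the preimage.\<close>
  let ?U = "U \<inter> F -` V"
  have "open ?U"
    using continuous_open_preimage[OF Cinf_on_continuous[OF U(2)]] U(2) V(2) by (auto simp: Cinf_on_def)
  then have "Cinf_on ?U (\<lambda>y. G (F y))"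
    by (intro Cinf_on_compose[OF Cinf_on_subset[OF U(2)] V(2)]) auto
  then show "\<exists>U h. x \<in> U \<and> Cinf_on U h \<and> (\<forall>y\<in>U \<inter> S. h y = g (f y))"
    using x U V assms(3) by (intro exI[of _ ?U] exI[of _ "\<lambda>y. G (F y)"]) auto
qed

lemma smooth_on_has_derivative:
  assumes "smooth_on S f" "x \<in> S"
  shows "\<exists>D. (f has_derivative D) (at x within S)"
proof -
  obtain U g where U: "x \<in> U" "Cinf_on U g" "\<forall>y\<in>U \<inter> S. g y = f y"
    using assms by (auto elim: smooth_onE)
  have "Ck_on (Suc 0) U g"
    using U(2) unfolding Cinf_on_def by (elim conjE allE)
  then have "(g has_derivative frechet_derivative g (at x)) (at x within S)"
    by (rule has_derivative_at_withinI[OF Ck_on_has_derivative]) (rule U)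
  note g = this
  obtain d where d: "d > 0" "\<And>y. dist y x < d \<Longrightarrow> y \<in> U"
    using U(1,2) unfolding Cinf_on_def open_dist by metis
  have "(f has_derivative frechet_derivative g (at x)) (at x within S)"
    by (rule has_derivative_transform_within[OF g d(1) assms(2)]) (simp add: U(3) d(2))
  then show ?thesis by (rule exI[of _ "frechet_derivative g (at x)"])
qed

section \<open>Lifts\<close>

lemma diffeo_onto_imageI:
  assumes "smooth_on N h" "smooth_on (h ` N) k" "\<And>x. x \<in> N \<Longrightarrow> k (h x) = x"
  shows "diffeo_onto_image N h"
proof -
  have inj: "inj_on h N"
    by (rule inj_on_inverseI[where g = k]) (rule assms(3))
  have "smooth_on (h ` N) (inv_into N h)"
    by (rule smooth_on_cong[OF assms(2)]) (auto simp: assms(3) inj)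
  with inj assms(1) show ?thesis
    by (simp add: diffeo_onto_image_def)
qed

lemma diffeo_onto_image_subset:
  assumes "diffeo_onto_image N h" "N' \<subseteq> N"
  shows "diffeo_onto_image N' h"
  using assms unfolding diffeo_onto_image_def
  by (intro diffeo_onto_imageI[unfolded diffeo_onto_image_def, where k = "inv_into N h"])
    (auto intro: smooth_on_subset simp: subset_iff)

lemma diffeo_onto_image_compose:
  fixes h :: "'a::euclidean_space \<Rightarrow> 'b::euclidean_space" and h' :: "'b \<Rightarrow> 'c::euclidean_space"
  assumes "diffeo_onto_image N h" "diffeo_onto_image N' h'" "h ` N \<subseteq> N'"
  shows "diffeo_onto_image N (\<lambda>x. h' (h x))"
proof (rule diffeo_onto_imageI[where k = "\<lambda>y. inv_into N h (inv_into N' h' y)"])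
  show "smooth_on N (\<lambda>x. h' (h x))"
    using assms by (auto intro: smooth_on_compose simp: diffeo_onto_image_def)
  have inv: "inv_into N' h' (h' (h x)) = h x" if "x \<in> N" for x
    using assms that by (intro inv_into_f_f) (auto simp: diffeo_onto_image_def)
  show "smooth_on ((\<lambda>x. h' (h x)) ` N) (\<lambda>y. inv_into N h (inv_into N' h' y))"
  proof (rule smooth_on_compose[where f = "inv_into N' h'" and g = "inv_into N h"])
    show "smooth_on ((\<lambda>x. h' (h x)) ` N) (inv_into N' h')"
      using assms by (auto simp: diffeo_onto_image_def intro: smooth_on_subset)
    show "smooth_on (h ` N) (inv_into N h)"
      using assms by (simp add: diffeo_onto_image_def)
  qed (auto simp: inv)
  show "inv_into N h (inv_into N' h' (h' (h x))) = x" if "x \<in> N" for x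
    using assms(1) that by (simp add: inv diffeo_onto_image_def)
qed

lemma diffeo_onto_image_inv_into:
  assumes "diffeo_onto_image N h"
  shows "diffeo_onto_image (h ` N) (inv_into N h)"
  using assms unfolding diffeo_onto_image_def
  by (intro diffeo_onto_imageI[unfolded diffeo_onto_image_def, where k = h])
    (auto simp: image_image)

text \<open>The image of \<open>V\<close> is the preimage of \<open>V\<close> under the continuous
  inverse, so it is open in the image of \<open>N\<close>; invariance of domain is avoided because
  the image of \<open>N\<close> is open by hypothesis.\<close>

lemma diffeo_onto_image_openin:
  assumes "diffeo_onto_image N h" "openin (top_of_set M) (h ` N)" "openin (top_of_set N) V"
  shows "openin (top_of_set M) (h ` V)"
proof -
  have "V \<subseteq> N"
    using assms(3) by (rule openin_imp_subset)
  with assms(1) have "h ` V = h ` N \<inter> inv_into N h -` V"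
    by (auto simp: diffeo_onto_image_def)
  moreover have "openin (top_of_set (h ` N)) (h ` N \<inter> inv_into N h -` V)"
    using assms by (intro continuous_openin_preimage[of _ _ N] smooth_on_continuous)
      (auto simp: diffeo_onto_image_def)
  ultimately show ?thesis
    using assms(2) openin_trans by metis
qed

lemma is_lift_restrict:
  assumes "is_lift M f c d N h" "openin (top_of_set N) N'"
  shows "is_lift M f c d N' h"
proof -
  note l = assms(1)[unfolded is_lift_def]
  have sub: "N' \<subseteq> N"
    using assms(2) by (rule openin_imp_subset)
  show ?thesis
    unfolding is_lift_def
    using l sub openin_trans[OF assms(2)] diffeo_onto_image_openin[OF _ _ assms(2)] diffeo_onto_image_subset[OF _ sub]
    by (intro conjI ballI) blast+
qed

lemma is_lift_cong:
  "is_lift M f c d N h \<Longrightarrow> (\<And>z. z \<in> N \<Longrightarrow> f (cproj c z) = g (cproj c z)) \<Longrightarrow> is_lift M g c d N h"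
  by (simp add: is_lift_def)

lemma is_lift_continuous: "is_lift M f c d N h \<Longrightarrow> continuous_on N h"
  by (simp add: is_lift_def diffeo_onto_image_def smooth_on_continuous)

lemma is_lift_preimage:
  assumes "is_lift M f c d N h" "openin (top_of_set (cdom d)) V"
  shows "openin (top_of_set N) (N \<inter> h -` V)"
  using assms is_lift_continuous[OF assms(1)]
  by (intro continuous_openin_preimage[of _ _ "cdom d"]) (auto simp: is_lift_def)

lemma is_lift_compose:
  assumes "is_lift M f c d N h" "is_lift M g d e N' h'"
    and "openin (top_of_set M) (cdom d)"
  shows "is_lift M (\<lambda>p. g (f p)) c e (N \<inter> h -` N') (\<lambda>x. h' (h x))"
proof -
  note l = assms(1)[unfolded is_lift_def] and l' = assms(2)[unfolded is_lift_def]
  have "openin (top_of_set (cdom d)) N'"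
    using l' assms(3) by (meson openin_open_eq openin_subset_trans openin_imp_subset)
  then have op: "openin (top_of_set N) (N \<inter> h -` N')"
    by (rule is_lift_preimage[OF assms(1)])
  have r: "is_lift M f c d (N \<inter> h -` N') h"
    by (rule is_lift_restrict[OF assms(1) op])
  have "openin (top_of_set N') (h ` (N \<inter> h -` N'))"
  proof (rule openin_subset_trans)
    show "openin (top_of_set M) (h ` (N \<inter> h -` N'))"
      using r by (simp add: is_lift_def)
    show "N' \<subseteq> M"
      using l' by (meson openin_imp_subset)
  qed auto
  moreover have "diffeo_onto_image N' h'" "openin (top_of_set M) (h' ` N')"
    using l' by simp_all
  ultimately have "openin (top_of_set M) (h' ` h ` (N \<inter> h -` N'))"
    by (metis diffeo_onto_image_openin)
  moreover have "diffeo_onto_image (N \<inter> h -` N') (\<lambda>x. h' (h x))"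
    by (rule diffeo_onto_image_compose[of _ _ N']) (use r l' in \<open>auto simp: is_lift_def\<close>)
  moreover have "openin (top_of_set M) (N \<inter> h -` N')"
    using r by (simp add: is_lift_def)
  moreover have "cproj e (h' (h z)) = g (f (cproj c z))" if "z \<in> N \<inter> h -` N'" for z
    using l l' that by auto
  ultimately show ?thesis
    using l l' unfolding is_lift_def by (auto simp: image_image)
qed

lemma is_lift_inverse:
  assumes "is_lift M f c d N h" "\<And>z. z \<in> N \<Longrightarrow> g (f (cproj c z)) = cproj c z"
  shows "is_lift M g d c (h ` N) (inv_into N h)"
proof -
  note l = assms(1)[unfolded is_lift_def]
  have inv: "inv_into N h (h z) = z" if "z \<in> N" for z
    using l that by (simp add: diffeo_onto_image_def)
  then have "inv_into N h ` h ` N = N"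
    by (auto simp: image_image)
  moreover have "cproj c (inv_into N h (h z)) = g (cproj d (h z))" if "z \<in> N" for z
    using l that inv assms(2) by simp
  ultimately show ?thesis
    using l diffeo_onto_image_inv_into[of N h] unfolding is_lift_def by auto
qed

section \<open>Orbifolds from charts\<close>

lemma is_orb_chart_continuous_map:
  assumes "is_orb_chart M X c"
  shows "continuous_map (top_of_set (cdom c)) X (cproj c)"
  using assms unfolding is_orb_chart_def
  by (auto dest: quotient_imp_continuous_map continuous_map_into_fulltopology)

text \<open>The saturation of \<open>V\<close> is a union of preimages of \<open>V\<close> under
  group elements, which are continuous. It is therefore open, and the projection is a quotient map
  onto an open set.\<close>

lemma is_orb_chart_open_image:
  assumes c: "is_orb_chart M X c" and V: "openin (top_of_set (cdom c)) V"
  shows "openin X (cproj c ` V)"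
proof -
  note ch = c[unfolded is_orb_chart_def]
  have fibre: "cproj c x = cproj c y \<longleftrightarrow> (\<exists>g\<in>cgrp c. y = g x)" if "x \<in> cdom c" "y \<in> cdom c" for x y
    using ch that by blast
  have sub: "V \<subseteq> cdom c"
    using V by (rule openin_imp_subset)
  have maps: "g x \<in> cdom c" if "g \<in> cgrp c" "x \<in> cdom c" for g x
  proof -
    have "g \<in> Bij (cdom c)"
      using ch that(1) subgroup.subset[of "cgrp c" "BijGroup (cdom c)"] by (auto simp: BijGroup_def)
    with that show ?thesis by (auto simp: Bij_def bij_betw_def)
  qed
  have "cdom c \<inter> cproj c -` (cproj c ` V) = (\<Union>g\<in>cgrp c. cdom c \<inter> g -` V)"
  proof (intro equalityI subsetI)
    fix x assume "x \<in> cdom c \<inter> cproj c -` (cproj c ` V)"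
    then obtain y where y: "x \<in> cdom c" "y \<in> V" "cproj c x = cproj c y"
      by auto
    with sub obtain g where "g \<in> cgrp c" "y = g x"
      using fibre by (metis subsetD)
    with y show "x \<in> (\<Union>g\<in>cgrp c. cdom c \<inter> g -` V)"
      by auto
  next
    fix x assume "x \<in> (\<Union>g\<in>cgrp c. cdom c \<inter> g -` V)"
    then obtain g where g: "g \<in> cgrp c" "x \<in> cdom c" "g x \<in> V"
      by auto
    then have "cproj c x = cproj c (g x)"
      using fibre maps by blast
    with g show "x \<in> cdom c \<inter> cproj c -` (cproj c ` V)"
      by auto
  qed
  moreover have "openin (top_of_set (cdom c)) (cdom c \<inter> g -` V)" if "g \<in> cgrp c" for g
    using ch that V maps by (intro continuous_openin_preimage[of _ _ "cdom c"] smooth_on_continuous) auto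
  ultimately have "openin (top_of_set (cdom c)) (cdom c \<inter> cproj c -` (cproj c ` V))"
    by (simp only:) (rule openin_Union, blast)
  moreover have "topspace (subtopology X (cproj c ` cdom c)) = cproj c ` cdom c"
    using ch openin_subset[of X "cproj c ` cdom c"] by auto
  moreover have "quotient_map (top_of_set (cdom c)) (subtopology X (cproj c ` cdom c)) (cproj c)"
    using ch by blast
  ultimately have "openin (subtopology X (cproj c ` cdom c)) (cproj c ` V)"
    using sub unfolding quotient_map_def by (simp add: Int_def vimage_def image_mono)
  then show ?thesis
    using ch by (metis openin_trans_full)
qed

text \<open>Locally \<open>f\<close> is a lift preceded by a local section of the open map
  \<open>cproj c\<close> and followed by the continuous map \<open>cproj d\<close>. This gives
  continuity in both directions between the boundary and X from lifts alone.\<close>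

lemma continuous_map_from_lifts:
  assumes cont: "\<And>p. p \<in> topspace X \<Longrightarrow> \<exists>c d N h x. x \<in> N \<and> p = cproj c x \<and> is_lift M f c d N h \<and>
      openin (top_of_set M) (cdom c) \<and>
      (\<forall>V. openin (top_of_set (cdom c)) V \<longrightarrow> openin X (cproj c ` V)) \<and>
      continuous_map (top_of_set (cdom d)) Y (cproj d)"
  shows "continuous_map X Y f"
proof -
  have into: "f p \<in> topspace Y" if "p \<in> topspace X" for p
  proof -
    obtain c d N h x where "x \<in> N" "p = cproj c x" "is_lift M f c d N h"
      "continuous_map (top_of_set (cdom d)) Y (cproj d)"
      using cont[OF \<open>p \<in> topspace X\<close>] by blast
    then have "f p = cproj d (h x)" "h x \<in> cdom d"
      by (auto simp: is_lift_def)
    with \<open>continuous_map (top_of_set (cdom d)) Y (cproj d)\<close> show ?thesis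
      by (auto simp: continuous_map_def Pi_iff)
  qed
  have "openin X {p \<in> topspace X. f p \<in> U}" if U: "openin Y U" for U
  proof (subst openin_subopen, intro ballI)
    fix p assume p: "p \<in> {p \<in> topspace X. f p \<in> U}"
    then obtain c d N h x where h: "x \<in> N" "p = cproj c x" "is_lift M f c d N h"
      "openin (top_of_set M) (cdom c)"
      and opn: "\<And>V. openin (top_of_set (cdom c)) V \<Longrightarrow> openin X (cproj c ` V)"
      and d: "continuous_map (top_of_set (cdom d)) Y (cproj d)"
      using cont[of p] by blast
    have "openin (top_of_set (cdom d)) (cdom d \<inter> cproj d -` U)"
      using d U by (auto simp: continuous_map_def Int_def vimage_def)
    then have "openin (top_of_set N) (N \<inter> h -` (cdom d \<inter> cproj d -` U))"
      by (rule is_lift_preimage[OF h(3)])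
    moreover have "openin (top_of_set (cdom c)) N"
      using h(3,4) unfolding is_lift_def by (meson openin_subset_trans openin_imp_subset)
    ultimately have op: "openin X (cproj c ` (N \<inter> h -` (cdom d \<inter> cproj d -` U)))"
      by (blast intro: opn openin_trans)
    show "\<exists>T. openin X T \<and> p \<in> T \<and> T \<subseteq> {p \<in> topspace X. f p \<in> U}"
      using h p openin_subset[OF op] by (intro exI[of _ "cproj c ` (N \<inter> h -` (cdom d \<inter> cproj d -` U))"] conjI op)
        (auto simp: is_lift_def)
  qed
  with into show ?thesis
    by (auto simp: continuous_map_def)
qed

text \<open>The final topology with respect to the chart projections.\<close>

definition glue_topology :: "('e::topological_space, 'a) orb_chart set \<Rightarrow> 'a topology" where
  "glue_topology A = topology (\<lambda>U. U \<subseteq> (\<Union>c\<in>A. cproj c ` cdom c) \<and>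
     (\<forall>c\<in>A. openin (top_of_set (cdom c)) (cdom c \<inter> cproj c -` U)))"

lemma openin_glue_topology:
  "openin (glue_topology A) U \<longleftrightarrow> U \<subseteq> (\<Union>c\<in>A. cproj c ` cdom c) \<and>
     (\<forall>c\<in>A. openin (top_of_set (cdom c)) (cdom c \<inter> cproj c -` U))"
proof -
  have "istopology (\<lambda>U. U \<subseteq> (\<Union>c\<in>A. cproj c ` cdom c) \<and>
     (\<forall>c\<in>A. openin (top_of_set (cdom c)) (cdom c \<inter> cproj c -` U)))" (is "istopology ?P")
    unfolding istopology_def
  proof (rule conjI; intro allI impI)
    fix S T assume S: "?P S" and T: "?P T"
    have "cdom c \<inter> cproj c -` (S \<inter> T) = (cdom c \<inter> cproj c -` S) \<inter> (cdom c \<inter> cproj c -` T)" for c :: "('b, 'a) orb_chart"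
      by auto
    with S T show "?P (S \<inter> T)"
      by (metis (no_types, lifting) inf.coboundedI1 openin_Int)
  next
    fix \<K> assume K: "\<forall>K\<in>\<K>. ?P K"
    have "openin (top_of_set (cdom c)) (cdom c \<inter> cproj c -` (\<Union>\<K>))" if "c \<in> A" for c
    proof -
      have "cdom c \<inter> cproj c -` (\<Union>\<K>) = \<Union>((\<lambda>K. cdom c \<inter> cproj c -` K) ` \<K>)"
        by auto
      moreover have "openin (top_of_set (cdom c)) (\<Union>((\<lambda>K. cdom c \<inter> cproj c -` K) ` \<K>))"
        by (rule openin_Union) (use K that in auto)
      ultimately show ?thesis by (simp only:)
    qed
    moreover have "\<Union>\<K> \<subseteq> (\<Union>c\<in>A. cproj c ` cdom c)"
      by (rule Union_least) (use K in simp)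
    ultimately show "?P (\<Union>\<K>)"
      by (intro conjI ballI)
  qed
  then show ?thesis
    by (simp add: glue_topology_def topology_inverse')
qed

lemma topspace_glue_topology: "topspace (glue_topology A) = (\<Union>c\<in>A. cproj c ` cdom c)"
proof -
  have "openin (glue_topology A) (\<Union>c\<in>A. cproj c ` cdom c)"
    unfolding openin_glue_topology
  proof (intro conjI ballI)
    fix c assume "c \<in> A"
    then have "cdom c \<inter> cproj c -` (\<Union>c\<in>A. cproj c ` cdom c) = cdom c"
      by blast
    then show "openin (top_of_set (cdom c)) (cdom c \<inter> cproj c -` (\<Union>c\<in>A. cproj c ` cdom c))"
      by simp
  qed simp
  moreover have "topspace (glue_topology A) \<subseteq> (\<Union>c\<in>A. cproj c ` cdom c)"
    by (rule openin_glue_topology[THEN iffD1, OF openin_topspace, THEN conjunct1])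
  ultimately show ?thesis
    using openin_subset by blast
qed

lemma glue_topology_continuous_map:
  assumes "c \<in> A"
  shows "continuous_map (top_of_set (cdom c)) (glue_topology A) (cproj c)"
  using assms by (auto simp: continuous_map_def topspace_glue_topology openin_glue_topology Int_def vimage_def)

text \<open>The part of \<open>is_orbifold\<close> that makes sense before the underlying set has a
  topology.\<close>

definition compatible_charts :: "'e::euclidean_space set \<Rightarrow> ('e, 'a) orb_chart set \<Rightarrow> bool" where
  "compatible_charts M A \<longleftrightarrow> (\<forall>c\<in>A. openin (top_of_set M) (cdom c)) \<and>
     (\<forall>c\<in>A. \<forall>d\<in>A. \<forall>x\<in>cdom c. \<forall>y\<in>cdom d. cproj c x = cproj d y
         \<longrightarrow> (\<exists>N h. x \<in> N \<and> h x = y \<and> is_lift M (\<lambda>p. p) c d N h))"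

text \<open>Seen in another chart, the image of \<open>V\<close> is a union of preimages of
  \<open>V\<close> under changes of charts, each of them open.\<close>

lemma glue_topology_open_image:
  assumes A: "compatible_charts M A" and c: "c \<in> A" and V: "openin (top_of_set (cdom c)) V"
  shows "openin (glue_topology A) (cproj c ` V)"
  unfolding openin_glue_topology
proof (intro conjI ballI)
  have sub: "V \<subseteq> cdom c"
    using V by (rule openin_imp_subset)
  then show "cproj c ` V \<subseteq> (\<Union>c\<in>A. cproj c ` cdom c)"
    using c by blast
  fix d assume d: "d \<in> A"
  show "openin (top_of_set (cdom d)) (cdom d \<inter> cproj d -` cproj c ` V)"
  proof (subst openin_subopen, intro ballI)
    fix x assume "x \<in> cdom d \<inter> cproj d -` cproj c ` V"
    then obtain y where y: "x \<in> cdom d" "y \<in> V" "cproj d x = cproj c y"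
      by auto
    with A c d sub obtain N h where h: "x \<in> N" "h x = y" "is_lift M (\<lambda>p. p) d c N h"
      unfolding compatible_charts_def by (metis subsetD)
    have "openin (top_of_set (cdom d)) N"
      using h(3) A d unfolding is_lift_def compatible_charts_def
      by (meson openin_subset_trans openin_imp_subset)
    then have "openin (top_of_set (cdom d)) (N \<inter> h -` V)"
      by (rule openin_trans[OF is_lift_preimage[OF h(3) V]])
    moreover have "N \<inter> h -` V \<subseteq> cdom d \<inter> cproj d -` cproj c ` V"
      using h(3) unfolding is_lift_def by (blast intro: sym)
    ultimately show "\<exists>T. openin (top_of_set (cdom d)) T \<and> x \<in> T \<and> T \<subseteq> cdom d \<inter> cproj d -` cproj c ` V"
      using h y by (intro exI[of _ "N \<inter> h -` V"]) auto
  qed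
qed

text \<open>The images of a countable base under countably many open projections form a countable
  base.\<close>

lemma second_countable_glue_topology:
  assumes A: "compatible_charts M A" and "countable A"
  shows "second_countable (glue_topology A)"
proof -
  obtain B :: "'a set set" where B: "countable B" "\<And>C. C \<in> B \<Longrightarrow> open C"
    "\<And>S. open S \<Longrightarrow> \<exists>U. U \<subseteq> B \<and> S = \<Union>U"
    using univ_second_countable by blast
  let ?C = "\<Union>c\<in>A. (\<lambda>V. cproj c ` (cdom c \<inter> V)) ` B"
  show ?thesis
    unfolding second_countable_def
  proof (intro exI[of _ ?C] conjI ballI allI impI)
    show "countable ?C"
      using assms(2) B(1) by auto
    show "openin (glue_topology A) V" if "V \<in> ?C" for V
      using that B(2) by (auto intro!: glue_topology_open_image[OF A])
    fix U p assume U: "openin (glue_topology A) U \<and> p \<in> U"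
    then obtain c x where c: "c \<in> A" "x \<in> cdom c" "p = cproj c x"
      unfolding openin_glue_topology by blast
    have "openin (top_of_set (cdom c)) (cdom c \<inter> cproj c -` U)"
      using U c(1) unfolding openin_glue_topology by blast
    then obtain S where S: "open S" "cdom c \<inter> cproj c -` U = cdom c \<inter> S"
      by (auto simp: openin_open)
    have "x \<in> S"
      using S(2) U c by blast
    then obtain V where V: "V \<in> B" "x \<in> V" "V \<subseteq> S"
      using B(3)[OF S(1)] by blast
    show "\<exists>V\<in>?C. p \<in> V \<and> V \<subseteq> U"
      using S(2) V c by (intro bexI[of _ "cproj c ` (cdom c \<inter> V)"]) auto
  qed
qed

text \<open>Points with different values of \<open>P\<close> are separated by \<open>P\<close>.
  Points with the same value lie in one chart, where the orbits of a finite group of isometries can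
  be separated by balls.\<close>

lemma Hausdorff_glue_topology:
  fixes P :: "'a \<Rightarrow> 'm::t2_space" and A :: "('e::euclidean_space, 'a) orb_chart set"
  assumes A: "compatible_charts M A"
    and P: "\<And>c. c \<in> A \<Longrightarrow> continuous_on (cdom c) (\<lambda>x. P (cproj c x))"
    and common: "\<And>p q. p \<in> topspace (glue_topology A) \<Longrightarrow> q \<in> topspace (glue_topology A) \<Longrightarrow> P p = P q
        \<Longrightarrow> \<exists>c\<in>A. p \<in> cproj c ` cdom c \<and> q \<in> cproj c ` cdom c"
    and fin: "\<And>c. c \<in> A \<Longrightarrow> finite (cgrp c)"
    and iso: "\<And>c g x y. c \<in> A \<Longrightarrow> g \<in> cgrp c \<Longrightarrow> x \<in> cdom c \<Longrightarrow> y \<in> cdom c \<Longrightarrow> dist (g x) (g y) = dist x y"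
    and fibre: "\<And>c x y. c \<in> A \<Longrightarrow> x \<in> cdom c \<Longrightarrow> y \<in> cdom c \<Longrightarrow>
        cproj c x = cproj c y \<longleftrightarrow> (\<exists>g\<in>cgrp c. y = g x)"
  shows "Hausdorff_space (glue_topology A)"
  unfolding Hausdorff_space_def
proof (intro allI impI, elim conjE)
  fix p q assume p: "p \<in> topspace (glue_topology A)" and q: "q \<in> topspace (glue_topology A)" and "p \<noteq> q"
  show "\<exists>U V. openin (glue_topology A) U \<and> openin (glue_topology A) V \<and> p \<in> U \<and> q \<in> V \<and> disjnt U V"
  proof (cases "P p = P q")
    case False
    then obtain U V where UV: "open U" "open V" "P p \<in> U" "P q \<in> V" "U \<inter> V = {}"
      using hausdorff by metis
    have op: "openin (glue_topology A) (topspace (glue_topology A) \<inter> P -` T)" if "open T" for T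
      unfolding openin_glue_topology
    proof (intro conjI ballI)
      fix c assume c: "c \<in> A"
      have "cdom c \<inter> cproj c -` (topspace (glue_topology A) \<inter> P -` T) = cdom c \<inter> (\<lambda>x. P (cproj c x)) -` T"
        using c by (auto simp: topspace_glue_topology)
      then show "openin (top_of_set (cdom c)) (cdom c \<inter> cproj c -` (topspace (glue_topology A) \<inter> P -` T))"
        using continuous_openin_preimage_gen[OF P[OF c] that] by simp
    qed (auto simp: topspace_glue_topology)
    show ?thesis
      using op[OF UV(1)] op[OF UV(2)] UV(3-5) p q
      by (intro exI[of _ "topspace (glue_topology A) \<inter> P -` U"] exI[of _ "topspace (glue_topology A) \<inter> P -` V"])
        (auto simp: disjnt_def)
  next
    case True
    then obtain c x y where c: "c \<in> A" "x \<in> cdom c" "y \<in> cdom c" "p = cproj c x" "q = cproj c y"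
      using common[OF p q] by blast
    have ne: "dist (g x) y > 0" if "g \<in> cgrp c" for g
      using fibre[OF c(1-3)] \<open>p \<noteq> q\<close> c that by auto
    obtain e where e: "e > 0" "\<And>g. g \<in> cgrp c \<Longrightarrow> e \<le> dist (g x) y"
    proof -
      \<comment> \<open>The element 1 makes the set nonempty, as \<open>Min\<close> requires,
        without appeal to an identity in the group.\<close>
      let ?D = "insert 1 ((\<lambda>g. dist (g x) y) ` cgrp c)"
      have "finite ?D"
        using fin[OF c(1)] by simp
      then have "Min ?D > 0" "\<And>g. g \<in> cgrp c \<Longrightarrow> Min ?D \<le> dist (g x) y"
        using ne by (auto simp: Min_gr_iff)
      then show ?thesis using that by blast
    qed
    \<comment> \<open>Radius \<open>e/2\<close> works because group elements are isometries: if the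
      two images met, some \<open>g x\<close> would be closer than \<open>e\<close> to
      \<open>y\<close>.\<close>
    let ?U = "cproj c ` (cdom c \<inter> ball x (e/2))" and ?V = "cproj c ` (cdom c \<inter> ball y (e/2))"
    have "disjnt ?U ?V"
      unfolding disjnt_iff
    proof (intro allI notI, elim conjE imageE)
      fix r x' y' assume r: "r = cproj c x'" "r = cproj c y'" and x': "x' \<in> cdom c \<inter> ball x (e/2)"
        and y': "y' \<in> cdom c \<inter> ball y (e/2)"
      then obtain g where g: "g \<in> cgrp c" "y' = g x'"
        using fibre[OF c(1), of x' y'] by auto
      have "dist (g x) y \<le> dist (g x) (g x') + dist y' y"
        using g(2) dist_triangle by blast
      also have "dist (g x) (g x') = dist x x'"
        using iso[OF c(1) g(1)] x' c by auto
      also have "dist x x' + dist y' y < e"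
        using x' y' by (auto simp: dist_commute)
      finally show False
        using e(2)[OF g(1)] by simp
    qed
    moreover have "openin (glue_topology A) ?U" "openin (glue_topology A) ?V"
      by (auto intro!: glue_topology_open_image[OF A c(1)])
    ultimately show ?thesis
      using c e(1) by (intro exI[of _ ?U] exI[of _ ?V]) auto
  qed
qed

lemma is_orbifold_glue_topology:
  assumes A: "compatible_charts M A" "countable A" "Hausdorff_space (glue_topology A)"
    and grp: "\<And>c. c \<in> A \<Longrightarrow> finite (cgrp c) \<and> subgroup (cgrp c) (BijGroup (cdom c))"
    and smooth: "\<And>c g. c \<in> A \<Longrightarrow> g \<in> cgrp c \<Longrightarrow> smooth_on (cdom c) g"
    and effective: "\<And>c g V x. c \<in> A \<Longrightarrow> g \<in> cgrp c \<Longrightarrow> openin (top_of_set M) V \<Longrightarrow> V \<noteq> {} \<Longrightarrow> V \<subseteq> cdom c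
        \<Longrightarrow> \<forall>x\<in>V. g x = x \<Longrightarrow> x \<in> cdom c \<Longrightarrow> g x = x"
    and fibre: "\<And>c x y. c \<in> A \<Longrightarrow> x \<in> cdom c \<Longrightarrow> y \<in> cdom c \<Longrightarrow>
        cproj c x = cproj c y \<longleftrightarrow> (\<exists>g\<in>cgrp c. y = g x)"
  shows "is_orbifold M (glue_topology A) A"
  unfolding is_orbifold_def
proof (intro conjI)
  show "\<forall>c\<in>A. is_orb_chart M (glue_topology A) c"
  proof
    fix c assume c: "c \<in> A"
    have q: "quotient_map (top_of_set (cdom c)) (subtopology (glue_topology A) (cproj c ` cdom c)) (cproj c)"
    proof (rule continuous_open_imp_quotient_map)
      show "continuous_map (top_of_set (cdom c)) (subtopology (glue_topology A) (cproj c ` cdom c)) (cproj c)"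
        using glue_topology_continuous_map[OF c] by (simp add: continuous_map_in_subtopology)
      show "open_map (top_of_set (cdom c)) (subtopology (glue_topology A) (cproj c ` cdom c)) (cproj c)"
        unfolding open_map_def
        using glue_topology_open_image[OF A(1) c] openin_imp_subset
        by (metis image_mono openin_subtopology_Int2 inf.absorb_iff2)
      show "cproj c ` topspace (top_of_set (cdom c)) = topspace (subtopology (glue_topology A) (cproj c ` cdom c))"
        using c by (auto simp: topspace_glue_topology)
    qed
    have "openin (glue_topology A) (cproj c ` cdom c)"
      by (rule glue_topology_open_image[OF A(1) c]) simp
    then show "is_orb_chart M (glue_topology A) c"
      unfolding is_orb_chart_def
    proof (intro conjI)
      show "openin (top_of_set M) (cdom c)"
        using A(1) c by (simp add: compatible_charts_def)
    qed (use q grp[OF c] smooth[OF c] fibre[OF c] effective[OF c] in blast)+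
  qed
qed (use A second_countable_glue_topology[OF A(1,2)] in \<open>auto simp: topspace_glue_topology compatible_charts_def\<close>)

lemma is_orbifoldD:
  assumes "is_orbifold M X A" "c \<in> A" "d \<in> A" "x \<in> cdom c" "y \<in> cdom d" "cproj c x = cproj d y"
  shows "\<exists>N h. x \<in> N \<and> h x = y \<and> is_lift M (\<lambda>p. p) c d N h"
  using assms(1)[unfolded is_orbifold_def, THEN conjunct2, THEN conjunct2, THEN conjunct2, THEN conjunct2]
    assms(2-) by blast

text \<open>Smoothness of a torus action needs to be checked only for lifts of the action to each single chart,
  because the changes of charts do the rest.\<close>

lemma is_torus_orbifoldI:
  fixes X :: "('e::euclidean_space, 'a) torus_orb"
  assumes orb: "is_orbifold M (tspace X) (tatlas X)"
    and act: "\<And>t p. p \<in> topspace (tspace X) \<Longrightarrow> tact X t p \<in> topspace (tspace X)"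
      "\<And>p. p \<in> topspace (tspace X) \<Longrightarrow> tact X 0 p = p"
      "\<And>s t p. p \<in> topspace (tspace X) \<Longrightarrow> tact X (s + t) p = tact X s (tact X t p)"
    and eff: "\<And>t. (\<forall>p\<in>topspace (tspace X). tact X t p = p) \<longleftrightarrow> t \<in> lattice"
    and R: "\<And>c. c \<in> tatlas X \<Longrightarrow> smooth_on (UNIV \<times> cdom c) (\<lambda>(t, z). R c t z)"
      "\<And>c t. c \<in> tatlas X \<Longrightarrow> is_lift M (tact X t) c c (cdom c) (R c t)"
  shows "is_torus_orbifold M X"
proof -
  have "\<exists>S N F. open S \<and> t0 \<in> S \<and> x \<in> N \<and> F t0 x = y \<and>
           smooth_on (S \<times> N) (\<lambda>(t, z). F t z) \<and>
           (\<forall>t\<in>S. is_lift M (tact X t) c d N (F t))"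
    if c: "c \<in> tatlas X" and d: "d \<in> tatlas X" and x: "x \<in> cdom c" and y: "y \<in> cdom d"
      and t0: "tact X t0 (cproj c x) = cproj d y" for c d x y t0
  proof -
    note Rc = R(2)[OF c, unfolded is_lift_def]
    have opc: "openin (top_of_set M) (cdom c)"
      using orb c by (simp add: is_orbifold_def is_orb_chart_def)
    have Rd: "R c t ` cdom c \<subseteq> cdom c" for t
      using Rc[of t] by blast
    have x': "R c t0 x \<in> cdom c" and "cproj c (R c t0 x) = cproj d y"
      using Rc[of t0] x t0 by auto
    then have "\<exists>N h. R c t0 x \<in> N \<and> h (R c t0 x) = y \<and> is_lift M (\<lambda>p. p) c d N h"
      by (rule is_orbifoldD[OF orb c d _ y])
    then obtain N' h where h: "R c t0 x \<in> N'" "h (R c t0 x) = y" and l: "is_lift M (\<lambda>p. p) c d N' h"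
      by blast
    have N': "openin (top_of_set (cdom c)) N'"
      using l opc unfolding is_lift_def by (meson openin_subset_trans openin_imp_subset)
    have "(\<lambda>(t, z). R c t z) \<in> UNIV \<times> cdom c \<rightarrow> cdom c"
    proof (rule funcsetI)
      fix tz assume "tz \<in> (UNIV :: (real \<times> real) set) \<times> cdom c"
      then show "(\<lambda>(t, z). R c t z) tz \<in> cdom c"
        using Rd[of "fst tz"] by (cases tz) (simp add: image_subset_iff)
    qed
    then have "openin (top_of_set (UNIV \<times> cdom c)) ((UNIV \<times> cdom c) \<inter> (\<lambda>(t, z). R c t z) -` N')"
      by (rule continuous_openin_preimage[OF smooth_on_continuous[OF R(1)[OF c]] _ N'])
    then obtain T where T: "open T" "(UNIV \<times> cdom c) \<inter> (\<lambda>(t, z). R c t z) -` N' = (UNIV \<times> cdom c) \<inter> T"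
      by (auto simp: openin_open)
    have Tiff: "R c t z \<in> N' \<longleftrightarrow> (t, z) \<in> T" if "z \<in> cdom c" for t z
      using arg_cong[OF T(2), of "\<lambda>W. (t, z) \<in> W"] that by simp
    \<comment> \<open>A product neighbourhood of \<open>(t0, x)\<close> on which the family stays in
      the domain of the change of charts \<open>h\<close>; this makes the domain \<open>N\<close>
      independent of the parameter.\<close>
    with h(1) x obtain S V where SV: "open S" "open V" "t0 \<in> S" "x \<in> V" "S \<times> V \<subseteq> T"
      by (metis T(1) open_prod_elim mem_Sigma_iff)
    define N where "N = cdom c \<inter> V"
    have RN: "R c t z \<in> N'" if "t \<in> S" "z \<in> N" for t z
      using Tiff SV(5) that unfolding N_def by blast
    have opN: "openin (top_of_set (cdom c)) N"
      using SV(2) by (auto simp: N_def)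
    show ?thesis
    proof (intro exI[of _ S] exI[of _ N] exI[of _ "\<lambda>t z. h (R c t z)"] conjI ballI)
      have "smooth_on (S \<times> N) (\<lambda>(t, z). R c t z)"
        by (rule smooth_on_subset[OF R(1)[OF c]]) (auto simp: N_def)
      moreover have "smooth_on N' h"
        using l by (simp add: is_lift_def diffeo_onto_image_def)
      ultimately have "smooth_on (S \<times> N) (\<lambda>x. h ((\<lambda>(t, z). R c t z) x))"
        by (rule smooth_on_compose) (auto intro: RN)
      then show "smooth_on (S \<times> N) (\<lambda>(t, z). h (R c t z))"
        by (simp add: case_prod_unfold)
      fix t assume t: "t \<in> S"
      have "is_lift M (\<lambda>p. tact X t p) c d (N \<inter> R c t -` N') (\<lambda>x. h (R c t x))"
        by (rule is_lift_compose[OF is_lift_restrict[OF R(2)[OF c] opN] l opc])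
      moreover have "N \<inter> R c t -` N' = N"
        using RN[OF t] by auto
      ultimately show "is_lift M (tact X t) c d N (\<lambda>z. h (R c t z))"
        by simp
    qed (use SV x h in \<open>auto simp: N_def\<close>)
  qed
  with orb act eff show ?thesis
    unfolding is_torus_orbifold_def by (intro conjI ballI allI impI)
qed

section \<open>Orientability\<close>

text \<open>Also at a boundary point one can move inside the half-space by small positive multiples
  of every basis vector, and these directions determine the derivative.\<close>

lemma halfspace_derivative_unique:
  fixes f :: "real^('n::finite option) \<Rightarrow> 'b::real_normed_vector"
  assumes N: "openin (top_of_set halfspace) N" and x: "x \<in> N"
    and D: "(f has_derivative D) (at x within N)" "(f has_derivative D') (at x within N)"
  shows "D = D'"
  using D
proof (rule frechet_derivative_unique_within)
  fix i :: "real^('n option)" and e :: real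
  assume i: "i \<in> Basis" and e: "e > 0"
  obtain U where U: "open U" "N = halfspace \<inter> U"
    using N by (auto simp: openin_open)
  then obtain d where d: "d > 0" "ball x d \<subseteq> U"
    using x by (meson Int_iff open_contains_ball)
  let ?r = "min e d / 2"
  have "x + ?r *\<^sub>R i \<in> ball x d"
    using i d e by (simp add: dist_norm)
  moreover have "x + ?r *\<^sub>R i \<in> halfspace"
    using x U(2) i d e by (auto simp: halfspace_def Basis_vec_def axis_def)
  ultimately show "\<exists>r. 0 < \<bar>r\<bar> \<and> \<bar>r\<bar> < e \<and> x + r *\<^sub>R i \<in> N"
    using d U(2) e by (intro exI[of _ ?r]) auto
qed

lemma sgn_det_compose:
  fixes D D' :: "real^'n \<Rightarrow> real^'n"
  assumes "linear D" "linear D'"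
  shows "sgn (det (matrix (\<lambda>v. D' (D v)))) = sgn (det (matrix D')) * sgn (det (matrix D))"
  using matrix_compose[OF assms] by (simp add: o_def det_mul sgn_mult)

lemma continuous_on_det_matrix:
  fixes F :: "'a::topological_space \<Rightarrow> real^'n \<Rightarrow> real^'n"
  assumes "\<And>v. continuous_on S (\<lambda>x. F x v)"
  shows "continuous_on S (\<lambda>x. det (matrix (F x)))"
  unfolding det_def matrix_def
  by (auto intro!: continuous_intros assms)

text \<open>The derivative is taken within \<open>N\<close>, since \<open>N\<close> may contain
  boundary points of the half-space.\<close>

definition signed_lift ::
  "(real^'n) set \<Rightarrow> ('a \<Rightarrow> 'b) \<Rightarrow> (real^'n, 'a) orb_chart \<Rightarrow> (real^'n, 'b) orb_chart
     \<Rightarrow> (real^'n) set \<Rightarrow> (real^'n \<Rightarrow> real^'n) \<Rightarrow> real \<Rightarrow> bool" where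
  "signed_lift M f c d N h \<sigma> \<longleftrightarrow> is_lift M f c d N h \<and>
     (\<forall>z\<in>N. \<exists>D. (h has_derivative D) (at z within N) \<and> sgn (det (matrix D)) = \<sigma>)"

lemma signed_lift_compose:
  assumes "signed_lift M f c d N h \<sigma>" "signed_lift M g d e N' h' \<tau>"
    and "openin (top_of_set M) (cdom d)"
  shows "signed_lift M (\<lambda>p. g (f p)) c e (N \<inter> h -` N') (\<lambda>x. h' (h x)) (\<sigma> * \<tau>)"
  unfolding signed_lift_def
proof (intro conjI ballI)
  show "is_lift M (\<lambda>p. g (f p)) c e (N \<inter> h -` N') (\<lambda>x. h' (h x))"
    using assms by (auto simp: signed_lift_def intro: is_lift_compose)
  fix z assume z: "z \<in> N \<inter> h -` N'"
  then obtain D D' where D: "(h has_derivative D) (at z within N)" "sgn (det (matrix D)) = \<sigma>"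
    and D': "(h' has_derivative D') (at (h z) within N')" "sgn (det (matrix D')) = \<tau>"
    using assms unfolding signed_lift_def by blast
  have "((\<lambda>x. h' (h x)) has_derivative (\<lambda>v. D' (D v))) (at z within N \<inter> h -` N')"
    by (rule has_derivative_in_compose[OF has_derivative_subset[OF D(1)] has_derivative_subset[OF D'(1)]]) auto
  moreover have "sgn (det (matrix (\<lambda>v. D' (D v)))) = \<sigma> * \<tau>"
    using sgn_det_compose[OF has_derivative_linear[OF D(1)] has_derivative_linear[OF D'(1)]] D(2) D'(2) by simp
  ultimately show "\<exists>D. ((\<lambda>x. h' (h x)) has_derivative D) (at z within N \<inter> h -` N') \<and> sgn (det (matrix D)) = \<sigma> * \<tau>"
    by blast
qed

lemma signed_lift_cong:
  "signed_lift M f c d N h \<sigma> \<Longrightarrow> (\<And>z. z \<in> N \<Longrightarrow> f (cproj c z) = g (cproj c z)) \<Longrightarrow> signed_lift M g c d N h \<sigma>"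
  by (auto simp: signed_lift_def intro: is_lift_cong)

text \<open>The chain rule for the inverse, together with uniqueness of derivatives on the
  half-space, gives a left inverse of \<open>D\<close>.\<close>

lemma diffeo_halfspace_derivative_nonsingular:
  fixes h :: "real^('n::finite option) \<Rightarrow> real^('n option)"
  assumes N: "openin (top_of_set halfspace) N" and h: "diffeo_onto_image N h"
    and x: "x \<in> N" and D: "(h has_derivative D) (at x within N)"
  shows "det (matrix D) \<noteq> 0"
proof -
  obtain D' where D': "(inv_into N h has_derivative D') (at (h x) within h ` N)"
    using smooth_on_has_derivative[of "h ` N" "inv_into N h" "h x"] h x by (auto simp: diffeo_onto_image_def)
  have "((\<lambda>z. inv_into N h (h z)) has_derivative (\<lambda>v. D' (D v))) (at x within N)"
    by (rule has_derivative_in_compose[OF D D'])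
  moreover have inv: "inv_into N h (h z) = z" if "z \<in> N" for z
    using h that by (simp add: diffeo_onto_image_def)
  then have "((\<lambda>z. inv_into N h (h z)) has_derivative (\<lambda>v. v)) (at x within N)"
    using has_derivative_transform[OF x inv has_derivative_ident] by simp
  ultimately have "(\<lambda>v. D' (D v)) = (\<lambda>v. v)"
    by (rule halfspace_derivative_unique[OF N x])
  then have "matrix D' ** matrix D = mat 1"
    using matrix_compose[OF has_derivative_linear[OF D] has_derivative_linear[OF D']]
    by (simp add: o_def matrix_id_mat_1[unfolded id_def])
  then have "det (matrix D') * det (matrix D) = 1"
    by (metis det_I det_mul)
  then show ?thesis by auto
qed

text \<open>Uniqueness identifies the derivatives of \<open>h\<close> with those of a local smooth
  extension. The determinant of the latter is continuous and does not vanish at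
  \<open>x\<close>.\<close>

lemma diffeo_halfspace_sign_locally_constant:
  fixes h :: "real^('n::finite option) \<Rightarrow> real^('n option)"
  assumes N: "openin (top_of_set halfspace) N" and h: "diffeo_onto_image N h"
    and x: "x \<in> N" and D: "(h has_derivative D) (at x within N)"
  obtains U where "open U" "x \<in> U"
    "\<And>y D'. y \<in> U \<inter> N \<Longrightarrow> (h has_derivative D') (at y within N) \<Longrightarrow> sgn (det (matrix D')) = sgn (det (matrix D))"
proof -
  have "smooth_on N h"
    using h by (simp add: diffeo_onto_image_def)
  then obtain U g where U: "x \<in> U" "Cinf_on U g" "\<forall>y\<in>U \<inter> N. g y = h y"
    using x by (rule smooth_onE)
  have op: "open U" and C: "Ck_on k U g" for k
    using U(2) unfolding Cinf_on_def by auto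
  let ?Dg = "\<lambda>y. frechet_derivative g (at y)"
  have eq: "D' = ?Dg y" if y: "y \<in> U \<inter> N" and D': "(h has_derivative D') (at y within N)" for y D'
  proof (rule halfspace_derivative_unique[OF N _ D'])
    obtain e where e: "e > 0" "ball y e \<subseteq> U"
      using op y by (meson Int_iff open_contains_ball)
    have "(g has_derivative ?Dg y) (at y within N)"
      using Ck_on_has_derivative[OF C] y by (blast intro: has_derivative_at_withinI)
    then show "(h has_derivative ?Dg y) (at y within N)"
      by (rule has_derivative_transform_within[OF _ e(1)]) (use y e U(3) in \<open>auto simp: dist_commute subset_iff\<close>)
  qed (use y in auto)
  have "continuous_on U (\<lambda>y. ?Dg y v)" for v
    using Ck_on_frechet_derivative[OF C[of "Suc 0"], of v] by simp
  then have cont: "continuous_on U (\<lambda>y. det (matrix (?Dg y)))"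
    by (rule continuous_on_det_matrix)
  have "D = ?Dg x"
    using eq U(1) x D by blast
  then have "det (matrix (?Dg x)) \<noteq> 0"
    using diffeo_halfspace_derivative_nonsingular[OF assms] by simp
  define T where "T = (if det (matrix (?Dg x)) > 0 then {0<..} else {..<0::real})"
  have T: "open T" "det (matrix (?Dg x)) \<in> T" "\<And>r. r \<in> T \<Longrightarrow> sgn r = sgn (det (matrix (?Dg x)))"
    using \<open>det (matrix (?Dg x)) \<noteq> 0\<close> by (auto simp: T_def split: if_splits)
  show thesis
  proof (rule that[of "U \<inter> (\<lambda>y. det (matrix (?Dg y))) -` T"])
    show "open (U \<inter> (\<lambda>y. det (matrix (?Dg y))) -` T)"
      by (rule continuous_open_preimage[OF cont op T(1)])
    show "x \<in> U \<inter> (\<lambda>y. det (matrix (?Dg y))) -` T"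
      using U(1) T(2) by simp
    fix y D' assume y: "y \<in> U \<inter> (\<lambda>y. det (matrix (?Dg y))) -` T \<inter> N"
      and D': "(h has_derivative D') (at y within N)"
    then have "D' = ?Dg y"
      using eq by blast
    with y T(3) \<open>D = ?Dg x\<close> show "sgn (det (matrix D')) = sgn (det (matrix D))"
      by simp
  qed
qed

text \<open>At a point of \<open>Reg d\<close>, where the group acts freely, any lift agrees near that point with the
  composition of a given lift and a group element; density of \<open>Reg d\<close> does the rest.\<close>

lemma orientable_orbifoldI:
  fixes A :: "(real^('n::finite option), 'a) orb_chart set"
  assumes dom: "\<And>c. c \<in> A \<Longrightarrow> openin (top_of_set halfspace) (cdom c)"
    and grp: "\<And>c. c \<in> A \<Longrightarrow> finite (cgrp c)"
    and fibre: "\<And>c x y. c \<in> A \<Longrightarrow> x \<in> cdom c \<Longrightarrow> y \<in> cdom c \<Longrightarrow>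
        cproj c x = cproj c y \<longleftrightarrow> (\<exists>g\<in>cgrp c. y = g x)"
    and grp_pos: "\<And>c g x. c \<in> A \<Longrightarrow> g \<in> cgrp c \<Longrightarrow> x \<in> cdom c \<Longrightarrow>
        \<exists>D. (g has_derivative D) (at x within cdom c) \<and> det (matrix D) > 0"
    and dense: "\<And>c V. c \<in> A \<Longrightarrow> openin (top_of_set halfspace) V \<Longrightarrow> V \<noteq> {} \<Longrightarrow> V \<subseteq> cdom c \<Longrightarrow> V \<inter> Reg c \<noteq> {}"
    and free: "\<And>c x g g'. c \<in> A \<Longrightarrow> x \<in> cdom c \<inter> Reg c \<Longrightarrow> g \<in> cgrp c \<Longrightarrow> g' \<in> cgrp c \<Longrightarrow> g x = g' x \<Longrightarrow> g = g'"
    and lift: "\<And>c d x y. c \<in> A \<Longrightarrow> d \<in> A \<Longrightarrow> x \<in> cdom c \<Longrightarrow> y \<in> cdom d \<Longrightarrow> cproj c x = cproj d y \<Longrightarrow>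
        \<exists>N h. x \<in> N \<and> h x = y \<and> signed_lift halfspace (\<lambda>p. p) c d N h (s c * s d)"
    and s: "\<And>c. c \<in> A \<Longrightarrow> s c \<in> {-1, 1 :: real}"
  shows "orientable_orbifold halfspace A"
  unfolding orientable_orbifold_def
proof (intro exI[of _ "\<lambda>c x. s c"] conjI ballI allI impI)
  fix c d N h x D
  assume c: "c \<in> A" and d: "d \<in> A" and h: "is_lift halfspace (\<lambda>p. p) c d N h"
    and x: "x \<in> N" and D: "(h has_derivative D) (at x within N)"
  have N: "openin (top_of_set halfspace) N" "N \<subseteq> cdom c" "diffeo_onto_image N h" "h ` N \<subseteq> cdom d"
    "\<And>z. z \<in> N \<Longrightarrow> cproj d (h z) = cproj c z"
    using h by (simp_all add: is_lift_def)
  obtain U where U: "open U" "x \<in> U"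
    "\<And>y D'. y \<in> U \<inter> N \<Longrightarrow> (h has_derivative D') (at y within N) \<Longrightarrow> sgn (det (matrix D')) = sgn (det (matrix D))"
    using diffeo_halfspace_sign_locally_constant[OF N(1,3) x D] by blast
  have "x \<in> cdom c" "h x \<in> cdom d" "cproj c x = cproj d (h x)"
    using x N by auto
  then obtain N' k where k: "x \<in> N'" "k x = h x" "signed_lift halfspace (\<lambda>p. p) c d N' k (s c * s d)"
    using lift[OF c d] by blast
  then have kl: "is_lift halfspace (\<lambda>p. p) c d N' k"
    by (simp add: signed_lift_def)
  have N': "openin (top_of_set halfspace) N'" "k ` N' \<subseteq> cdom d" "\<And>z. z \<in> N' \<Longrightarrow> cproj d (k z) = cproj c z"
    using kl by (simp_all add: is_lift_def)
  \<comment> \<open>Here both lifts are defined and the sign of the derivative of \<open>h\<close>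
    is the one at \<open>x\<close>, so the sign may be computed at any other point of
    \<open>N1\<close>.\<close>
  define N1 where "N1 = N \<inter> N' \<inter> U"
  have N1: "openin (top_of_set halfspace) N1"
    unfolding N1_def using N(1) N'(1) U(1) by (auto intro: openin_Int_open)
  have "openin (top_of_set N') N1"
    by (rule openin_subset_trans[OF N1 _ openin_imp_subset[OF N'(1)]]) (auto simp: N1_def)
  then have "openin (top_of_set halfspace) (k ` N1)"
    using is_lift_restrict[OF kl] by (simp add: is_lift_def)
  moreover have "k ` N1 \<noteq> {}" "k ` N1 \<subseteq> cdom d"
    using x k(1) U(2) N'(2) by (auto simp: N1_def)
  ultimately have "k ` N1 \<inter> Reg d \<noteq> {}"
    by (rule dense[OF d])
  then obtain x' where x': "x' \<in> N1" "k x' \<in> Reg d"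
    by blast
  have hk: "\<exists>g\<in>cgrp d. h z = g (k z)" if "z \<in> N1" for z
  proof -
    have "z \<in> N" "z \<in> N'"
      using that by (auto simp: N1_def)
    then have "k z \<in> cdom d" "h z \<in> cdom d" "cproj d (k z) = cproj d (h z)"
      using N(4,5) N'(2,3) by auto
    then show ?thesis
      using fibre[OF d] by blast
  qed
  then obtain g0 where g0: "g0 \<in> cgrp d" "h x' = g0 (k x')"
    using x'(1) by blast
  have gcont: "continuous_on (cdom d) g" if "g \<in> cgrp d" for g
    using grp_pos[OF d that] by (auto simp: continuous_on_eq_continuous_within intro: has_derivative_continuous)
  \<comment> \<open>Finitely many open conditions exclude every group element except
    \<open>g0\<close>. They hold at \<open>x'\<close> because the group acts freely at
    \<open>k x'\<close>; hence \<open>h\<close> is \<open>g0\<close> after \<open>k\<close> on all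
    of \<open>N2\<close>.\<close>
  define N2 where "N2 = N1 \<inter> (\<Inter>g\<in>cgrp d - {g0}. {z \<in> N1. h z \<noteq> g (k z)})"
  have ne_open: "openin (top_of_set N1) {z \<in> N1. h z \<noteq> g (k z)}" if "g \<in> cgrp d" for g
  proof -
    have "continuous_on N1 (\<lambda>z. g (k z))"
    proof (rule continuous_on_compose2[OF gcont[OF that]])
      show "continuous_on N1 k"
        by (rule continuous_on_subset[OF is_lift_continuous[OF kl]]) (auto simp: N1_def)
    qed (use N'(2) in \<open>auto simp: N1_def\<close>)
    moreover have "continuous_on N1 h"
      by (rule continuous_on_subset[OF is_lift_continuous[OF h]]) (auto simp: N1_def)
    ultimately have "continuous_on N1 (\<lambda>z. h z - g (k z))"
      by (intro continuous_intros)
    then have "openin (top_of_set N1) (N1 \<inter> (\<lambda>z. h z - g (k z)) -` (- {0}))"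
      by (rule continuous_openin_preimage_gen) auto
    moreover have "N1 \<inter> (\<lambda>z. h z - g (k z)) -` (- {0}) = {z \<in> N1. h z \<noteq> g (k z)}"
      by auto
    ultimately show ?thesis by simp
  qed
  have "openin (top_of_set N1) N2"
  \<comment> \<open>Finite intersections of relatively open sets need a nonempty family, hence the
    separate case of a trivial group.\<close>
  proof (cases "cgrp d - {g0} = {}")
    case False
    then show ?thesis
      unfolding N2_def
    proof (intro openin_Int openin_subtopology_self openin_Inter)
      show "finite ((\<lambda>g. {z \<in> N1. h z \<noteq> g (k z)}) ` (cgrp d - {g0}))"
        using grp[OF d] by simp
      show "(\<lambda>g. {z \<in> N1. h z \<noteq> g (k z)}) ` (cgrp d - {g0}) \<noteq> {}"
        using False by blast
    qed (use ne_open in blast)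
  qed (simp only: N2_def image_empty Inter_empty Int_UNIV_right openin_subtopology_self)
  then have N2: "openin (top_of_set halfspace) N2"
    using N1 by (rule openin_trans)
  have kx'd: "k x' \<in> cdom d \<inter> Reg d"
    using x' N'(2) by (auto simp: N1_def)
  have x'2: "x' \<in> N2"
    using x'(1) free[OF d kx'd _ g0(1)] g0(2) by (auto simp: N2_def)
  have h_eq: "h z = g0 (k z)" if "z \<in> N2" for z
  proof -
    have "z \<in> N1" and ne: "\<And>g. g \<in> cgrp d \<Longrightarrow> g \<noteq> g0 \<Longrightarrow> h z \<noteq> g (k z)"
      using that by (auto simp: N2_def)
    with hk[OF \<open>z \<in> N1\<close>] show ?thesis by blast
  qed
  have sub: "N2 \<subseteq> N" "N2 \<subseteq> N'" "x' \<in> N" "x' \<in> N'" "x' \<in> U \<inter> N"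
    using x' by (auto simp: N2_def N1_def)
  obtain D1 where D1: "(h has_derivative D1) (at x' within N)"
    using smooth_on_has_derivative[of N h x'] N(3) sub by (auto simp: diffeo_onto_image_def)
  obtain Dk where Dk: "(k has_derivative Dk) (at x' within N')" "sgn (det (matrix Dk)) = s c * s d"
    using k(3) sub by (auto simp: signed_lift_def)
  obtain Dg where Dg: "(g0 has_derivative Dg) (at (k x') within cdom d)" "det (matrix Dg) > 0"
    using grp_pos[OF d g0(1)] kx'd by blast
  have gk: "((\<lambda>z. g0 (k z)) has_derivative (\<lambda>v. Dg (Dk v))) (at x' within N2)"
    by (rule has_derivative_in_compose[OF has_derivative_subset[OF Dk(1) sub(2)] has_derivative_subset[OF Dg(1)]])
      (use sub N'(2) in auto)
  have "(h has_derivative (\<lambda>v. Dg (Dk v))) (at x' within N2)"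
    by (rule has_derivative_transform[OF x'2 h_eq gk])
  then have "D1 = (\<lambda>v. Dg (Dk v))"
    by (rule halfspace_derivative_unique[OF N2 x'2 has_derivative_subset[OF D1 sub(1)]])
  then have "sgn (det (matrix D1)) = s c * s d"
    using sgn_det_compose[OF has_derivative_linear[OF Dk(1)] has_derivative_linear[OF Dg(1)]] Dk(2) Dg(2) by simp
  \<comment> \<open>The sign found at \<open>x'\<close> is carried back to \<open>x\<close> by its
    constancy on \<open>U\<close>.\<close>
  with U(3)[OF sub(5) D1] show "sgn (det (matrix D)) = s c * s d"
    by simp
qed (use s in \<open>auto intro: continuous_intros\<close>)

section \<open>Complex coordinates on the half-space\<close>

definition of_C5 :: "complex \<times> complex \<times> real \<Rightarrow> real^(4 option)" where
  "of_C5 p = (\<chi> i. case i of None \<Rightarrow> snd (snd p) | Some j \<Rightarrow> of_C2 (fst p, fst (snd p)) $ j)"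

definition to_C5 :: "real^(4 option) \<Rightarrow> complex \<times> complex \<times> real" where
  "to_C5 x = (Complex (x $ Some 1) (x $ Some 2), Complex (x $ Some 3) (x $ Some 4), x $ None)"

abbreviation z_of :: "real^(4 option) \<Rightarrow> complex" where "z_of x \<equiv> fst (to_C5 x)"

abbreviation y_of :: "real^(4 option) \<Rightarrow> complex" where "y_of x \<equiv> fst (snd (to_C5 x))"

abbreviation h_of :: "real^(4 option) \<Rightarrow> real" where "h_of x \<equiv> snd (snd (to_C5 x))"

lemma UNIV_option_4: "(UNIV :: 4 option set) = {None, Some 1, Some 2, Some 3, Some 4}"
  by (simp add: UNIV_option_conv UNIV_4)

lemma forall_option_4: "(\<forall>i :: 4 option. P i) \<longleftrightarrow> P None \<and> P (Some 1) \<and> P (Some 2) \<and> P (Some 3) \<and> P (Some 4)"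
  by (metis exhaust_4 option.exhaust)

lemma vector_4 [simp]:
  "(vector [a, b, c, d] :: ('a::zero)^4) $ 1 = a"
  "(vector [a, b, c, d] :: ('a::zero)^4) $ 2 = b"
  "(vector [a, b, c, d] :: ('a::zero)^4) $ 3 = c"
  "(vector [a, b, c, d] :: ('a::zero)^4) $ 4 = d"
  unfolding vector_def by simp_all

lemma of_C5_nth [simp]:
  "of_C5 p $ None = snd (snd p)" "of_C5 p $ Some 1 = Re (fst p)" "of_C5 p $ Some 2 = Im (fst p)"
  "of_C5 p $ Some 3 = Re (fst (snd p))" "of_C5 p $ Some 4 = Im (fst (snd p))"
  by (simp_all add: of_C5_def of_C2_def)

lemma to_of_C5 [simp]: "to_C5 (of_C5 p) = p"
  by (simp add: to_C5_def)

lemma of_to_C5 [simp]: "of_C5 (to_C5 x) = x"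
  by (simp add: vec_eq_iff forall_option_4) (simp add: to_C5_def)

lemma linear_to_C5: "linear to_C5"
  by (intro linearI) (auto simp: to_C5_def complex_eq_iff)

lemma linear_of_C5: "linear of_C5"
  by (intro linearI) (auto simp: vec_eq_iff forall_option_4)

lemmas bounded_linear_to_C5 = linear_to_C5[THEN linear_conv_bounded_linear[THEN iffD1]]
  and bounded_linear_of_C5 = linear_of_C5[THEN linear_conv_bounded_linear[THEN iffD1]]

lemma continuous_on_to_C5 [continuous_intros]: "continuous_on S f \<Longrightarrow> continuous_on S (\<lambda>x. to_C5 (f x))"
  by (rule bounded_linear.continuous_on[OF bounded_linear_to_C5])

lemma continuous_on_of_C5 [continuous_intros]: "continuous_on S f \<Longrightarrow> continuous_on S (\<lambda>x. of_C5 (f x))"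
  by (rule bounded_linear.continuous_on[OF bounded_linear_of_C5])

lemma halfspace_iff: "x \<in> halfspace \<longleftrightarrow> 0 \<le> h_of x"
  by (simp add: halfspace_def to_C5_def)

lemma of_C5_halfspace: "of_C5 p \<in> halfspace \<longleftrightarrow> 0 \<le> snd (snd p)"
  by (simp add: halfspace_iff)

lemma norm_of_C5: "(norm (of_C5 p))\<^sup>2 = (cmod (fst p))\<^sup>2 + (cmod (fst (snd p)))\<^sup>2 + (snd (snd p))\<^sup>2"
  unfolding power2_norm_eq_inner[of "of_C5 p"]
  by (simp add: inner_vec_def UNIV_option_4 cmod_power2 flip: power2_eq_square)

lemma Cinf_on_of_C5:
  assumes "Cinf_on U f" "Cinf_on U g" "Cinf_on U h"
  shows "Cinf_on U (\<lambda>x. of_C5 (f x, g x, h x))"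
proof -
  have lin: "bounded_linear (\<lambda>z. of_C5 (z, 0, 0))" "bounded_linear (\<lambda>y. of_C5 (0, y, 0))"
    "bounded_linear (\<lambda>r. of_C5 (0, 0, r))"
    by (auto intro!: linearI simp: linear_conv_bounded_linear[symmetric] vec_eq_iff forall_option_4)
  have "of_C5 (f x, g x, h x) = of_C5 (f x, 0, 0) + of_C5 (0, g x, 0) + of_C5 (0, 0, h x)" for x
    by (simp add: vec_eq_iff forall_option_4)
  with assms show ?thesis
    by (simp add: Cinf_on_add Cinf_on_linear[OF lin(1)] Cinf_on_linear[OF lin(2)] Cinf_on_linear[OF lin(3)])
qed

lemma bounded_linear_C5_coords:
  "bounded_linear (\<lambda>x. z_of x)" "bounded_linear (\<lambda>x. y_of x)"
  "bounded_linear (\<lambda>x. h_of x)"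
  by (intro bounded_linear_to_C5 bounded_linear_compose[OF bounded_linear_fst] bounded_linear_compose[OF bounded_linear_snd])+

section \<open>Signs of determinants\<close>

text \<open>The determinant of a square is a square. Rotations and shears have evident square roots,
  so their orientation needs no matrix computation.\<close>

lemma det_matrix_square_pos:
  fixes T T' :: "real^'n \<Rightarrow> real^'n"
  assumes "linear T" "linear T'" "\<And>v. T (T' v) = v"
  shows "det (matrix (\<lambda>v. T (T v))) > 0"
proof -
  have "matrix T ** matrix T' = matrix (\<lambda>v. v)"
    using matrix_compose[OF assms(2,1)] assms(3) by (simp add: o_def)
  also have "\<dots> = mat 1"
    using matrix_id_mat_1 by (simp only: id_def)
  finally have "det (matrix T) * det (matrix T') = 1"
    by (simp add: det_mul[symmetric])
  then have "det (matrix T) \<noteq> 0" by auto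
  then show ?thesis
    using matrix_compose[OF assms(1,1)] by (auto simp: o_def det_mul zero_less_mult_iff linorder_neq_iff)
qed

lemma det_matrix_diagonal:
  fixes d :: "'n::finite \<Rightarrow> real"
  shows "det (matrix (\<lambda>v :: real^'n. \<chi> i. d i * v $ i)) = prod d UNIV"
  by (subst det_diagonal) (auto simp: matrix_def axis_def)

text \<open>Conjugation by an orthogonal map that takes \<open>a\<close> to a multiple of a
  coordinate vector makes the reflection diagonal, with a single entry -1.\<close>

lemma det_matrix_reflection:
  fixes a :: "real^'n"
  assumes "a \<noteq> 0"
  shows "det (matrix (\<lambda>v. v - (2 * (a \<bullet> v) / (a \<bullet> a)) *\<^sub>R a)) = -1"
proof -
  define R where "R = (\<lambda>(a :: real^'n) v. v - (2 * (a \<bullet> v) / (a \<bullet> a)) *\<^sub>R a)"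
  have lin: "linear (R b)" for b
    unfolding R_def by (intro linearI) (auto simp: algebra_simps inner_simps add_divide_distrib)
  \<comment> \<open>Any coordinate axis will do.\<close>
  fix k :: 'n
  let ?e = "norm a *\<^sub>R axis k 1 :: real^'n"
  have ne: "norm a = norm ?e" by simp
  obtain f where f: "orthogonal_transformation f" "f a = ?e"
    using orthogonal_transformation_exists[OF ne] by blast
  have lf: "linear f"
    using f(1) by (rule orthogonal_transformation_linear)
  have "(\<lambda>v. f (R a v)) = (\<lambda>v. R ?e (f v))"
    using f(1) unfolding R_def f(2)[symmetric] orthogonal_transformation_def
    by (simp add: linear_diff linear_scale fun_eq_iff)
  then have "matrix f ** matrix (R a) = matrix (R ?e) ** matrix f"
    by (simp only: matrix_compose[OF lin lf, unfolded o_def, symmetric] matrix_compose[OF lf lin, unfolded o_def, symmetric])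
  then have "det (matrix f) * det (matrix (R a)) = det (matrix f) * det (matrix (R ?e))"
    by (metis det_mul mult.commute)
  moreover have "det (matrix f) \<noteq> 0"
    using det_orthogonal_matrix[of "matrix f"] f(1) orthogonal_transformation_matrix[of f] by auto
  ultimately have "det (matrix (R a)) = det (matrix (R ?e))" by simp
  also have "R ?e = (\<lambda>v. \<chi> i. (if i = k then -1 else 1) * v $ i)"
  proof
    fix v :: "real^'n"
    have "R ?e v = v - (2 * v $ k) *\<^sub>R axis k 1"
      using assms by (simp add: R_def inner_axis')
    then show "R ?e v = (\<chi> i. (if i = k then -1 else 1) * v $ i)"
      by (simp add: vec_eq_iff axis_def)
  qed
  also have "det (matrix \<dots>) = -1"
    by (subst det_matrix_diagonal) (simp add: prod.If_cases)
  finally show ?thesis by (simp add: R_def)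
qed

section \<open>The building blocks of the changes of charts\<close>

text \<open>Angles are counted in full turns, so that they are the coefficients of the frame vectors
  in the Lie algebra of the torus.\<close>

definition rot :: "real \<Rightarrow> real \<Rightarrow> real^(4 option) \<Rightarrow> real^(4 option)" where
  "rot \<alpha> \<beta> x = of_C5 (cis (2 * pi * \<alpha>) * z_of x, cis (2 * pi * \<beta>) * y_of x, h_of x)"

lemma rot_0 [simp]: "rot 0 0 x = x"
  by (simp add: rot_def)

lemma rot_rot: "rot \<alpha> \<beta> (rot \<gamma> \<delta> x) = rot (\<alpha> + \<gamma>) (\<beta> + \<delta>) x"
  by (simp add: rot_def cis_mult[symmetric] distrib_left mult.assoc)

lemma rot_minus [simp]: "rot \<alpha> \<beta> (rot (-\<alpha>) (-\<beta>) x) = x" "rot (-\<alpha>) (-\<beta>) (rot \<alpha> \<beta> x) = x"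
  by (simp_all add: rot_rot)

lemma linear_rot: "linear (rot \<alpha> \<beta>)"
proof -
  have "linear (\<lambda>p :: complex \<times> complex \<times> real. (cis (2 * pi * \<alpha>) * fst p, cis (2 * pi * \<beta>) * fst (snd p), snd (snd p)))"
    by (intro linearI) (auto simp: algebra_simps)
  from linear_compose[OF linear_to_C5 linear_compose[OF this linear_of_C5]]
  show ?thesis by (simp add: o_def rot_def[abs_def])
qed

lemma rot_halfspace [simp]: "rot \<alpha> \<beta> x \<in> halfspace \<longleftrightarrow> x \<in> halfspace"
  by (simp add: halfspace_iff rot_def)

lemma rot_image_halfspace: "rot \<alpha> \<beta> ` halfspace = halfspace"
  by (auto intro!: image_eqI[of _ _ "rot (-\<alpha>) (-\<beta>) _"])

lemma dist_rot: "dist (rot \<alpha> \<beta> x) (rot \<alpha> \<beta> y) = dist x y"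
proof -
  have "(norm (rot \<alpha> \<beta> (x - y)))\<^sup>2 = (norm (of_C5 (to_C5 (x - y))))\<^sup>2"
    unfolding norm_of_C5 rot_def by (simp add: norm_mult)
  then have "norm (rot \<alpha> \<beta> (x - y)) = norm (x - y)"
    by (simp add: power2_eq_iff_nonneg)
  then show ?thesis
    by (simp add: dist_norm linear_diff[OF linear_rot])
qed

lemma det_rot_pos: "det (matrix (rot \<alpha> \<beta>)) > 0"
proof -
  have "rot \<alpha> \<beta> = (\<lambda>v. rot (\<alpha>/2) (\<beta>/2) (rot (\<alpha>/2) (\<beta>/2) v))"
    by (simp add: rot_rot fun_eq_iff)
  then show ?thesis
    using det_matrix_square_pos[OF linear_rot[of "\<alpha>/2" "\<beta>/2"] linear_rot[of "-(\<alpha>/2)" "-(\<beta>/2)"]] by simp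
qed

lemma rot_has_derivative: "(rot \<alpha> \<beta> has_derivative rot \<alpha> \<beta>) F"
  using linear_rot linear_conv_bounded_linear bounded_linear_imp_has_derivative by blast

lemma Cinf_on_cis:
  fixes f :: "'a::real_normed_vector \<Rightarrow> real"
  assumes "Cinf_on U f"
  shows "Cinf_on U (\<lambda>x. cis (f x))"
proof -
  have "bounded_linear (\<lambda>r :: real. \<i> * complex_of_real r)"
    by (intro bounded_linear_const_mult bounded_linear_of_real)
  from Cinf_on_compose[OF Cinf_on_linear[OF this assms] Cinf_on_exp] show ?thesis
    by (simp add: cis_conv_exp)
qed

text \<open>Joint smoothness in the torus parameter and the point, as the definition of a smooth
  action demands.\<close>

lemma smooth_rot:
  fixes \<alpha> \<beta> :: "'a::euclidean_space \<Rightarrow> real"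
  assumes "bounded_linear \<alpha>" "bounded_linear \<beta>"
  shows "Cinf_on UNIV (\<lambda>p. rot (\<alpha> (fst p)) (\<beta> (fst p)) (snd p))"
proof -
  have "bounded_linear (\<lambda>p :: 'a \<times> (real^(4 option)). 2 * pi * \<alpha> (fst p))"
    "bounded_linear (\<lambda>p :: 'a \<times> (real^(4 option)). 2 * pi * \<beta> (fst p))"
    using assms by (auto intro!: bounded_linear_const_mult intro: bounded_linear_compose bounded_linear_fst)
  then show ?thesis
    unfolding rot_def
    by (intro Cinf_on_of_C5 Cinf_on_mult Cinf_on_cis Cinf_on_bounded_linear open_UNIV
        bounded_linear_compose[OF _ bounded_linear_snd] bounded_linear_C5_coords)
qed

lemma Cinf_on_rot: "Cinf_on UNIV (rot \<alpha> \<beta>)"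
  by (intro Cinf_on_bounded_linear linear_conv_bounded_linear[THEN iffD1, OF linear_rot] open_UNIV)

lemma diffeo_rot: "diffeo_onto_image S (rot \<alpha> \<beta>)"
  by (rule diffeo_onto_imageI[where k = "rot (-\<alpha>) (-\<beta>)"]) (auto intro: smooth_on_Cinf[OF Cinf_on_rot])

definition rho2 :: "complex \<Rightarrow> real \<Rightarrow> real" where
  "rho2 y h = (cmod y)\<^sup>2 + h\<^sup>2"

lemma rho2_nonneg [simp]: "0 \<le> rho2 y h"
  by (simp add: rho2_def)

lemma rho2_eq_0_iff [simp]: "rho2 y h = 0 \<longleftrightarrow> y = 0 \<and> h = 0"
  by (simp add: rho2_def sum_power2_eq_zero_iff)

lemma rho2_le_0_iff [simp]: "rho2 y h \<le> 0 \<longleftrightarrow> y = 0 \<and> h = 0"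
  by (metis order_antisym_conv rho2_eq_0_iff rho2_nonneg)

text \<open>Inversion in the unit sphere of the three-dimensional (y, h)-space, with z as a
  parameter.\<close>

definition inversion :: "real^(4 option) \<Rightarrow> real^(4 option)" where
  "inversion x = (let (z, y, h) = to_C5 x in of_C5 (z, y /\<^sub>R rho2 y h, h /\<^sub>R rho2 y h))"

lemma inversion_eq: "inversion = (\<lambda>x. of_C5 (z_of x, inverse (rho2 (y_of x) (h_of x)) *\<^sub>R y_of x,
    inverse (rho2 (y_of x) (h_of x)) *\<^sub>R h_of x))"
  by (auto simp: inversion_def fun_eq_iff split: prod.splits)

definition inversion_dom :: "(real^(4 option)) set" where
  "inversion_dom = {x. rho2 (y_of x) (h_of x) \<noteq> 0}"

lemma open_inversion_dom: "open inversion_dom"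
  unfolding inversion_dom_def rho2_def
  by (intro open_Collect_neq continuous_intros)

lemma rho2_inverse: "rho2 y h \<noteq> 0 \<Longrightarrow> rho2 (y /\<^sub>R rho2 y h) (h /\<^sub>R rho2 y h) = inverse (rho2 y h)"
proof -
  assume ne: "rho2 y h \<noteq> 0"
  have "rho2 (y /\<^sub>R r) (h /\<^sub>R r) = (inverse r)\<^sup>2 * rho2 y h" for r
    by (simp add: rho2_def power_mult_distrib power_inverse distrib_left)
  with ne show ?thesis by (simp add: power2_eq_square)
qed

lemma inversion_inversion: "x \<in> inversion_dom \<Longrightarrow> inversion (inversion x) = x"
  unfolding inversion_def inversion_dom_def
  by (cases "to_C5 x") (simp add: rho2_inverse Let_def del: scaleR_conv_of_real real_scaleR_def, 
    metis of_to_C5)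

lemma inversion_in_dom: "x \<in> inversion_dom \<Longrightarrow> inversion x \<in> inversion_dom"
  unfolding inversion_def inversion_dom_def
  by (cases "to_C5 x") (auto simp: rho2_inverse simp del: rho2_eq_0_iff real_scaleR_def)

lemma inversion_halfspace: "inversion x \<in> halfspace \<longleftrightarrow> x \<in> halfspace \<or> x \<notin> inversion_dom"
  unfolding inversion_def inversion_dom_def halfspace_iff
  by (cases "to_C5 x") (auto simp: zero_le_mult_iff)

lemma inversion_image: "inversion ` (halfspace \<inter> inversion_dom) = halfspace \<inter> inversion_dom"
proof -
  have "inversion x \<in> halfspace \<inter> inversion_dom" if "x \<in> halfspace \<inter> inversion_dom" for x
    using that inversion_in_dom inversion_halfspace by blast
  then show ?thesis
    using inversion_inversion by (auto intro!: image_eqI[of _ inversion "inversion _"])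
qed

lemma Cinf_on_rho2:
  "open U \<Longrightarrow> Cinf_on U (\<lambda>x. rho2 (y_of x) (h_of x))"
proof -
  assume U: "open U"
  have eq: "rho2 y h = Re y * Re y + Im y * Im y + h * h" for y h
    by (simp add: rho2_def cmod_power2 flip: power2_eq_square)
  show ?thesis
    unfolding eq
    by (intro Cinf_on_add Cinf_on_mult Cinf_on_bounded_linear U bounded_linear_C5_coords
        bounded_linear_compose[OF bounded_linear_Re] bounded_linear_compose[OF bounded_linear_Im])
qed

lemma Cinf_on_inversion: "Cinf_on inversion_dom inversion"
proof -
  have inv: "Cinf_on inversion_dom (\<lambda>x. inverse (rho2 (y_of x) (h_of x)))"
    by (rule Cinf_on_compose[OF Cinf_on_rho2[OF open_inversion_dom] Cinf_on_inverse]) (auto simp: inversion_dom_def)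
  show ?thesis
    unfolding inversion_eq
    by (intro Cinf_on_of_C5 Cinf_on_scaleR inv Cinf_on_bounded_linear open_inversion_dom bounded_linear_C5_coords)
qed

text \<open>The derivative is the reflection in the hyperplane orthogonal to the position vector
  \<open>a = (0, y, h)\<close>, followed by scaling the (y, h)-coordinates by \<open>1 / r\<close>.
  The reflection makes the determinant negative.\<close>

lemma inversion_has_derivative:
  assumes "x \<in> inversion_dom"
  shows "\<exists>D. (inversion has_derivative D) (at x) \<and> det (matrix D) < 0"
proof -
  obtain z y h where x: "to_C5 x = (z, y, h)"
    by (metis prod_cases3)
  define r where "r = rho2 y h"
  have r: "r > 0"
    using assms x rho2_nonneg[of y h] by (auto simp: inversion_dom_def r_def simp del: rho2_nonneg rho2_eq_0_iff rho2_le_0_iff)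
  define a where "a = of_C5 (0, y, h)"
  have aa: "a \<bullet> a = r"
    by (simp add: a_def r_def power2_norm_eq_inner[symmetric] norm_of_C5 rho2_def)
  define d where "d = (\<lambda>i :: 4 option. if i = Some 1 \<or> i = Some 2 then 1 else inverse r)"
  define S where "S = (\<lambda>v :: real^(4 option). \<chi> i. d i * v $ i)"
  define R where "R = (\<lambda>v. v - (2 * (a \<bullet> v) / (a \<bullet> a)) *\<^sub>R a)"
  have dr: "((\<lambda>x. rho2 (y_of x) (h_of x)) has_derivative (\<lambda>v. 2 * (a \<bullet> v))) (at x)"
  proof -
    have eq: "(\<lambda>x. rho2 (y_of x) (h_of x)) =
        (\<lambda>x. x $ Some 3 * x $ Some 3 + x $ Some 4 * x $ Some 4 + x $ None * x $ None)"
      by (simp add: rho2_def cmod_power2 to_C5_def flip: power2_eq_square)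
    have "((\<lambda>x. x $ Some 3 * x $ Some 3 + x $ Some 4 * x $ Some 4 + x $ None * x $ None) has_derivative
        (\<lambda>v. (x $ Some 3 * v $ Some 3 + v $ Some 3 * x $ Some 3) + (x $ Some 4 * v $ Some 4 + v $ Some 4 * x $ Some 4)
          + (x $ None * v $ None + v $ None * x $ None))) (at x)"
      by (intro has_derivative_add has_derivative_mult bounded_linear_imp_has_derivative bounded_linear_vec_nth)
    moreover have "Re y = x $ Some 3" "Im y = x $ Some 4" "h = x $ None"
      using x by (auto simp: to_C5_def)
    ultimately show ?thesis
      unfolding eq
      by (elim has_derivative_eq_rhs) (simp add: fun_eq_iff a_def inner_vec_def UNIV_option_4 algebra_simps)
  qed
  have di: "((\<lambda>x. inverse (rho2 (y_of x) (h_of x))) has_derivative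
      (\<lambda>v. - (inverse r * (2 * (a \<bullet> v)) * inverse r))) (at x)"
    using Deriv.has_derivative_inverse[OF _ dr] assms[unfolded inversion_dom_def mem_Collect_eq]
    by (simp only: x fst_conv snd_conv r_def simp_thms)
  note bl = bounded_linear_C5_coords[THEN bounded_linear_imp_has_derivative]
  have "(inversion has_derivative (\<lambda>v. of_C5 (z_of v,
      inverse r *\<^sub>R y_of v + (- (inverse r * (2 * (a \<bullet> v)) * inverse r)) *\<^sub>R y,
      inverse r *\<^sub>R h_of v + (- (inverse r * (2 * (a \<bullet> v)) * inverse r)) *\<^sub>R h))) (at x)"
    unfolding inversion_eq
    using has_derivative_scaleR[OF di bl(2)] has_derivative_scaleR[OF di bl(3)] x
    by (intro bounded_linear.has_derivative[OF bounded_linear_of_C5] has_derivative_Pair bl(1))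
      (simp_all add: r_def)
  also have "(\<lambda>v. of_C5 (z_of v,
      inverse r *\<^sub>R y_of v + (- (inverse r * (2 * (a \<bullet> v)) * inverse r)) *\<^sub>R y,
      inverse r *\<^sub>R h_of v + (- (inverse r * (2 * (a \<bullet> v)) * inverse r)) *\<^sub>R h))
    = (\<lambda>v. S (R v))"
    using r by (auto simp: fun_eq_iff vec_eq_iff forall_option_4 S_def R_def d_def aa)
      (auto simp: a_def to_C5_def field_simps)
  finally have D: "(inversion has_derivative (\<lambda>v. S (R v))) (at x)" .
  have "linear S" "linear R"
    unfolding S_def R_def by (auto intro!: linearI simp: vec_eq_iff algebra_simps inner_simps add_divide_distrib)
  then have "det (matrix (\<lambda>v. S (R v))) = det (matrix S) * det (matrix R)"
    using matrix_compose[of R S] by (simp add: o_def det_mul)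
  moreover have "det (matrix R) = -1"
    unfolding R_def using aa r by (intro det_matrix_reflection) auto
  moreover have "det (matrix S) > 0"
    unfolding S_def det_matrix_diagonal d_def using r by (simp add: UNIV_option_4)
  ultimately show ?thesis
    using D by auto
qed

text \<open>The change of charts between two vertices joined by the edge on which \<open>y = 0\<close>: it inverts \<open>|z|\<close>, multiplies the angle of \<open>z\<close>
  by \<open>p\<close> and rotates \<open>y\<close> by \<open>q\<close> times this angle.\<close>

definition twist :: "real \<Rightarrow> real \<Rightarrow> real^(4 option) \<Rightarrow> real^(4 option)" where
  "twist p q x = (let (z, y, h) = to_C5 x; L = Ln z
     in of_C5 (exp (Complex (- Re L) (p * Im L)), y * cis (q * Im L), h))"

lemma twist_eq: "twist p q = (\<lambda>x. of_C5 (exp (Complex (- Re (Ln (z_of x))) (p * Im (Ln (z_of x)))),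
    y_of x * cis (q * Im (Ln (z_of x))), h_of x))"
  by (auto simp: twist_def fun_eq_iff Let_def split: prod.splits)

text \<open>The bound on the angle keeps the image in the right half-plane, so that the principal
  logarithm undoes the exponential there.\<close>

definition twist_dom :: "real \<Rightarrow> (real^(4 option)) set" where
  "twist_dom p = {x. 0 < Re (z_of x) \<and> \<bar>p\<bar> * \<bar>Im (Ln (z_of x))\<bar> < pi / 2}"

lemma open_right_half_C5: "open {x. 0 < Re (z_of x)}"
  by (intro open_Collect_less continuous_intros)

lemma Cinf_on_Ln_C5: "Cinf_on {x. 0 < Re (z_of x)} (\<lambda>x. Ln (z_of x))"
  by (rule Cinf_on_compose[OF Cinf_on_bounded_linear[OF bounded_linear_C5_coords(1) open_right_half_C5] Cinf_on_Ln]) auto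

lemma open_twist_dom: "open (twist_dom p)"
proof -
  have "open ({x. 0 < Re (z_of x)} \<inter> (\<lambda>x. \<bar>p\<bar> * \<bar>Im (Ln (z_of x))\<bar>) -` {..<pi / 2})"
    by (rule continuous_open_preimage)
      (intro continuous_intros Cinf_on_continuous[OF Cinf_on_Ln_C5] open_right_half_C5 open_lessThan)+
  moreover have "twist_dom p = {x. 0 < Re (z_of x)} \<inter> (\<lambda>x. \<bar>p\<bar> * \<bar>Im (Ln (z_of x))\<bar>) -` {..<pi / 2}"
    by (auto simp: twist_dom_def)
  ultimately show ?thesis by simp
qed

lemma Cinf_on_twist: "Cinf_on (twist_dom p) (twist p q)"
proof -
  have L: "Cinf_on (twist_dom p) (\<lambda>x. Ln (z_of x))"
    by (rule Cinf_on_subset[OF Cinf_on_Ln_C5 open_twist_dom]) (auto simp: twist_dom_def)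
  have "bounded_linear (\<lambda>L. Complex (- Re L) (p * Im L))"
    by (auto intro!: linearI simp: linear_conv_bounded_linear[symmetric] complex_eq_iff algebra_simps)
  from Cinf_on_compose[OF Cinf_on_linear[OF this L] Cinf_on_exp]
  have 1: "Cinf_on (twist_dom p) (\<lambda>x. exp (Complex (- Re (Ln (z_of x))) (p * Im (Ln (z_of x)))))"
    by simp
  have "bounded_linear (\<lambda>L. q * Im L)"
    by (intro bounded_linear_const_mult bounded_linear_Im)
  note cis = Cinf_on_cis[OF Cinf_on_linear[OF this L]]
  have 2: "Cinf_on (twist_dom p) (\<lambda>x. y_of x * cis (q * Im (Ln (z_of x))))"
    by (rule Cinf_on_mult[OF Cinf_on_bounded_linear[OF bounded_linear_C5_coords(2) open_twist_dom] cis])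
  show ?thesis
    unfolding twist_eq
    using Cinf_on_of_C5[OF 1 2 Cinf_on_bounded_linear[OF bounded_linear_C5_coords(3) open_twist_dom]] by simp
qed

lemma twist_halfspace [simp]: "twist p q x \<in> halfspace \<longleftrightarrow> x \<in> halfspace"
  by (cases "to_C5 x") (simp add: twist_def halfspace_iff Let_def)

lemma Ln_twist:
  assumes "x \<in> twist_dom p"
  shows "Ln (z_of (twist p q x)) = Complex (- Re (Ln (z_of x))) (p * Im (Ln (z_of x)))"
proof -
  let ?a = "p * Im (Ln (z_of x))"
  have "\<bar>?a\<bar> < pi / 2"
    using assms by (simp add: twist_dom_def abs_mult)
  then have "-pi < ?a \<and> ?a \<le> pi"
    using pi_gt_zero by linarith
  then show ?thesis
    by (cases "to_C5 x") (simp add: twist_def Let_def Ln_exp)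
qed

lemma twist_in_dom:
  assumes "x \<in> twist_dom p" "p \<noteq> 0"
  shows "twist p q x \<in> twist_dom (inverse p)"
proof -
  let ?L = "Ln (z_of x)"
  have a: "\<bar>p * Im ?L\<bar> < pi / 2"
    using assms(1) by (simp add: twist_dom_def abs_mult)
  then have "0 < cos (p * Im ?L)"
    by (intro cos_gt_zero_pi) auto
  then have "0 < Re (z_of (twist p q x))"
    by (cases "to_C5 x") (simp add: twist_def Let_def Re_exp)
  moreover have "0 < Re (z_of x)"
    using assms(1) by (simp add: twist_dom_def)
  then have "\<bar>Im ?L\<bar> < pi / 2"
    using Re_Ln_pos_lt[of "z_of x"] by force
  moreover have "\<bar>inverse p\<bar> * \<bar>p * Im ?L\<bar> = \<bar>Im ?L\<bar>"
    using assms(2) by (simp add: abs_mult)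
  ultimately show ?thesis
    unfolding twist_dom_def using Ln_twist[OF assms(1), of q] by simp
qed

text \<open>If the angle of z is t, that of the image is \<open>p * t\<close>. The inverse divides
  it by \<open>p\<close> and has to rotate \<open>y\<close> by \<open>- q * t\<close>, which is
  \<open>- (q / p)\<close> times the new angle.\<close>

lemma twist_twist:
  assumes "x \<in> twist_dom p" "p \<noteq> 0"
  shows "twist (inverse p) (- (q / p)) (twist p q x) = x"
proof -
  obtain z y h where x: "to_C5 x = (z, y, h)"
    by (metis prod_cases3)
  have z: "z \<noteq> 0"
    using assms(1) x by (auto simp: twist_dom_def)
  obtain z' where t: "to_C5 (twist p q x) = (z', y * cis (q * Im (Ln z)), h)"
    by (simp add: twist_def x Let_def)
  have Lz': "Ln z' = Complex (- Re (Ln z)) (p * Im (Ln z))"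
    using Ln_twist[OF assms(1), of q] x t by simp
  have "Complex (- Re (Ln z')) (inverse p * Im (Ln z')) = Ln z"
    using assms(2) by (simp add: Lz' complex_eq_iff)
  then have "exp (Complex (- Re (Ln z')) (inverse p * Im (Ln z'))) = exp (Ln z)"
    by (rule arg_cong)
  moreover have "cis (q * Im (Ln z)) * cis (- (q / p) * Im (Ln z')) = 1"
    using assms(2) by (simp add: Lz' cis_mult)
  ultimately have "twist (inverse p) (- (q / p)) (twist p q x) = of_C5 (z, y, h)"
    using z by (simp add: twist_def[of "inverse p"] t Let_def mult.assoc)
  also have "\<dots> = x"
    by (metis of_to_C5 x)
  finally show ?thesis .
qed

lemma twist_image:
  assumes "p \<noteq> 0"
  shows "twist p q ` (halfspace \<inter> twist_dom p) = halfspace \<inter> twist_dom (inverse p)"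
proof (intro equalityI subsetI)
  fix x assume x: "x \<in> halfspace \<inter> twist_dom (inverse p)"
  let ?y = "twist (inverse p) (- (q / p)) x"
  have "twist p q ?y = x"
    using twist_twist[of x "inverse p" "- (q / p)"] x assms by simp
  moreover have "?y \<in> halfspace \<inter> twist_dom p"
    using twist_in_dom[of x "inverse p"] x assms by simp
  ultimately show "x \<in> twist p q ` (halfspace \<inter> twist_dom p)"
    by (metis image_eqI)
qed (use assms twist_in_dom in auto)

text \<open>At a positive real z the angle is 0, and the derivative is a diagonal map followed by a
  shear. It stretches radially by \<open>-1/r^2\<close> and angularly by \<open>p/r^2\<close>,
  whence the sign \<open>- sgn p\<close>.\<close>

lemma twist_has_derivative:
  assumes "p \<noteq> 0" "r > 0" "to_C5 x = (of_real r, y, h)"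
  shows "\<exists>D. (twist p q has_derivative D) (at x) \<and> sgn (det (matrix D)) = - sgn p"
proof -
  \<comment> \<open>The shear acts after the diagonal map \<open>S\<close>, which has already
    multiplied the angular coordinate by \<open>p/r^2\<close>. Dividing the required displacement
    \<open>i * q * y / r\<close> by this factor gives \<open>c\<close>.\<close>
  define c where "c = \<i> * of_real (q * r / p) * y"
  define d where "d = (\<lambda>i :: 4 option. if i = Some 1 then - (inverse r * inverse r)
    else if i = Some 2 then p * (inverse r * inverse r) else 1)"
  define S where "S = (\<lambda>v :: real^(4 option). \<chi> i. d i * v $ i)"
  define R where "R = (\<lambda>(c :: complex) v. v + (v $ Some 2) *\<^sub>R of_C5 (0, c, 0))"
  have "(Ln has_derivative (\<lambda>v. inverse (of_real r) * v)) (at (of_real r))"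
    using has_field_derivative_Ln[of "of_real r"] assms(2)
    by (auto simp: has_field_derivative_def complex_nonpos_Reals_iff divide_inverse)
  then have L: "((\<lambda>x. Ln (z_of x)) has_derivative (\<lambda>v. inverse (of_real r) * z_of v)) (at x)"
    using diff_chain_at[OF bounded_linear_imp_has_derivative[OF bounded_linear_C5_coords(1)], of Ln _ x] assms(3)
    by (simp add: o_def)
  have "bounded_linear (\<lambda>L. Complex (- Re L) (p * Im L))"
    by (auto intro!: linearI simp: linear_conv_bounded_linear[symmetric] complex_eq_iff algebra_simps)
  note M = bounded_linear.has_derivative[OF this L]
  have exp': "(exp has_derivative (\<lambda>v. exp w * v)) (at w)" for w :: complex
    using DERIV_exp by (simp add: has_field_derivative_def)
  have Lr: "Ln (complex_of_real r) = of_real (ln r)"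
    using assms(2) by (simp add: Ln_of_real)
  have "exp (Complex (- ln r) 0) = of_real (inverse r)"
    using assms(2) by (simp add: Complex_eq exp_minus exp_of_real)
  then have E: "((\<lambda>x. exp (Complex (- Re (Ln (z_of x))) (p * Im (Ln (z_of x))))) has_derivative
      (\<lambda>v. of_real (inverse r) * Complex (- Re (inverse (of_real r) * z_of v)) (p * Im (inverse (of_real r) * z_of v)))) (at x)"
    using diff_chain_at[OF M exp'] assms(3) Lr by (simp add: o_def)
  have "bounded_linear (\<lambda>L. \<i> * complex_of_real (q * Im L))"
    by (intro bounded_linear_const_mult bounded_linear_compose[OF bounded_linear_of_real] bounded_linear_Im)
  note M' = bounded_linear.has_derivative[OF this L]
  have "((\<lambda>x. cis (q * Im (Ln (z_of x)))) has_derivative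
      (\<lambda>v. \<i> * complex_of_real (q * Im (inverse (of_real r) * z_of v)))) (at x)"
    using diff_chain_at[OF M' exp'] assms(3) Lr by (simp add: o_def cis_conv_exp)
  from has_derivative_mult[OF bounded_linear_imp_has_derivative[OF bounded_linear_C5_coords(2)] this]
  have C: "((\<lambda>x. y_of x * cis (q * Im (Ln (z_of x)))) has_derivative
      (\<lambda>v. y * (\<i> * complex_of_real (q * Im (inverse (of_real r) * z_of v))) + y_of v)) (at x)"
    using assms(3) Lr by simp
  have "(twist p q has_derivative (\<lambda>v. of_C5
      (of_real (inverse r) * Complex (- Re (inverse (of_real r) * z_of v)) (p * Im (inverse (of_real r) * z_of v)),
       y * (\<i> * complex_of_real (q * Im (inverse (of_real r) * z_of v))) + y_of v,
       h_of v))) (at x)"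
    unfolding twist_eq
    using bounded_linear.has_derivative[OF bounded_linear_of_C5 has_derivative_Pair[OF E
        has_derivative_Pair[OF C bounded_linear_imp_has_derivative[OF bounded_linear_C5_coords(3)]]]] by simp
  also have "(\<lambda>v. of_C5
      (of_real (inverse r) * Complex (- Re (inverse (of_real r) * z_of v)) (p * Im (inverse (of_real r) * z_of v)),
       y * (\<i> * complex_of_real (q * Im (inverse (of_real r) * z_of v))) + y_of v,
       h_of v)) = (\<lambda>v. R c (S v))"
    using assms(1,2)
    by (auto simp: fun_eq_iff vec_eq_iff forall_option_4 S_def R_def d_def c_def to_C5_def field_simps
        simp flip: of_real_inverse)
  finally have D: "(twist p q has_derivative (\<lambda>v. R c (S v))) (at x)" .
  have lin: "linear S" "linear (R c)" for c
    unfolding S_def R_def by (auto intro!: linearI simp: vec_eq_iff algebra_simps)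
  \<comment> \<open>The shears form an additive group, so \<open>R c\<close> is the square of
    \<open>R (c/2)\<close>.\<close>
  have "R a (R b v) = R (a + b) v" for a b v
    by (simp add: R_def vec_eq_iff forall_option_4 distrib_left)
  moreover have "R 0 v = v" for v
    by (simp add: R_def vec_eq_iff forall_option_4)
  ultimately have "det (matrix (R c)) > 0"
    using det_matrix_square_pos[OF lin(2) lin(2), of "c/2" "-c/2"] by simp
  have "det (matrix S) = - (inverse r * inverse r) * (p * (inverse r * inverse r))"
    unfolding S_def det_matrix_diagonal d_def by (simp add: UNIV_option_4)
  then have "sgn (det (matrix S)) = - sgn p"
    using assms(2) by (simp add: sgn_mult)
  with \<open>det (matrix (R c)) > 0\<close> have "sgn (det (matrix (\<lambda>v. R c (S v)))) = - sgn p"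
    using sgn_det_compose[OF lin] by simp
  with D show ?thesis by auto
qed

section \<open>Quotients of the torus times a polytope\<close>

lemma lattice_iff: "t \<in> lattice \<longleftrightarrow> fst t \<in> \<int> \<and> snd t \<in> \<int>"
  by (cases t) (simp add: lattice_def)

lemma lattice_closed [simp, intro]:
  "0 \<in> lattice" "s \<in> lattice \<Longrightarrow> t \<in> lattice \<Longrightarrow> s + t \<in> lattice"
  "s \<in> lattice \<Longrightarrow> - s \<in> lattice" "s \<in> lattice \<Longrightarrow> t \<in> lattice \<Longrightarrow> s - t \<in> lattice"
  "k \<in> \<int> \<Longrightarrow> k *\<^sub>R rvec v \<in> lattice"
  by (auto simp: lattice_iff rvec_def)

text \<open>The same formula as in \<open>face_stab\<close>, for any set of directions, so that the
  bordism and the quasitoric orbifold share one calculus of classes.\<close>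

definition torus_stab :: "(real \<times> real) set \<Rightarrow> (real \<times> real) set" where
  "torus_stab B = {r + n | r n. r \<in> span B \<and> n \<in> lattice}"

lemma torus_stabI: "r \<in> span B \<Longrightarrow> t - r \<in> lattice \<Longrightarrow> t \<in> torus_stab B"
  unfolding torus_stab_def by (intro CollectI exI[of _ r] exI[of _ "t - r"]) simp

lemma torus_stabE:
  assumes "t \<in> torus_stab B"
  obtains r where "r \<in> span B" "t - r \<in> lattice"
  using assms by (auto simp: torus_stab_def)

lemma torus_stab_iff: "t \<in> torus_stab B \<longleftrightarrow> (\<exists>r. r \<in> span B \<and> t - r \<in> lattice)"
  by (blast elim: torus_stabE intro: torus_stabI)

lemma torus_stab_add: "s \<in> torus_stab B \<Longrightarrow> t \<in> torus_stab B \<Longrightarrow> s + t \<in> torus_stab B"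
proof (elim torus_stabE)
  fix r r' assume "r \<in> span B" "s - r \<in> lattice" "r' \<in> span B" "t - r' \<in> lattice"
  moreover have "(s + t) - (r + r') = (s - r) + (t - r')" by simp
  ultimately show ?thesis
    by (intro torus_stabI[of "r + r'"]) (auto intro: span_add simp only: lattice_closed)
qed

lemma torus_stab_minus: "t \<in> torus_stab B \<Longrightarrow> - t \<in> torus_stab B"
proof (elim torus_stabE)
  fix r assume "r \<in> span B" "t - r \<in> lattice"
  moreover have "- t - (- r) = - (t - r)" by simp
  ultimately show ?thesis
    by (intro torus_stabI[of "- r"]) (auto intro: span_neg simp only: lattice_closed)
qed

lemma lattice_subset_torus_stab: "t \<in> lattice \<Longrightarrow> t \<in> torus_stab B"
  by (rule torus_stabI[of 0]) (auto intro: span_zero)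

text \<open>The class of \<open>(t, p)\<close> when the subtorus spanned by \<open>B p\<close> is
  collapsed over \<open>p\<close>, for an orbit space of any type.\<close>

definition torus_coset :: "('p \<Rightarrow> (real \<times> real) set) \<Rightarrow> real \<times> real \<Rightarrow> 'p \<Rightarrow> ((real \<times> real) \<times> 'p) set" where
  "torus_coset B t p = {(s, q). q = p \<and> s - t \<in> torus_stab (B p)}"

lemma torus_coset_eq_iff: "torus_coset B t p = torus_coset B t' p' \<longleftrightarrow> p = p' \<and> t' - t \<in> torus_stab (B p)"
proof
  assume eq: "torus_coset B t p = torus_coset B t' p'"
  have "(t', p') \<in> torus_coset B t' p'"
    by (simp add: torus_coset_def lattice_subset_torus_stab)
  then have "(t', p') \<in> torus_coset B t p"
    by (simp only: eq)
  then show "p = p' \<and> t' - t \<in> torus_stab (B p)"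
    by (simp add: torus_coset_def)
next
  assume t: "p = p' \<and> t' - t \<in> torus_stab (B p)"
  have "s - t \<in> torus_stab (B p) \<longleftrightarrow> s - t' \<in> torus_stab (B p)" for s
    using torus_stab_add[of "s - t'" "B p" "t' - t"] torus_stab_add[of "s - t" "B p" "t - t'"]
      torus_stab_minus[of "t' - t" "B p"] t by auto
  with t show "torus_coset B t p = torus_coset B t' p'"
    by (auto simp: torus_coset_def)
qed

lemma torus_coset_translate: "(\<lambda>(s, p). (t + s, p)) ` torus_coset B s q = torus_coset B (t + s) q"
proof (intro equalityI subsetI)
  fix x assume "x \<in> torus_coset B (t + s) q"
  then show "x \<in> (\<lambda>(s, p). (t + s, p)) ` torus_coset B s q"
    by (cases x) (auto simp: torus_coset_def algebra_simps intro!: image_eqI[of _ _ "(fst x - t, q)"])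
qed (auto simp: torus_coset_def)

section \<open>The null-bordism\<close>

text \<open>The frame of the chart \<open>(a, b)\<close> consists of \<open>w a\<close> and \<open>u\<close>, which is the common direction of two
  opposite edges of the rectangle.  The orbit space is \<open>[0,1]\<close> times a half-disc with coordinates \<open>(s, k)\<close>;
  the diameter \<open>k = 0\<close> corresponds to the boundary, and the circle in the direction \<open>u\<close> fixes the
  points over the half-circle \<open>k\<^sup>2 = s (1 - s)\<close>.\<close>

locale null_bordism =
  fixes u :: "int \<times> int" and w :: "bool \<Rightarrow> int \<times> int"
  assumes indep: "idet (w a) u \<noteq> 0"
begin

definition dir :: "real \<times> real \<times> real \<Rightarrow> (real \<times> real) set" where
  "dir = (\<lambda>(x, s, k). {v. \<exists>a. v = rvec (w a) \<and> x = of_bool a} \<union> {v. v = rvec u \<and> k\<^sup>2 = s * (1 - s)})"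

text \<open>With \<open>r = rho2 y h\<close>, both values of \<open>b\<close> give
  \<open>s * (1 - s) - k^2 = |y|^2 / (1 + r)^2\<close>. So the image lies in the half-disc, with the
  half-circle over \<open>y = 0\<close> and the diameter over \<open>h = 0\<close>. Each
  \<open>b\<close> misses one end of the diameter, which the other one reaches at the
  origin.\<close>

definition orbit_pt :: "bool \<Rightarrow> bool \<Rightarrow> complex \<times> complex \<times> real \<Rightarrow> real \<times> real \<times> real" where
  "orbit_pt a b = (\<lambda>(z, y, h). (if a then 1 - radial z else radial z,
     if b then 1 / (1 + rho2 y h) else rho2 y h / (1 + rho2 y h), h / (1 + rho2 y h)))"

definition proj :: "bool \<Rightarrow> bool \<Rightarrow> real^(4 option) \<Rightarrow> big_point" where
  "proj a b x = torus_coset dir ((Arg (z_of x) / (2 * pi)) *\<^sub>R rvec (w a)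
     + (Arg (y_of x) / (2 * pi)) *\<^sub>R rvec u) (orbit_pt a b (to_C5 x))"

text \<open>\<open>restrict\<close> is there because \<open>BijGroup\<close> consists of extensional
  functions.\<close>

definition chart :: "bool \<Rightarrow> bool \<Rightarrow> (real^(4 option), big_point) orb_chart" where
  "chart a b = \<lparr> cdom = halfspace,
     cgrp = {restrict (rot s1 s2) halfspace | s1 s2. s1 *\<^sub>R rvec (w a) + s2 *\<^sub>R rvec u \<in> lattice},
     cproj = proj a b \<rparr>"

definition act :: "real \<times> real \<Rightarrow> big_point \<Rightarrow> big_point" where
  "act t C = (\<lambda>(s, p). (t + s, p)) ` C"

lemma chart_simps [simp]:
  "cdom (chart a b) = halfspace" "cproj (chart a b) = proj a b"
  "cgrp (chart a b) = {restrict (rot s1 s2) halfspace | s1 s2. s1 *\<^sub>R rvec (w a) + s2 *\<^sub>R rvec u \<in> lattice}"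
  by (simp_all add: chart_def)

lemma act_torus_coset: "act t (torus_coset dir s p) = torus_coset dir (t + s) p"
  by (simp add: act_def torus_coset_translate)

section \<open>Coordinates with respect to the frame of a chart\<close>

lemma real_idet: "real_of_int (idet v v') = fst (rvec v) * snd (rvec v') - snd (rvec v) * fst (rvec v')"
  by (simp add: idet_def rvec_def)

text \<open>Cramer's rule for the frame \<open>(w a, u)\<close>; the same applies to
  \<open>coord_u\<close>.\<close>

definition coord_w :: "bool \<Rightarrow> real \<times> real \<Rightarrow> real" where
  "coord_w a t = (fst t * snd (rvec u) - snd t * fst (rvec u)) / idet (w a) u"

definition coord_u :: "bool \<Rightarrow> real \<times> real \<Rightarrow> real" where
  "coord_u a t = (fst (rvec (w a)) * snd t - snd (rvec (w a)) * fst t) / idet (w a) u"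

lemma frame_expand: "t = coord_w a t *\<^sub>R rvec (w a) + coord_u a t *\<^sub>R rvec u"
proof -
  have ne: "fst (rvec (w a)) * snd (rvec u) - snd (rvec (w a)) * fst (rvec u) \<noteq> 0"
    using indep[of a] unfolding real_idet[symmetric] by simp
  show ?thesis
    unfolding coord_w_def coord_u_def real_idet
    using ne by (cases t) (simp add: prod_eq_iff add_divide_distrib[symmetric] divide_eq_eq eq_divide_eq, simp add: algebra_simps)
qed

lemma frame_unique:
  assumes "t = \<alpha> *\<^sub>R rvec (w a) + \<beta> *\<^sub>R rvec u"
  shows "coord_w a t = \<alpha>" "coord_u a t = \<beta>"
proof -
  have ne: "fst (rvec (w a)) * snd (rvec u) - snd (rvec (w a)) * fst (rvec u) \<noteq> 0"
    using indep[of a] unfolding real_idet[symmetric] by simp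
  show "coord_w a t = \<alpha>" "coord_u a t = \<beta>"
    unfolding coord_w_def coord_u_def real_idet assms
    using ne by (simp_all add: divide_eq_eq) (simp_all add: algebra_simps)
qed

lemma linear_coord: "linear (coord_w a)" "linear (coord_u a)"
  by (auto intro!: linearI simp: coord_w_def coord_u_def algebra_simps add_divide_distrib diff_divide_distrib)

text \<open>Describing absent directions by vanishing coefficients treats all strata of the orbit
  space at once.\<close>

lemma torus_stab_frame:
  "t \<in> torus_stab ({v. v = rvec (w a) \<and> P} \<union> {v. v = rvec u \<and> Q}) \<longleftrightarrow>
     (\<exists>\<alpha> \<beta>. (P \<or> \<alpha> = 0) \<and> (Q \<or> \<beta> = 0) \<and> t - (\<alpha> *\<^sub>R rvec (w a) + \<beta> *\<^sub>R rvec u) \<in> lattice)"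
proof -
  have span_iff: "r \<in> span ({v. v = rvec (w a) \<and> P} \<union> {v. v = rvec u \<and> Q}) \<longleftrightarrow>
      (\<exists>\<alpha> \<beta>. (P \<or> \<alpha> = 0) \<and> (Q \<or> \<beta> = 0) \<and> r = \<alpha> *\<^sub>R rvec (w a) + \<beta> *\<^sub>R rvec u)" for r
  proof -
    have "{v. v = rvec (w a) \<and> P} \<union> {v. v = rvec u \<and> Q} =
        (if P then if Q then {rvec (w a), rvec u} else {rvec (w a)} else if Q then {rvec u} else {})"
      by auto
    then show ?thesis
      by (auto simp: span_breakdown_eq algebra_simps)
  qed
  show ?thesis
    unfolding torus_stab_iff span_iff
  proof (intro iffI; elim exE conjE)
    fix r \<alpha> \<beta>
    assume "P \<or> \<alpha> = 0" "Q \<or> \<beta> = 0" "r = \<alpha> *\<^sub>R rvec (w a) + \<beta> *\<^sub>R rvec u" "t - r \<in> lattice"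
    then show "\<exists>\<alpha> \<beta>. (P \<or> \<alpha> = 0) \<and> (Q \<or> \<beta> = 0) \<and> t - (\<alpha> *\<^sub>R rvec (w a) + \<beta> *\<^sub>R rvec u) \<in> lattice"
      by (intro exI conjI) auto
  next
    fix \<alpha> \<beta>
    assume "P \<or> \<alpha> = 0" "Q \<or> \<beta> = 0" "t - (\<alpha> *\<^sub>R rvec (w a) + \<beta> *\<^sub>R rvec u) \<in> lattice"
    then show "\<exists>r. (\<exists>\<alpha> \<beta>. (P \<or> \<alpha> = 0) \<and> (Q \<or> \<beta> = 0) \<and> r = \<alpha> *\<^sub>R rvec (w a) + \<beta> *\<^sub>R rvec u) \<and> t - r \<in> lattice"
      by (intro exI conjI) (assumption | rule refl)+
  qed
qed

section \<open>Orbit points, polar representatives and the fibres of the projections\<close>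

lemma radial_bounds: "0 \<le> radial z" "radial z < 1"
  by (auto simp: radial_def divide_less_eq add_pos_nonneg)

lemma radial_eq_0_iff [simp]: "radial z = 0 \<longleftrightarrow> z = 0"
  by (auto simp: radial_def) (metis add_cancel_right_right less_irrefl not_sum_power2_lt_zero one_power2 power_zero_numeral sum_power2_eq_zero_iff zero_neq_one)

lemma divide_one_plus_eq_iff:
  fixes r r' :: real
  assumes "0 \<le> r" "0 \<le> r'"
  shows "r / (1 + r) = r' / (1 + r') \<longleftrightarrow> r = r'" "1 / (1 + r) = 1 / (1 + r') \<longleftrightarrow> r = r'"
  using assms by (auto simp: frac_eq_eq add_nonneg_eq_0_iff algebra_simps)

lemma radial_eq_iff: "radial z = radial z' \<longleftrightarrow> cmod z = cmod z'"
  unfolding radial_def by (simp add: divide_one_plus_eq_iff)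

lemma radial_inverse:
  assumes "z \<noteq> 0" "cmod z' = inverse (cmod z)"
  shows "radial z' = 1 - radial z"
proof -
  define r where "r = (cmod z)\<^sup>2"
  have r: "r > 0"
    using assms(1) by (simp add: r_def)
  have "radial z' = inverse r / (1 + inverse r)"
    by (simp add: radial_def assms(2) r_def power_inverse)
  also have "\<dots> = 1 - r / (1 + r)"
    using r by (simp add: field_simps)
  finally show ?thesis
    by (simp add: radial_def r_def)
qed

text \<open>Both values of \<open>b\<close> give \<open>s * (1 - s) = r / (1 + r)^2\<close>, so the
  equation of the half-circle becomes \<open>h^2 = r\<close>, that is, \<open>y = 0\<close>. Since
  \<open>radial z < 1\<close>, a chart meets only the end named by its own \<open>a\<close>.\<close>

lemma dir_orbit_pt:
  "dir (orbit_pt a b (z, y, h)) = {v. v = rvec (w a) \<and> z = 0} \<union> {v. v = rvec u \<and> y = 0}"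
proof -
  define r where "r = rho2 y h"
  have r: "r \<ge> 0" by (simp add: r_def)
  have 1: "(if a then 1 - radial z else radial z) = of_bool a' \<longleftrightarrow> a' = a \<and> z = 0" for a'
    using radial_bounds[of z] by (cases a; cases a') auto
  have "(h / (1 + r))\<^sup>2 = (if b then 1 / (1 + r) else r / (1 + r)) * (1 - (if b then 1 / (1 + r) else r / (1 + r)))
      \<longleftrightarrow> h\<^sup>2 / (1 + r)\<^sup>2 = r / (1 + r)\<^sup>2"
  proof -
    have "(if b then 1 / (1 + r) else r / (1 + r)) * (1 - (if b then 1 / (1 + r) else r / (1 + r))) = r / (1 + r)\<^sup>2"
    proof (cases b)
      case True
      have "1 - 1 / (1 + r) = r / (1 + r)"
        using r by (simp add: field_simps)
      with True show ?thesis
        by (simp add: power2_eq_square)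
    next
      case False
      have "1 - r / (1 + r) = 1 / (1 + r)"
        using r by (simp add: field_simps)
      with False show ?thesis
        by (simp add: power2_eq_square)
    qed
    then show ?thesis
      by (simp only: power_divide)
  qed
  also have "\<dots> \<longleftrightarrow> h\<^sup>2 = r"
    using r by simp
  also have "\<dots> \<longleftrightarrow> y = 0"
    by (auto simp: r_def rho2_def)
  finally have 2: "(h / (1 + r))\<^sup>2 = (if b then 1 / (1 + r) else r / (1 + r)) * (1 - (if b then 1 / (1 + r) else r / (1 + r)))
      \<longleftrightarrow> y = 0" .
  show ?thesis
    unfolding dir_def orbit_pt_def prod.case r_def[symmetric] 1 2 by auto
qed

text \<open>The coordinate \<open>s\<close> determines \<open>r\<close>; then \<open>k\<close>
  determines \<open>h\<close>, and \<open>r\<close> and \<open>h\<close> determine the modulus of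
  \<open>y\<close>.\<close>

lemma orbit_pt_eq_iff:
  "orbit_pt a b (z, y, h) = orbit_pt a b (z', y', h') \<longleftrightarrow> cmod z = cmod z' \<and> cmod y = cmod y' \<and> h = h'"
proof
  assume eq: "orbit_pt a b (z, y, h) = orbit_pt a b (z', y', h')"
  then have r: "rho2 y h = rho2 y' h'"
    using divide_one_plus_eq_iff[OF rho2_nonneg rho2_nonneg] by (auto simp: orbit_pt_def split: if_splits)
  have "1 + rho2 y h > 0"
    using rho2_nonneg[of y h] by linarith
  with eq r have h: "h = h'"
    by (auto simp: orbit_pt_def)
  with r have "cmod y = cmod y'"
    by (simp add: rho2_def power2_eq_iff_nonneg)
  with h eq show "cmod z = cmod z' \<and> cmod y = cmod y' \<and> h = h'"
    by (auto simp: orbit_pt_def radial_eq_iff split: if_splits)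
qed (simp add: orbit_pt_def radial_def rho2_def)

lemma Arg_diff_Ints:
  assumes "z = cmod z *\<^sub>R cis (2 * pi * \<alpha>)" "z \<noteq> 0"
  shows "\<alpha> - Arg z / (2 * pi) \<in> \<int>"
proof -
  have "cis (2 * pi * \<alpha>) = cis (Arg z)"
  proof -
    have "complex_of_real (cmod z) * cis (Arg z) = cmod z *\<^sub>R cis (2 * pi * \<alpha>)"
      by (simp only: rcis_cmod_Arg[unfolded rcis_def] assms(1)[symmetric])
    with assms(2) show ?thesis
      by (simp add: scaleR_conv_of_real)
  qed
  then have "cis (2 * pi * \<alpha> - Arg z) = 1"
    by (simp add: cis_divide[symmetric])
  then have "cos (2 * pi * \<alpha> - Arg z) = 1"
    by (simp add: complex_eq_iff)
  then obtain k where "2 * pi * \<alpha> - Arg z = of_int k * 2 * pi"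
    using cos_one_2pi_int by auto
  then have "\<alpha> - Arg z / (2 * pi) = of_int k"
    by (simp add: field_simps)
  then show ?thesis by simp
qed

lemma polar_Arg: "z = cmod z *\<^sub>R cis (2 * pi * (Arg z / (2 * pi)))"
  by (cases "z = 0") (auto simp: cis_Arg sgn_div_norm)

text \<open>The principal argument may be replaced by any angle: two choices differ by an integer if
  the coordinate is nonzero, and otherwise the corresponding direction is collapsed.\<close>

lemma proj_polar:
  assumes "z = cmod z *\<^sub>R cis (2 * pi * \<alpha>)" "y = cmod y *\<^sub>R cis (2 * pi * \<beta>)"
  shows "proj a b (of_C5 (z, y, h)) = torus_coset dir (\<alpha> *\<^sub>R rvec (w a) + \<beta> *\<^sub>R rvec u) (orbit_pt a b (z, y, h))"
proof -
  define d e where "d = \<alpha> - Arg z / (2 * pi)" and "e = \<beta> - Arg y / (2 * pi)"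
  have d: "z \<noteq> 0 \<Longrightarrow> d \<in> \<int>" and e: "y \<noteq> 0 \<Longrightarrow> e \<in> \<int>"
    using Arg_diff_Ints assms by (auto simp: d_def e_def)
  have "d *\<^sub>R rvec (w a) + e *\<^sub>R rvec u \<in> torus_stab (dir (orbit_pt a b (z, y, h)))"
    unfolding dir_orbit_pt torus_stab_frame
  proof (rule exI[of _ "if z = 0 then d else 0"], rule exI[of _ "if y = 0 then e else 0"], intro conjI)
    have "(d *\<^sub>R rvec (w a) + e *\<^sub>R rvec u) - ((if z = 0 then d else 0) *\<^sub>R rvec (w a) + (if y = 0 then e else 0) *\<^sub>R rvec u)
        = (if z = 0 then 0 else d) *\<^sub>R rvec (w a) + (if y = 0 then 0 else e) *\<^sub>R rvec u"
      by simp
    also have "\<dots> \<in> lattice"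
      using d e by (intro lattice_closed) auto
    finally show "(d *\<^sub>R rvec (w a) + e *\<^sub>R rvec u) - ((if z = 0 then d else 0) *\<^sub>R rvec (w a) + (if y = 0 then e else 0) *\<^sub>R rvec u) \<in> lattice" .
  qed auto
  then show ?thesis
    unfolding proj_def by (simp add: torus_coset_eq_iff d_def e_def algebra_simps)
qed

lemma polar_rot: "z = cmod z *\<^sub>R cis (2 * pi * \<alpha>) \<Longrightarrow>
    cis (2 * pi * s) * z = cmod (cis (2 * pi * s) * z) *\<^sub>R cis (2 * pi * (s + \<alpha>))"
  by (simp add: norm_mult distrib_left cis_mult[symmetric]) (metis mult.left_commute mult_scaleR_right)

lemma proj_rot: "proj a b (rot \<alpha> \<beta> x) = act (\<alpha> *\<^sub>R rvec (w a) + \<beta> *\<^sub>R rvec u) (proj a b x)"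
proof -
  obtain z y h where x: "x = of_C5 (z, y, h)"
    by (metis of_to_C5 prod_cases3)
  have "orbit_pt a b (cis (2 * pi * \<alpha>) * z, cis (2 * pi * \<beta>) * y, h) = orbit_pt a b (z, y, h)"
    by (simp add: orbit_pt_eq_iff norm_mult)
  moreover have "proj a b (of_C5 (cis (2 * pi * \<alpha>) * z, cis (2 * pi * \<beta>) * y, h)) =
      torus_coset dir ((\<alpha> + Arg z / (2 * pi)) *\<^sub>R rvec (w a) + (\<beta> + Arg y / (2 * pi)) *\<^sub>R rvec u)
        (orbit_pt a b (cis (2 * pi * \<alpha>) * z, cis (2 * pi * \<beta>) * y, h))"
    by (rule proj_polar[OF polar_rot[OF polar_Arg] polar_rot[OF polar_Arg]])
  moreover have "proj a b x = torus_coset dir ((Arg z / (2 * pi)) *\<^sub>R rvec (w a) + (Arg y / (2 * pi)) *\<^sub>R rvec u)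
      (orbit_pt a b (z, y, h))"
    by (simp add: proj_def x)
  ultimately show ?thesis
    by (simp add: x rot_def act_torus_coset algebra_simps)
qed

lemma act_lattice:
  assumes "t \<in> lattice"
  shows "act t (torus_coset dir s p) = torus_coset dir s p"
  using assms lattice_subset_torus_stab[of "- t"]
  by (simp add: act_torus_coset torus_coset_eq_iff)

lemma act_add: "act (s + t) C = act s (act t C)"
  by (force simp: act_def image_image algebra_simps split_beta)

text \<open>Equal orbit points have equal moduli, and the angles differ by an element of the
  stabiliser. Its continuous part only involves coordinates that vanish, so it can be absorbed into
  the rotation and a lattice vector remains.\<close>

lemma proj_fibre:
  "proj a b x = proj a b x' \<longleftrightarrow> (\<exists>s1 s2. s1 *\<^sub>R rvec (w a) + s2 *\<^sub>R rvec u \<in> lattice \<and> x' = rot s1 s2 x)"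
proof
  obtain z y h where x: "x = of_C5 (z, y, h)"
    by (metis of_to_C5 prod_cases3)
  obtain z' y' h' where x': "x' = of_C5 (z', y', h')"
    by (metis of_to_C5 prod_cases3)
  assume "proj a b x = proj a b x'"
  then have norms: "cmod z = cmod z'" "cmod y = cmod y'" "h = h'" and
    "(Arg z' / (2 * pi)) *\<^sub>R rvec (w a) + (Arg y' / (2 * pi)) *\<^sub>R rvec u
      - ((Arg z / (2 * pi)) *\<^sub>R rvec (w a) + (Arg y / (2 * pi)) *\<^sub>R rvec u) \<in> torus_stab (dir (orbit_pt a b (z, y, h)))"
    unfolding proj_def x x' by (auto simp: torus_coset_eq_iff orbit_pt_eq_iff)
  then obtain \<alpha> \<beta> where ab: "z = 0 \<or> \<alpha> = 0" "y = 0 \<or> \<beta> = 0"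
    "(Arg z' / (2 * pi)) *\<^sub>R rvec (w a) + (Arg y' / (2 * pi)) *\<^sub>R rvec u
      - ((Arg z / (2 * pi)) *\<^sub>R rvec (w a) + (Arg y / (2 * pi)) *\<^sub>R rvec u) - (\<alpha> *\<^sub>R rvec (w a) + \<beta> *\<^sub>R rvec u) \<in> lattice"
    unfolding dir_orbit_pt torus_stab_frame by blast
  \<comment> \<open>Subtracting the stabiliser parameters does not change the effect on the point,
    since each of them is 0 unless its coordinate vanishes.\<close>
  define s1 s2 where "s1 = Arg z' / (2 * pi) - Arg z / (2 * pi) - \<alpha>" and "s2 = Arg y' / (2 * pi) - Arg y / (2 * pi) - \<beta>"
  have eq: "c' = cis (2 * pi * (Arg c' / (2 * pi) - Arg c / (2 * pi) - \<gamma>)) * c"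
    if "cmod c = cmod c'" "c = 0 \<or> \<gamma> = 0" for c c' \<gamma>
  proof (cases "c = 0")
    case False
    with that have g: "\<gamma> = 0" by simp
    have pol: "complex_of_real (cmod d) * cis (Arg d) = d" for d
      using rcis_cmod_Arg[of d] by (simp add: rcis_def)
    have "2 * pi * (Arg c' / (2 * pi) - Arg c / (2 * pi) - \<gamma>) = Arg c' - Arg c"
      using g by (simp add: field_simps)
    moreover have "cis (Arg c' - Arg c) * c = complex_of_real (cmod c) * (cis (Arg c' - Arg c) * cis (Arg c))"
      by (subst pol[of c, symmetric]) (simp only: mult_ac)
    moreover have "\<dots> = c'"
      using pol[of c'] that(1) by (simp add: cis_mult)
    ultimately show ?thesis
      by simp
  qed (use that in auto)
  have "s1 *\<^sub>R rvec (w a) + s2 *\<^sub>R rvec u \<in> lattice"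
    using ab(3) by (simp add: s1_def s2_def algebra_simps)
  moreover have "x' = rot s1 s2 x"
    unfolding rot_def x x' s1_def s2_def using eq norms ab(1,2) by simp
  ultimately show "\<exists>s1 s2. s1 *\<^sub>R rvec (w a) + s2 *\<^sub>R rvec u \<in> lattice \<and> x' = rot s1 s2 x"
    by blast
next
  assume "\<exists>s1 s2. s1 *\<^sub>R rvec (w a) + s2 *\<^sub>R rvec u \<in> lattice \<and> x' = rot s1 s2 x"
  then show "proj a b x = proj a b x'"
    by (auto simp: proj_rot proj_def[of a b x] act_lattice)
qed

section \<open>Changes of charts and their signs\<close>

lemma openin_halfspace_Int: "open U \<Longrightarrow> openin (top_of_set halfspace) (halfspace \<inter> U)"
  by (auto simp: openin_open)

lemma signed_lift_rot:
  "signed_lift halfspace (act (\<alpha> *\<^sub>R rvec (w a) + \<beta> *\<^sub>R rvec u)) (chart a b) (chart a b) halfspace (rot \<alpha> \<beta>) 1"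
  unfolding signed_lift_def is_lift_def
proof (intro conjI ballI)
  show "\<exists>D. (rot \<alpha> \<beta> has_derivative D) (at z within halfspace) \<and> sgn (det (matrix D)) = 1" for z
    using det_rot_pos rot_has_derivative by (intro exI[of _ "rot \<alpha> \<beta>"]) auto
qed (simp_all add: rot_image_halfspace diffeo_rot proj_rot)

lemma signed_lift_act:
  "signed_lift halfspace (act t) (chart a b) (chart a b) halfspace (rot (coord_w a t) (coord_u a t)) 1"
  using signed_lift_rot[of "coord_w a t" a "coord_u a t" b] frame_expand[of t a] by simp

lemma orbit_pt_inversion:
  assumes "rho2 y h \<noteq> 0"
  shows "orbit_pt a (\<not> b) (z, y /\<^sub>R rho2 y h, h /\<^sub>R rho2 y h) = orbit_pt a b (z, y, h)"
proof -
  define r where "r = rho2 y h"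
  have "r > 0"
    using assms rho2_nonneg[of y h] unfolding r_def by linarith
  have inv: "rho2 (y /\<^sub>R r) (h /\<^sub>R r) = inverse r"
    using rho2_inverse[OF assms] by (simp only: r_def)
  show ?thesis
    unfolding orbit_pt_def prod.case r_def[symmetric] inv using \<open>r > 0\<close> by (auto simp: field_simps)
qed

text \<open>Scaling by a positive factor preserves the argument of \<open>y\<close>, so only the
  orbit point has to be compared.\<close>

lemma proj_inversion:
  assumes "x \<in> inversion_dom"
  shows "proj a (\<not> b) (inversion x) = proj a b x"
proof -
  obtain z y h where x: "to_C5 x = (z, y, h)"
    by (metis prod_cases3)
  have ne: "rho2 y h \<noteq> 0"
    using assms by (simp only: inversion_dom_def mem_Collect_eq x fst_conv snd_conv) simp
  then have "inverse (rho2 y h) > 0"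
    using rho2_nonneg[of y h] by (simp only: positive_imp_inverse_positive less_le) simp
  then have "Arg (y /\<^sub>R rho2 y h) = Arg y"
    by (simp only: scaleR_conv_of_real Arg_times_of_real)
  then show ?thesis
    unfolding proj_def inversion_def x Let_def prod.case to_of_C5 fst_conv snd_conv orbit_pt_inversion[OF ne] by simp
qed

lemma signed_lift_inversion:
  "signed_lift halfspace (\<lambda>p. p) (chart a b) (chart a (\<not> b)) (halfspace \<inter> inversion_dom) inversion (-1)"
  unfolding signed_lift_def is_lift_def
proof (intro conjI ballI)
  show "\<exists>D. (inversion has_derivative D) (at x within halfspace \<inter> inversion_dom) \<and> sgn (det (matrix D)) = -1"
    if "x \<in> halfspace \<inter> inversion_dom" for x
    using inversion_has_derivative[of x] that by (auto intro: has_derivative_at_withinI)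
  show "diffeo_onto_image (halfspace \<inter> inversion_dom) inversion"
    by (rule diffeo_onto_imageI[where k = inversion])
      (auto simp: inversion_image inversion_inversion intro: smooth_on_Cinf[OF Cinf_on_inversion])
qed (simp_all add: inversion_image openin_halfspace_Int open_inversion_dom proj_inversion)

text \<open>Together with \<open>shift\<close>, the parameters of \<open>twist\<close> between the
  two ends: an angle along \<open>w a\<close> is \<open>ratio a\<close> times that angle along
  \<open>w (\<not> a)\<close> and \<open>shift a\<close> times it along \<open>u\<close>.\<close>

definition ratio :: "bool \<Rightarrow> real" where "ratio a = coord_w (\<not> a) (rvec (w a))"

definition shift :: "bool \<Rightarrow> real" where "shift a = coord_u (\<not> a) (rvec (w a))"

lemma rvec_w: "rvec (w a) = ratio a *\<^sub>R rvec (w (\<not> a)) + shift a *\<^sub>R rvec u"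
  unfolding ratio_def shift_def by (rule frame_expand)

lemma ratio_eq: "ratio a = idet (w a) u / idet (w (\<not> a)) u"
  by (simp add: ratio_def coord_w_def real_idet[of "w a" u])

lemma ratio_nonzero: "ratio a \<noteq> 0"
  using indep[of a] indep[of "\<not> a"] by (simp add: ratio_eq)

text \<open>The ratios are inverse to each other. Their common sign is what allows the signs of the
  flips to be written as quotients of chart signs.\<close>

lemma sgn_ratio: "sgn (ratio True) = sgn (ratio False)"
  by (simp add: ratio_eq sgn_divide)

lemma orbit_pt_flip:
  assumes "z \<noteq> 0" "cmod z' = inverse (cmod z)" "cmod y' = cmod y"
  shows "orbit_pt (\<not> a) b (z', y', h) = orbit_pt a b (z, y, h)"
  using radial_inverse[OF assms(1,2)] assms(3) by (cases a) (auto simp: orbit_pt_def rho2_def)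

lemma proj_flip:
  assumes "z = cmod z *\<^sub>R cis (2 * pi * \<alpha>)" "z \<noteq> 0"
  shows "proj (\<not> a) b (of_C5 (inverse (cmod z) *\<^sub>R cis (2 * pi * (ratio a * \<alpha>)), y * cis (2 * pi * (shift a * \<alpha>)), h))
    = proj a b (of_C5 (z, y, h))"
proof -
  let ?z = "inverse (cmod z) *\<^sub>R cis (2 * pi * (ratio a * \<alpha>))" and ?y = "y * cis (2 * pi * (shift a * \<alpha>))"
  let ?\<beta> = "Arg y / (2 * pi)"
  have z: "?z = cmod ?z *\<^sub>R cis (2 * pi * (ratio a * \<alpha>))"
    by simp
  have y: "?y = cmod ?y *\<^sub>R cis (2 * pi * (shift a * \<alpha> + ?\<beta>))"
    using polar_rot[OF polar_Arg, of "shift a * \<alpha>" y] by (simp only: mult.commute)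
  have "proj (\<not> a) b (of_C5 (?z, ?y, h)) = torus_coset dir ((ratio a * \<alpha>) *\<^sub>R rvec (w (\<not> a))
      + (shift a * \<alpha> + ?\<beta>) *\<^sub>R rvec u) (orbit_pt (\<not> a) b (?z, ?y, h))"
    by (rule proj_polar[OF z y])
  also have "orbit_pt (\<not> a) b (?z, ?y, h) = orbit_pt a b (z, y, h)"
    using assms(2) by (intro orbit_pt_flip) (auto simp: norm_mult)
  also have "(ratio a * \<alpha>) *\<^sub>R rvec (w (\<not> a)) + (shift a * \<alpha> + ?\<beta>) *\<^sub>R rvec u = \<alpha> *\<^sub>R rvec (w a) + ?\<beta> *\<^sub>R rvec u"
    by (subst (2) rvec_w) (simp add: algebra_simps)
  also have "torus_coset dir (\<alpha> *\<^sub>R rvec (w a) + ?\<beta> *\<^sub>R rvec u) (orbit_pt a b (z, y, h)) = proj a b (of_C5 (z, y, h))"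
    by (rule proj_polar[OF assms(1) polar_Arg, symmetric])
  finally show ?thesis .
qed

text \<open>Holds for every nonzero z because the branch of the logarithm agrees with
  \<open>Arg\<close>; only the smoothness of \<open>twist\<close> is confined to
  \<open>twist_dom\<close>.\<close>

lemma proj_twist:
  assumes "z_of x \<noteq> 0"
  shows "proj (\<not> a) b (twist (ratio a) (shift a) x) = proj a b x"
proof -
  obtain z y h where x: "to_C5 x = (z, y, h)"
    by (metis prod_cases3)
  then have xC: "x = of_C5 (z, y, h)"
    by (metis of_to_C5)
  have z: "z \<noteq> 0"
    using assms x by simp
  let ?\<alpha> = "Arg z / (2 * pi)"
  have L: "Im (Ln z) = Arg z" "Re (Ln z) = ln (cmod z)"
    using z by (simp_all add: Arg_eq_Im_Ln)
  have e: "exp (Complex (- ln (cmod z)) t) = inverse (cmod z) *\<^sub>R cis t" for t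
    using z by (simp add: exp_eq_polar exp_minus scaleR_conv_of_real)
  have "twist (ratio a) (shift a) x =
      of_C5 (inverse (cmod z) *\<^sub>R cis (2 * pi * (ratio a * ?\<alpha>)), y * cis (2 * pi * (shift a * ?\<alpha>)), h)"
    by (simp add: twist_def x Let_def L e)
  then show ?thesis
    using proj_flip[OF polar_Arg z] xC by simp
qed

text \<open>Phrased as a relation between points of charts, so that changes of charts can be chained
  by \<open>conn_trans\<close> without tracking domains.\<close>

definition conn :: "real \<Rightarrow> bool \<Rightarrow> bool \<Rightarrow> real^(4 option) \<Rightarrow> bool \<Rightarrow> bool \<Rightarrow> real^(4 option) \<Rightarrow> bool" where
  "conn \<sigma> a b x a' b' y \<longleftrightarrow>
     (\<exists>N h. x \<in> N \<and> h x = y \<and> signed_lift halfspace (\<lambda>p. p) (chart a b) (chart a' b') N h \<sigma>)"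

lemma connI:
  "signed_lift halfspace (\<lambda>p. p) (chart a b) (chart a' b') N h \<sigma> \<Longrightarrow> x \<in> N \<Longrightarrow> conn \<sigma> a b x a' b' (h x)"
  unfolding conn_def by (intro exI[of _ N] exI[of _ h]) simp

lemma conn_trans:
  assumes "conn \<sigma> a b x a' b' y" "conn \<tau> a' b' y a'' b'' z"
  shows "conn (\<sigma> * \<tau>) a b x a'' b'' z"
proof -
  obtain N h where h: "x \<in> N" "h x = y" "signed_lift halfspace (\<lambda>p. p) (chart a b) (chart a' b') N h \<sigma>"
    using assms(1) by (auto simp: conn_def)
  obtain N' h' where h': "y \<in> N'" "h' y = z" "signed_lift halfspace (\<lambda>p. p) (chart a' b') (chart a'' b'') N' h' \<tau>"
    using assms(2) by (auto simp: conn_def)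
  have "signed_lift halfspace (\<lambda>p. p) (chart a b) (chart a'' b'') (N \<inter> h -` N') (\<lambda>x. h' (h x)) (\<sigma> * \<tau>)"
    by (rule signed_lift_compose[OF h(3) h'(3)]) simp
  from connI[OF this, of x] h(1,2) h'(1,2) show ?thesis
    by simp
qed

lemma conn_proj:
  assumes "conn \<sigma> a b x a' b' y"
  shows "proj a' b' y = proj a b x" "y \<in> halfspace"
proof -
  obtain N h where h: "x \<in> N" "h x = y" "is_lift halfspace (\<lambda>p. p) (chart a b) (chart a' b') N h"
    using assms by (auto simp: conn_def signed_lift_def)
  then show "proj a' b' y = proj a b x" "y \<in> halfspace"
    unfolding is_lift_def by auto
qed

lemma conn_group:
  assumes "x \<in> halfspace" "proj a b x = proj a b y"
  shows "conn 1 a b x a b y"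
proof -
  obtain s1 s2 where s: "s1 *\<^sub>R rvec (w a) + s2 *\<^sub>R rvec u \<in> lattice" "y = rot s1 s2 x"
    using assms(2) proj_fibre by blast
  have "signed_lift halfspace (\<lambda>p. p) (chart a b) (chart a b) halfspace (rot s1 s2) 1"
    by (rule signed_lift_cong[OF signed_lift_rot]) (use s(1) in \<open>simp add: proj_def act_lattice\<close>)
  from connI[OF this assms(1)] s(2) show ?thesis by simp
qed

lemma conn_inversion:
  assumes "x \<in> halfspace" "x \<in> inversion_dom"
  shows "conn (-1) a b x a (\<not> b) (inversion x)"
  using connI[OF signed_lift_inversion] assms by simp

lemma conn_twist:
  assumes "x \<in> halfspace" "to_C5 x = (of_real r, y, h)" "r > 0"
  shows "conn (- sgn (ratio a)) a b x (\<not> a) b (twist (ratio a) (shift a) x)"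
proof -
  let ?f = "twist (ratio a) (shift a)" and ?N = "halfspace \<inter> twist_dom (ratio a)"
  have N: "openin (top_of_set halfspace) ?N"
    by (intro openin_halfspace_Int open_twist_dom)
  have diffeo: "diffeo_onto_image ?N ?f"
  proof (rule diffeo_onto_imageI[where k = "twist (inverse (ratio a)) (- (shift a / ratio a))"])
    show "smooth_on (?f ` ?N) (twist (inverse (ratio a)) (- (shift a / ratio a)))"
      unfolding twist_image[OF ratio_nonzero] by (rule smooth_on_Cinf[OF Cinf_on_twist]) simp
  qed (auto intro: smooth_on_Cinf[OF Cinf_on_twist] simp: twist_twist ratio_nonzero)
  have lift: "is_lift halfspace (\<lambda>p. p) (chart a b) (chart (\<not> a) b) ?N ?f"
    unfolding is_lift_def twist_image[OF ratio_nonzero]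
  proof (intro conjI ballI)
    fix z assume "z \<in> ?N"
    then show "cproj (chart (\<not> a) b) (?f z) = cproj (chart a b) z"
      by (auto simp: twist_dom_def intro!: proj_twist)
  qed (auto simp: N diffeo openin_halfspace_Int open_twist_dom)
  have x: "x \<in> ?N"
    using assms by (simp add: twist_dom_def Ln_of_real)
  obtain D where D: "(?f has_derivative D) (at x)" "sgn (det (matrix D)) = - sgn (ratio a)"
    using twist_has_derivative[OF ratio_nonzero assms(3,2)] by blast
  \<comment> \<open>The sign is computed at \<open>x\<close> alone and extends to a neighbourhood by
    local constancy.\<close>
  obtain U where U: "open U" "x \<in> U"
    "\<And>y D'. y \<in> U \<inter> ?N \<Longrightarrow> (?f has_derivative D') (at y within ?N) \<Longrightarrow> sgn (det (matrix D')) = sgn (det (matrix D))"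
    using diffeo_halfspace_sign_locally_constant[OF N diffeo x has_derivative_at_withinI[OF D(1)]] by blast
  have op: "openin (top_of_set ?N) (?N \<inter> U)"
    using U(1) by (auto simp: openin_open)
  have "signed_lift halfspace (\<lambda>p. p) (chart a b) (chart (\<not> a) b) (?N \<inter> U) ?f (- sgn (ratio a))"
    unfolding signed_lift_def
  proof (intro conjI ballI)
    show "is_lift halfspace (\<lambda>p. p) (chart a b) (chart (\<not> a) b) (?N \<inter> U) ?f"
      by (rule is_lift_restrict[OF lift op])
    fix z assume z: "z \<in> ?N \<inter> U"
    then have "z \<in> ?N" by blast
    moreover have "smooth_on ?N ?f"
      using diffeo by (simp add: diffeo_onto_image_def)
    ultimately obtain D' where D': "(?f has_derivative D') (at z within ?N)"
      using smooth_on_has_derivative by blast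
    moreover have "z \<in> U \<inter> ?N"
      using z by blast
    ultimately show "\<exists>D. (?f has_derivative D) (at z within ?N \<inter> U) \<and> sgn (det (matrix D)) = - sgn (ratio a)"
      using U(3) D(2) by (intro exI[of _ D'] conjI has_derivative_subset[OF D']) auto
  qed
  from connI[OF this, of x] x U(2) show ?thesis by simp
qed

text \<open>A torus element \<open>t\<close> along \<open>w a\<close> makes z positive real, where
  \<open>conn_twist\<close> applies. Acting by \<open>- t\<close> afterwards turns the composite
  into a lift of the identity, and rotations do not affect the sign.\<close>

lemma conn_flip:
  assumes x: "x \<in> halfspace" and z: "z_of x \<noteq> 0"
  shows "\<exists>y. conn (- sgn (ratio a)) a b x (\<not> a) b y"
proof -
  let ?z = "z_of x"
  define \<alpha> where "\<alpha> = - (Arg ?z / (2 * pi))"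
  define t where "t = \<alpha> *\<^sub>R rvec (w a)"
  have co: "coord_w a t = \<alpha>" "coord_u a t = 0"
    using frame_unique[of t \<alpha> a 0] by (simp_all add: t_def)
  define x1 where "x1 = rot \<alpha> 0 x"
  have x1: "to_C5 x1 = (of_real (cmod ?z), y_of x, h_of x)"
  proof -
    have "cis (- Arg ?z) * (complex_of_real (cmod ?z) * cis (Arg ?z)) = of_real (cmod ?z)"
      by (simp add: mult.left_commute[of "cis _"] cis_mult)
    then have "cis (- Arg ?z) * ?z = of_real (cmod ?z)"
      using rcis_cmod_Arg[of ?z] by (simp only: rcis_def)
    then show ?thesis
      by (simp add: x1_def rot_def \<alpha>_def)
  qed
  have "conn (- sgn (ratio a)) a b x1 (\<not> a) b (twist (ratio a) (shift a) x1)"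
    by (rule conn_twist[OF _ x1]) (use x z in \<open>auto simp: x1_def\<close>)
  then obtain N h where h: "x1 \<in> N" "signed_lift halfspace (\<lambda>p. p) (chart a b) (chart (\<not> a) b) N h (- sgn (ratio a))"
    by (auto simp: conn_def)
  have l1: "signed_lift halfspace (act t) (chart a b) (chart a b) halfspace (rot \<alpha> 0) 1"
    using signed_lift_act[of t a b] by (simp add: co)
  have l2: "signed_lift halfspace (act t) (chart a b) (chart (\<not> a) b) (halfspace \<inter> rot \<alpha> 0 -` N)
      (\<lambda>x. h (rot \<alpha> 0 x)) (- sgn (ratio a))"
    using signed_lift_compose[OF l1 h(2)] by simp
  \<comment> \<open>The way back is taken in the target chart, so \<open>- t\<close> is expanded in
    the frame of \<open>\<not> a\<close>.\<close>
  let ?h = "\<lambda>x. rot (coord_w (\<not> a) (- t)) (coord_u (\<not> a) (- t)) (h (rot \<alpha> 0 x))"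
  have l3: "signed_lift halfspace (\<lambda>p. act (- t) (act t p)) (chart a b) (chart (\<not> a) b)
      ((halfspace \<inter> rot \<alpha> 0 -` N) \<inter> (\<lambda>x. h (rot \<alpha> 0 x)) -` halfspace) ?h (- sgn (ratio a))"
    using signed_lift_compose[OF l2 signed_lift_act[of "- t"]] by simp
  have l4: "signed_lift halfspace (\<lambda>p. p) (chart a b) (chart (\<not> a) b)
      ((halfspace \<inter> rot \<alpha> 0 -` N) \<inter> (\<lambda>x. h (rot \<alpha> 0 x)) -` halfspace) ?h (- sgn (ratio a))"
    by (rule signed_lift_cong[OF l3]) (simp add: proj_def act_torus_coset)
  have "h (rot \<alpha> 0 x) \<in> halfspace"
    using h x1_def conn_proj(2)[of _ a b x1 "\<not> a" b "h x1"] connI by blast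
  with connI[OF l4, of x] h(1) x show ?thesis
    by (auto simp: x1_def)
qed

text \<open>The end of [0,1] named by \<open>a\<close> is reached only by charts with this
  \<open>a\<close>, because \<open>radial z < 1\<close>. Likewise the end of the diameter at the
  origin of the (y, h)-space is reached only by charts with this \<open>b\<close>.\<close>

lemma orbit_pt_eq_imp:
  assumes "orbit_pt a b (to_C5 x) = orbit_pt a' b' (to_C5 y)"
  shows "a \<noteq> a' \<Longrightarrow> z_of x \<noteq> 0" "b \<noteq> b' \<Longrightarrow> x \<in> inversion_dom"
proof -
  obtain z1 y1 h1 where x: "to_C5 x = (z1, y1, h1)"
    by (metis prod_cases3)
  obtain z2 y2 h2 where y: "to_C5 y = (z2, y2, h2)"
    by (metis prod_cases3)
  have eq: "orbit_pt a b (z1, y1, h1) = orbit_pt a' b' (z2, y2, h2)"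
    using assms x y by simp
  show "z_of x \<noteq> 0" if "a \<noteq> a'"
  proof
    assume "z_of x = 0"
    then have "radial z1 = 0"
      using x by simp
    moreover have "(if a then 1 - radial z1 else radial z1) = (if a' then 1 - radial z2 else radial z2)"
      using eq by (simp add: orbit_pt_def)
    ultimately show False
      using that radial_bounds(2)[of z2] by (cases a; cases a') (simp_all del: radial_eq_0_iff)
  qed
  show "x \<in> inversion_dom" if "b \<noteq> b'"
  proof (rule ccontr)
    assume "x \<notin> inversion_dom"
    then have r: "rho2 y1 h1 = 0"
      using x by (simp add: inversion_dom_def)
    have "1 + rho2 y2 h2 > 0"
      using rho2_nonneg[of y2 h2] by linarith
    moreover have "(if b then 1 / (1 + rho2 y1 h1) else rho2 y1 h1 / (1 + rho2 y1 h1)) =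
        (if b' then 1 / (1 + rho2 y2 h2) else rho2 y2 h2 / (1 + rho2 y2 h2))"
      using eq by (simp add: orbit_pt_def)
    ultimately show False
      using that r by (cases b; cases b') (simp_all add: divide_eq_eq eq_divide_eq del: rho2_eq_0_iff)
  qed
qed

lemma proj_eq_imp_orbit_pt_eq:
  "proj a b x = proj a' b' y \<Longrightarrow> orbit_pt a b (to_C5 x) = orbit_pt a' b' (to_C5 y)"
  by (simp add: proj_def torus_coset_eq_iff)

lemmas proj_eq_imp = orbit_pt_eq_imp[OF proj_eq_imp_orbit_pt_eq]

text \<open>The 0-cochain whose coboundary is the orientation character.\<close>

definition sign :: "bool \<Rightarrow> bool \<Rightarrow> real" where
  "sign a b = (if a then - sgn (ratio False) else 1) * (if b then -1 else 1)"

text \<open>First \<open>a\<close> is changed to \<open>a'\<close> by a flip, then \<open>b\<close>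
  to \<open>b'\<close> by an inversion. Agreement of the orbit points guarantees that the coordinate
  to be inverted does not vanish.\<close>

lemma conn_all:
  assumes x: "x \<in> halfspace" and eq: "proj a b x = proj a' b' y"
  shows "conn (sign a b * sign a' b') a b x a' b' y"
proof -
  have sg: "sgn (ratio False) * sgn (ratio False) = 1" "sgn (ratio False) * (sgn (ratio False) * c) = c" for c
    using ratio_nonzero[of False] by (auto simp: sgn_if)
  have one: "conn 1 a b x a b x"
    by (rule conn_group[OF x refl])
  have "\<exists>x1. conn (sign a b * sign a' b) a b x a' b x1"
  proof (cases "a = a'")
    case True
    then show ?thesis
      using one by (auto simp: sign_def sg ratio_nonzero intro!: exI[of _ x])
  next
    case False
    with conn_flip[OF x proj_eq_imp(1)[OF eq False], of a b] sgn_ratio show ?thesis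
      by (cases a; cases a'; cases b) (auto simp: sign_def)
  qed
  then obtain x1 where x1: "conn (sign a b * sign a' b) a b x a' b x1"
    by blast
  note p1 = conn_proj[OF x1]
  have "\<exists>x2. conn (sign a' b * sign a' b') a' b x1 a' b' x2"
  proof (cases "b = b'")
    case True
    then show ?thesis
      using conn_group[OF p1(2) refl, of a' b] by (auto simp: sign_def sg ratio_nonzero intro!: exI[of _ x1])
  next
    case False
    have "x1 \<in> inversion_dom"
      using proj_eq_imp(2)[of a' b x1 a' b' y] p1(1) eq False by simp
    then have "conn (-1) a' b x1 a' (\<not> b) (inversion x1)"
      by (rule conn_inversion[OF p1(2)])
    then show ?thesis
      using False by (cases a'; cases b; cases b') (auto simp: sign_def sg ratio_nonzero)
  qed
  then obtain x2 where x2: "conn (sign a' b * sign a' b') a' b x1 a' b' x2"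
    by blast
  note p2 = conn_proj[OF x2]
  \<comment> \<open>Flip and inversion reach some point over the right class; a group element, of
    sign 1, moves it to \<open>y\<close>.\<close>
  have "conn 1 a' b' x2 a' b' y"
    using conn_group[OF p2(2), of a' b' y] p2(1) p1(1) eq by simp
  from conn_trans[OF conn_trans[OF x1 x2] this]
  show ?thesis
    by (cases a; cases a'; cases b; cases b') (simp_all add: sign_def sg ratio_nonzero)
qed

section \<open>Gluing the four charts; the chart groups\<close>

definition atlas :: "(real^(4 option), big_point) orb_chart set" where
  "atlas = {chart a b | a b. True}"

definition bordism :: "(real^(4 option), big_point) torus_orb" where
  "bordism = \<lparr> tspace = glue_topology atlas, tatlas = atlas, tact = act \<rparr>"

lemma bordism_simps [simp]:
  "tspace bordism = glue_topology atlas" "tatlas bordism = atlas" "tact bordism = act"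
  by (simp_all add: bordism_def)

lemma finite_atlas: "finite atlas"
proof -
  have "atlas = (\<lambda>(a, b). chart a b) ` UNIV"
    by (auto simp: atlas_def)
  then show ?thesis by simp
qed

lemma atlasI [simp]: "chart a b \<in> atlas"
  by (auto simp: atlas_def)

lemma atlasE:
  assumes "c \<in> atlas"
  obtains a b where "c = chart a b"
  using assms by (auto simp: atlas_def)

lemma topspace_bordism: "p \<in> topspace (glue_topology atlas) \<longleftrightarrow> (\<exists>a b. \<exists>x\<in>halfspace. p = proj a b x)"
proof
  assume "p \<in> topspace (glue_topology atlas)"
  then obtain c x where c: "c \<in> atlas" "x \<in> cdom c" "p = cproj c x"
    by (auto simp: topspace_glue_topology)
  obtain a b where "c = chart a b"
    using c(1) by (rule atlasE)
  with c show "\<exists>a b. \<exists>x\<in>halfspace. p = proj a b x"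
    by auto
next
  assume "\<exists>a b. \<exists>x\<in>halfspace. p = proj a b x"
  then obtain a b x where "x \<in> halfspace" "p = proj a b x"
    by blast
  then show "p \<in> topspace (glue_topology atlas)"
    unfolding topspace_glue_topology by (intro UN_I[OF atlasI[of a b]]) simp
qed

lemma compatible_atlas: "compatible_charts halfspace atlas"
  unfolding compatible_charts_def
proof (intro conjI ballI impI)
  fix c d x y assume c: "c \<in> atlas" and d: "d \<in> atlas" and x: "x \<in> cdom c" and eq: "cproj c x = cproj d y"
  obtain a b where ab: "c = chart a b"
    using c by (rule atlasE)
  obtain a' b' where ab': "d = chart a' b'"
    using d by (rule atlasE)
  have "conn (sign a b * sign a' b') a b x a' b' y"
    using x eq by (intro conn_all) (simp_all add: ab ab')
  then show "\<exists>N h. x \<in> N \<and> h x = y \<and> is_lift halfspace (\<lambda>p. p) c d N h"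
    unfolding conn_def signed_lift_def ab ab' by blast
qed (auto elim: atlasE)

lemma rot_mod:
  assumes "d \<noteq> 0"
  shows "rot (real_of_int i / d) (real_of_int j / d) = rot (real_of_int (i mod d) / d) (real_of_int (j mod d) / d)"
proof -
  have "cis (2 * pi * (real_of_int i / d)) = cis (2 * pi * (real_of_int (i mod d) / d))" for i
  proof -
    have "real_of_int i = real_of_int (i div d) * d + real_of_int (i mod d)"
      by (metis div_mult_mod_eq of_int_add of_int_mult)
    then have "real_of_int i / d = real_of_int (i div d) + real_of_int (i mod d) / d"
      using assms by (simp add: field_simps)
    then show ?thesis
      by (simp add: distrib_left cis_mult[symmetric])
  qed
  then show ?thesis
    by (simp add: rot_def[abs_def])
qed

text \<open>By Cramer's rule, the coordinates of a lattice vector have the common denominator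
  \<open>d = idet (w a) u\<close>. A rotation depends only on the numerators modulo
  \<open>d\<close>.\<close>

lemma finite_cgrp: "finite (cgrp (chart a b))"
proof -
  define d where "d = idet (w a) u"
  have d: "d \<noteq> 0"
    using indep by (simp add: d_def)
  let ?F = "(\<lambda>(i, j). restrict (rot (real_of_int i / d) (real_of_int j / d)) halfspace)
      ` ((\<lambda>i. i mod d) ` UNIV \<times> (\<lambda>i. i mod d) ` UNIV)"
  have "finite (range (\<lambda>i. i mod d))"
  proof (rule finite_subset)
    show "range (\<lambda>i. i mod d) \<subseteq> {- \<bar>d\<bar>..\<bar>d\<bar>}"
    proof clarify
      fix i :: int
      have "\<bar>i mod d\<bar> < \<bar>d\<bar>"
        using d by (rule abs_mod_less)
      then show "i mod d \<in> {- \<bar>d\<bar>..\<bar>d\<bar>}" by auto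
    qed
  qed simp
  then have "finite ?F" by simp
  moreover have "cgrp (chart a b) \<subseteq> ?F"
  proof
    fix g assume "g \<in> cgrp (chart a b)"
    then obtain s1 s2 where s: "g = restrict (rot s1 s2) halfspace" "s1 *\<^sub>R rvec (w a) + s2 *\<^sub>R rvec u \<in> lattice"
      by auto
    let ?t = "s1 *\<^sub>R rvec (w a) + s2 *\<^sub>R rvec u"
    obtain m n where mn: "fst ?t = real_of_int m" "snd ?t = real_of_int n"
      using s(2) unfolding lattice_iff by (auto elim!: Ints_cases)
    define i j where "i = m * snd u - n * fst u" and "j = fst (w a) * n - snd (w a) * m"
    have "s1 = real_of_int i / d" "s2 = real_of_int j / d"
      using frame_unique[OF refl[of ?t]] mn by (simp_all add: coord_w_def coord_u_def d_def i_def j_def rvec_def)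
    then have "g = restrict (rot (real_of_int (i mod d) / d) (real_of_int (j mod d) / d)) halfspace"
      using s(1) rot_mod[OF d] by simp
    then show "g \<in> ?F" by auto
  qed
  ultimately show ?thesis
    by (rule finite_subset[rotated])
qed

lemma rot_Bij: "restrict (rot s1 s2) halfspace \<in> Bij halfspace"
  unfolding Bij_def
  by (auto intro!: bij_betwI[where g = "rot (- s1) (- s2)"])

lemma subgroup_cgrp: "subgroup (cgrp (chart a b)) (BijGroup halfspace)"
proof (rule subgroup.intro)
  show "cgrp (chart a b) \<subseteq> carrier (BijGroup halfspace)"
    by (auto simp: BijGroup_def rot_Bij)
  show "x \<otimes>\<^bsub>BijGroup halfspace\<^esub> y \<in> cgrp (chart a b)" if xy: "x \<in> cgrp (chart a b)" "y \<in> cgrp (chart a b)" for x y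
  proof -
    obtain s1 s2 t1 t2 where s: "x = restrict (rot s1 s2) halfspace" "s1 *\<^sub>R rvec (w a) + s2 *\<^sub>R rvec u \<in> lattice"
      and t: "y = restrict (rot t1 t2) halfspace" "t1 *\<^sub>R rvec (w a) + t2 *\<^sub>R rvec u \<in> lattice"
      using xy by auto
    have "x \<otimes>\<^bsub>BijGroup halfspace\<^esub> y = restrict (rot (s1 + t1) (s2 + t2)) halfspace"
      by (auto simp: BijGroup_def rot_Bij s(1) t(1) compose_def rot_rot fun_eq_iff)
    moreover have "(s1 + t1) *\<^sub>R rvec (w a) + (s2 + t2) *\<^sub>R rvec u \<in> lattice"
      using lattice_closed(2)[OF s(2) t(2)] by (simp add: algebra_simps)
    ultimately show ?thesis by auto
  qed
  have "restrict (rot 0 0) halfspace \<in> cgrp (chart a b)"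
    by (auto intro!: exI[of _ "0 :: real"])
  moreover have "restrict (rot 0 0) halfspace = \<one>\<^bsub>BijGroup halfspace\<^esub>"
    by (simp add: BijGroup_def fun_eq_iff restrict_def)
  ultimately show "\<one>\<^bsub>BijGroup halfspace\<^esub> \<in> cgrp (chart a b)"
    by simp
  show "inv\<^bsub>BijGroup halfspace\<^esub> x \<in> cgrp (chart a b)" if x: "x \<in> cgrp (chart a b)" for x
  proof -
    obtain s1 s2 where s: "x = restrict (rot s1 s2) halfspace" "s1 *\<^sub>R rvec (w a) + s2 *\<^sub>R rvec u \<in> lattice"
      using x by auto
    have "inv_into halfspace x y = rot (- s1) (- s2) y" if "y \<in> halfspace" for y
    proof (rule inv_into_f_eq)
      show "inj_on x halfspace"
        using rot_Bij[of s1 s2] by (simp add: Bij_def bij_betw_def s(1))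
    qed (use that in \<open>simp_all add: s(1)\<close>)
    then have "inv\<^bsub>BijGroup halfspace\<^esub> x = restrict (rot (- s1) (- s2)) halfspace"
      using rot_Bij[of s1 s2] by (auto simp: inv_BijGroup s(1) fun_eq_iff restrict_def)
    moreover have "(- s1) *\<^sub>R rvec (w a) + (- s2) *\<^sub>R rvec u \<in> lattice"
      using lattice_closed(3)[OF s(2)] by (simp add: algebra_simps)
    ultimately show ?thesis
      unfolding chart_simps by blast
  qed
qed

lemma chart_fibre:
  assumes "x \<in> halfspace"
  shows "proj a b x = proj a b y \<longleftrightarrow> (\<exists>g\<in>cgrp (chart a b). y = g x)"
proof
  assume "proj a b x = proj a b y"
  then obtain s1 s2 where s: "s1 *\<^sub>R rvec (w a) + s2 *\<^sub>R rvec u \<in> lattice" "y = rot s1 s2 x"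
    unfolding proj_fibre by blast
  then have "restrict (rot s1 s2) halfspace \<in> cgrp (chart a b)" "y = restrict (rot s1 s2) halfspace x"
    using assms by auto
  then show "\<exists>g\<in>cgrp (chart a b). y = g x"
    by blast
next
  assume "\<exists>g\<in>cgrp (chart a b). y = g x"
  then obtain s1 s2 where "s1 *\<^sub>R rvec (w a) + s2 *\<^sub>R rvec u \<in> lattice" "y = restrict (rot s1 s2) halfspace x"
    by auto
  with assms show "proj a b x = proj a b y"
    unfolding proj_fibre by auto
qed

lemma atlas_fibre:
  assumes "c \<in> atlas" "x \<in> cdom c"
  shows "cproj c x = cproj c y \<longleftrightarrow> (\<exists>g\<in>cgrp c. y = g x)"
proof -
  obtain a b where "c = chart a b"
    using assms(1) by (rule atlasE)
  with assms(2) chart_fibre[of x a b y] show ?thesis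
    by (simp only: chart_simps(1,2))
qed

section \<open>The free part of the charts, and separation of points\<close>

definition regular :: "(real^(4 option)) set" where
  "regular = {x. z_of x \<noteq> 0 \<and> y_of x \<noteq> 0}"

text \<open>A point is moved along (1, 1, 0); this leaves \<open>h\<close> unchanged, so it does not
  leave the half-space.\<close>

lemma regular_dense:
  assumes "openin (top_of_set halfspace) V" "V \<noteq> {}"
  shows "V \<inter> regular \<noteq> {}"
proof -
  obtain x where x: "x \<in> V"
    using assms(2) by blast
  obtain T where T: "open T" "V = halfspace \<inter> T"
    using assms(1) by (auto simp: openin_open)
  let ?f = "\<lambda>r. x + r *\<^sub>R of_C5 (1, 1, 0)"
  have "open (?f -` T)"
    by (intro open_vimage continuous_intros T(1))
  moreover have "0 \<in> ?f -` T"
    using x T(2) by simp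
  ultimately obtain e where e: "e > 0" "ball 0 e \<subseteq> ?f -` T"
    by (meson open_contains_ball)
  \<comment> \<open>For all other \<open>r\<close> the real parts of z + r and y + r are nonzero, so
    both coordinates are.\<close>
  let ?bad = "{- Re (z_of x), - Re (y_of x)}"
  have "infinite {0<..<e}"
    using e(1) by (rule infinite_Ioo)
  then have "infinite ({0<..<e} - ?bad)"
    by (intro Diff_infinite_finite) simp_all
  then obtain r where r: "r \<in> {0<..<e} - ?bad"
    using infinite_imp_nonempty by blast
  have "?f r \<in> T"
    using e(2) r by (auto simp: subset_iff)
  moreover have eq: "to_C5 (?f r) = to_C5 x + (of_real r, of_real r, 0)"
    by (simp add: linear_add[OF linear_to_C5] linear_scale[OF linear_to_C5] of_real_def)
  moreover have "x \<in> halfspace"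
    using x T(2) by blast
  ultimately have "?f r \<in> V"
    by (simp add: T(2) halfspace_iff)
  moreover have "?f r \<in> regular"
    using r eq by (auto simp: regular_def complex_eq_iff)
  ultimately show ?thesis by blast
qed

lemma rot_free:
  assumes "x \<in> regular" "rot s1 s2 x = rot t1 t2 x"
  shows "rot s1 s2 = rot t1 t2"
proof -
  have "to_C5 (rot s1 s2 x) = to_C5 (rot t1 t2 x)"
    using assms(2) by simp
  with assms(1) have "cis (2 * pi * s1) = cis (2 * pi * t1)" "cis (2 * pi * s2) = cis (2 * pi * t2)"
    by (auto simp: rot_def regular_def)
  then show ?thesis
    by (simp add: rot_def[abs_def])
qed

text \<open>All members of a class have the same second component, so the selected one is
  irrelevant. This is the map \<open>P\<close> of the Hausdorff criterion.\<close>

definition orbit_of :: "big_point \<Rightarrow> real \<times> real \<times> real" where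
  "orbit_of C = snd (SOME e. e \<in> C)"

lemma orbit_of_torus_coset [simp]: "orbit_of (torus_coset dir t p) = p"
proof -
  have "(t, p) \<in> torus_coset dir t p"
    by (simp add: torus_coset_def lattice_subset_torus_stab)
  then have "(SOME e. e \<in> torus_coset dir t p) \<in> torus_coset dir t p"
    by (rule someI)
  then show ?thesis
    by (auto simp: orbit_of_def torus_coset_def)
qed

lemma orbit_of_proj: "orbit_of (proj a b x) = orbit_pt a b (to_C5 x)"
  by (simp add: proj_def)

lemma continuous_orbit_pt: "continuous_on S (\<lambda>x. orbit_pt a b (to_C5 x))"
proof -
  have "1 + rho2 y h \<noteq> 0" for y h
    using rho2_nonneg[of y h] by linarith
  moreover have "1 + (cmod z)\<^sup>2 \<noteq> 0" for z
    using zero_le_power2[of "cmod z"] by linarith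
  moreover have "continuous_on S (\<lambda>x. rho2 (y_of x) (h_of x))"
    unfolding rho2_def by (intro continuous_intros)
  ultimately show ?thesis
    unfolding orbit_pt_def radial_def case_prod_unfold
    by (cases a; cases b) (auto intro!: continuous_intros)
qed

text \<open>Whether a class is covered by a chart depends on its orbit point only; the flip and the
  inversion supply a representative. Classes over one orbit point thus share a chart, as the
  Hausdorff criterion requires.\<close>

lemma proj_in_chart:
  assumes "y \<in> halfspace" "orbit_pt a b (to_C5 x) = orbit_pt a' b' (to_C5 y)"
  shows "\<exists>y'\<in>halfspace. proj a b y' = proj a' b' y"
proof -
  have "\<exists>y1\<in>halfspace. proj a b' y1 = proj a' b' y"
  proof (cases "a = a'")
    case False
    then have "z_of y \<noteq> 0"
      using orbit_pt_eq_imp(1)[OF assms(2)[symmetric]] by simp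
    from conn_flip[OF assms(1) this, of a' b'] obtain y1 where y1: "conn (- sgn (ratio a')) a' b' y (\<not> a') b' y1"
      by blast
    have "(\<not> a') = a"
      using False by auto
    with conn_proj[OF y1] show ?thesis
      by auto
  qed (use assms in auto)
  then obtain y1 where y1: "y1 \<in> halfspace" "proj a b' y1 = proj a' b' y"
    by blast
  then have "orbit_pt a b (to_C5 x) = orbit_pt a b' (to_C5 y1)"
    using assms(2) by (metis proj_eq_imp_orbit_pt_eq)
  then have "\<exists>y2\<in>halfspace. proj a b y2 = proj a b' y1"
  proof (cases "b = b'")
    case False
    assume "orbit_pt a b (to_C5 x) = orbit_pt a b' (to_C5 y1)"
    then have "y1 \<in> inversion_dom"
      using orbit_pt_eq_imp(2)[of a b' y1 a b x] False by simp
    from conn_proj[OF conn_inversion[OF y1(1) this, of a b']] False show ?thesis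
      by (cases b; cases b') auto
  qed (use y1 in auto)
  with y1(2) show ?thesis by simp
qed

lemma Hausdorff_bordism: "Hausdorff_space (glue_topology atlas)"
proof (rule Hausdorff_glue_topology[OF compatible_atlas, where P = orbit_of])
  show "continuous_on (cdom c) (\<lambda>x. orbit_of (cproj c x))" if "c \<in> atlas" for c
    using that by (auto elim!: atlasE simp: orbit_of_proj continuous_orbit_pt)
  show "\<exists>c\<in>atlas. p \<in> cproj c ` cdom c \<and> q \<in> cproj c ` cdom c"
    if p: "p \<in> topspace (glue_topology atlas)" and q: "q \<in> topspace (glue_topology atlas)"
      and eq: "orbit_of p = orbit_of q" for p q
  proof -
    obtain a b x where x: "x \<in> halfspace" "p = proj a b x"
      using p unfolding topspace_bordism by blast
    obtain a' b' y where y: "y \<in> halfspace" "q = proj a' b' y"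
      using q unfolding topspace_bordism by blast
    obtain y' where "y' \<in> halfspace" "proj a b y' = q"
      using proj_in_chart[OF y(1)] eq unfolding x(2) y(2) orbit_of_proj by blast
    with x show ?thesis
      by (intro bexI[of _ "chart a b"]) auto
  qed
  show "finite (cgrp c)" if "c \<in> atlas" for c
    using that finite_cgrp by (auto elim!: atlasE simp del: chart_simps(3))
  show "dist (g x) (g y) = dist x y" if "c \<in> atlas" "g \<in> cgrp c" "x \<in> cdom c" "y \<in> cdom c" for c g x y
    using that by (auto elim!: atlasE simp: dist_rot)
  show "cproj c x = cproj c y \<longleftrightarrow> (\<exists>g\<in>cgrp c. y = g x)" if "c \<in> atlas" "x \<in> cdom c" "y \<in> cdom c" for c x y
    using that(1,2) by (rule atlas_fibre)
qed

lemma is_orbifold_bordism: "is_orbifold halfspace (glue_topology atlas) atlas"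
proof (rule is_orbifold_glue_topology[OF compatible_atlas countable_finite[OF finite_atlas] Hausdorff_bordism])
  show "finite (cgrp c) \<and> subgroup (cgrp c) (BijGroup (cdom c))" if "c \<in> atlas" for c
    using that finite_cgrp subgroup_cgrp by (auto elim!: atlasE simp del: chart_simps(3))
  show "smooth_on (cdom c) g" if "c \<in> atlas" "g \<in> cgrp c" for c g
  proof -
    obtain a b where ab: "c = chart a b"
      using \<open>c \<in> atlas\<close> by (rule atlasE)
    then obtain s1 s2 where "g = restrict (rot s1 s2) halfspace"
      using \<open>g \<in> cgrp c\<close> by auto
    then show ?thesis
      using smooth_on_cong[OF smooth_on_Cinf[OF Cinf_on_rot[of s1 s2], of halfspace], of g] by (simp add: ab)
  qed
  show "g x = x" if c: "c \<in> atlas" and g: "g \<in> cgrp c" and V: "openin (top_of_set halfspace) V" "V \<noteq> {}" "V \<subseteq> cdom c"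
    and fix_V: "\<forall>x\<in>V. g x = x" and x: "x \<in> cdom c" for c g V x
  proof -
    obtain a b where ab: "c = chart a b"
      using c by (rule atlasE)
    then obtain s1 s2 where s: "g = restrict (rot s1 s2) halfspace"
      using g by auto
    obtain y where y: "y \<in> V" "y \<in> regular"
      using regular_dense[OF V(1,2)] by blast
    have "y \<in> halfspace" "g y = y"
      using fix_V V(3) y(1) by (auto simp: ab)
    then have "rot s1 s2 y = rot 0 0 y"
      by (simp add: s)
    then have "rot s1 s2 = rot 0 0"
      by (rule rot_free[OF y(2)])
    with x show ?thesis
      by (simp add: s ab)
  qed
  show "cproj c x = cproj c y \<longleftrightarrow> (\<exists>g\<in>cgrp c. y = g x)" if "c \<in> atlas" "x \<in> cdom c" "y \<in> cdom c" for c x y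
    using that(1,2) by (rule atlas_fibre)
qed

text \<open>The lift of the action to a chart uses the frame named by \<open>a\<close>, which has to
  be recovered because \<open>is_torus_orbifoldI\<close> indexes lifts by charts.\<close>

definition first_index :: "(real^(4 option), big_point) orb_chart \<Rightarrow> bool" where
  "first_index c = (SOME a. \<exists>b. c = chart a b)"

lemma is_torus_orbifold_bordism: "is_torus_orbifold halfspace bordism"
proof (rule is_torus_orbifoldI[where R = "\<lambda>c t. rot (coord_w (first_index c) t) (coord_u (first_index c) t)"])
  show "is_orbifold halfspace (tspace bordism) (tatlas bordism)"
    by (simp add: is_orbifold_bordism)
  show "tact bordism t p \<in> topspace (tspace bordism)" if "p \<in> topspace (tspace bordism)" for t p
  proof -
    obtain a b x where x: "x \<in> halfspace" "p = proj a b x"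
      using \<open>p \<in> topspace (tspace bordism)\<close> unfolding bordism_simps topspace_bordism by blast
    have "act t p = proj a b (rot (coord_w a t) (coord_u a t) x)"
      using frame_expand[of t a] by (simp add: proj_rot x(2))
    moreover have "rot (coord_w a t) (coord_u a t) x \<in> halfspace"
      using x(1) by simp
    ultimately show ?thesis
      unfolding bordism_simps topspace_bordism by blast
  qed
  show "tact bordism 0 p = p" for p
    by (force simp: act_def)
  show "tact bordism (s + t) p = tact bordism s (tact bordism t p)" for s t p
    by (simp add: act_add)
  show "(\<forall>p\<in>topspace (tspace bordism). tact bordism t p = p) \<longleftrightarrow> t \<in> lattice" for t
  proof
    assume fix_all: "\<forall>p\<in>topspace (tspace bordism). tact bordism t p = p"
    \<comment> \<open>Both complex coordinates are nonzero, so no direction is collapsed here and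
      the stabiliser is exactly the lattice.\<close>
    let ?x = "of_C5 (1, 1, 0)"
    have "?x \<in> halfspace"
      by (simp add: of_C5_halfspace)
    then have "proj True True ?x \<in> topspace (tspace bordism)"
      unfolding bordism_simps topspace_bordism by blast
    with fix_all have "act t (proj True True ?x) = proj True True ?x"
      by simp
    then have "- t \<in> torus_stab (dir (orbit_pt True True (1, 1, 0)))"
      by (simp add: proj_def act_torus_coset torus_coset_eq_iff)
    then have "- t \<in> lattice"
      by (simp add: dir_orbit_pt torus_stab_iff)
    then show "t \<in> lattice"
      using lattice_closed(3) by fastforce
  next
    assume t: "t \<in> lattice"
    show "\<forall>p\<in>topspace (tspace bordism). tact bordism t p = p"
    proof
      fix p assume "p \<in> topspace (tspace bordism)"
      then obtain a b x where "p = proj a b x"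
        unfolding bordism_simps topspace_bordism by blast
      then show "tact bordism t p = p"
        using act_lattice[OF t] by (simp add: proj_def)
    qed
  qed
  fix c assume c: "c \<in> tatlas bordism"
  define a where "a = first_index c"
  have "\<exists>a b. c = chart a b"
    using c by (simp add: atlas_def)
  from someI_ex[OF this] obtain b where cab: "c = chart a b"
    unfolding first_index_def[symmetric] a_def[symmetric] by blast
  show "smooth_on (UNIV \<times> cdom c) (\<lambda>(t, z). rot (coord_w (first_index c) t) (coord_u (first_index c) t) z)"
    unfolding a_def[symmetric] case_prod_unfold
    by (rule smooth_on_Cinf[OF smooth_rot]) (auto simp: linear_coord linear_conv_bounded_linear[symmetric])
  show "is_lift halfspace (tact bordism t) c c (cdom c) (rot (coord_w (first_index c) t) (coord_u (first_index c) t))" for t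
    unfolding a_def[symmetric] using signed_lift_act[of t a b] by (simp add: cab signed_lift_def)
qed

section \<open>Orientability of the bordism\<close>

lemma chart_inj: "chart a b = chart a' b' \<longleftrightarrow> a = a' \<and> b = b'"
proof
  assume "chart a b = chart a' b'"
  then have "proj a b = proj a' b'"
    by (metis chart_simps(2))
  \<comment> \<open>The origin of a chart has the orbit point
    \<open>(of_bool a, of_bool b, 0)\<close>, from which both indices can be read off.\<close>
  then have "orbit_pt a b (to_C5 (of_C5 0)) = orbit_pt a' b' (to_C5 (of_C5 0))"
    by (metis proj_eq_imp_orbit_pt_eq)
  then show "a = a' \<and> b = b'"
    by (cases a; cases a'; cases b; cases b') (auto simp: orbit_pt_def zero_prod_def rho2_def radial_def)
qed simp

text \<open>Transfers \<open>sign\<close> from indices to charts, as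
  \<open>orientable_orbifoldI\<close> expects; well defined by \<open>chart_inj\<close>.\<close>

definition chart_sign :: "(real^(4 option), big_point) orb_chart \<Rightarrow> real" where
  "chart_sign c = (THE r. \<exists>a b. c = chart a b \<and> r = sign a b)"

lemma chart_sign: "chart_sign (chart a b) = sign a b"
  by (auto simp: chart_sign_def chart_inj)

lemma orientable_bordism: "orientable_orbifold halfspace atlas"
proof (rule orientable_orbifoldI[where Reg = "\<lambda>c. regular" and s = chart_sign])
  show "finite (cgrp c)" if "c \<in> atlas" for c
    using that finite_cgrp by (auto elim!: atlasE simp del: chart_simps(3))
  show "openin (top_of_set halfspace) (cdom c)" if "c \<in> atlas" for c
    using that by (auto elim!: atlasE)
  show "cproj c x = cproj c y \<longleftrightarrow> (\<exists>g\<in>cgrp c. y = g x)" if "c \<in> atlas" "x \<in> cdom c" "y \<in> cdom c" for c x y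
    using that(1,2) by (rule atlas_fibre)
  show "\<exists>D. (g has_derivative D) (at x within cdom c) \<and> det (matrix D) > 0"
    if c: "c \<in> atlas" and g: "g \<in> cgrp c" and x: "x \<in> cdom c" for c g x
  proof -
    obtain a b where ab: "c = chart a b"
      using c by (rule atlasE)
    then obtain s1 s2 where s: "g = restrict (rot s1 s2) halfspace"
      using g by auto
    have "(g has_derivative rot s1 s2) (at x within halfspace)"
      by (rule has_derivative_transform[OF _ _ rot_has_derivative]) (use x in \<open>simp_all add: s ab\<close>)
    then show ?thesis
      using det_rot_pos by (auto simp: ab)
  qed
  show "V \<inter> regular \<noteq> {}" if "openin (top_of_set halfspace) V" "V \<noteq> {}" for V
    using that by (rule regular_dense)
  show "g = g'" if c: "c \<in> atlas" and x: "x \<in> cdom c \<inter> regular" and g: "g \<in> cgrp c" "g' \<in> cgrp c" and eq: "g x = g' x" for c x g g'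
  proof -
    obtain a b where ab: "c = chart a b"
      using c by (rule atlasE)
    then obtain s1 s2 t1 t2 where s: "g = restrict (rot s1 s2) halfspace" "g' = restrict (rot t1 t2) halfspace"
      using g by auto
    have "rot s1 s2 = rot t1 t2"
      by (rule rot_free[of x]) (use x eq in \<open>simp_all add: s ab\<close>)
    then show ?thesis
      by (simp add: s)
  qed
  show "\<exists>N h. x \<in> N \<and> h x = y \<and> signed_lift halfspace (\<lambda>p. p) c d N h (chart_sign c * chart_sign d)"
    if c: "c \<in> atlas" and d: "d \<in> atlas" and x: "x \<in> cdom c" and eq: "cproj c x = cproj d y" for c d x y
  proof -
    obtain a b where ab: "c = chart a b"
      using c by (rule atlasE)
    obtain a' b' where ab': "d = chart a' b'"
      using d by (rule atlasE)
    have "conn (sign a b * sign a' b') a b x a' b' y"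
      using x eq by (intro conn_all) (simp_all add: ab ab')
    then show ?thesis
      unfolding ab ab' chart_sign conn_def .
  qed
  show "chart_sign c \<in> {-1, 1}" if c: "c \<in> atlas" for c
  proof -
    obtain a b where ab: "c = chart a b"
      using c by (rule atlasE)
    show ?thesis
      unfolding ab chart_sign using ratio_nonzero[of False] by (auto simp: sign_def sgn_if)
  qed
qed

text \<open>If z is too long, the flip inverts its modulus; if (y, h) is too long, the inversion
  shortens it. So the compact cores of the four charts cover everything, which gives
  compactness.\<close>

lemma proj_in_core:
  assumes "x \<in> halfspace"
  shows "\<exists>a' b' x'. x' \<in> halfspace \<and> cmod (z_of x') \<le> 1 \<and>
    rho2 (y_of x') (h_of x') \<le> 1 \<and> proj a b x = proj a' b' x'"
proof -
  obtain z y h where x: "x = of_C5 (z, y, h)"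
    by (metis of_to_C5 prod_cases3)
  have h: "h \<ge> 0"
    using assms by (simp add: x of_C5_halfspace)
  have "\<exists>a' z' y'. cmod z' \<le> 1 \<and> proj a b x = proj a' b (of_C5 (z', y', h))"
  proof (cases "cmod z \<le> 1")
    case False
    then have "z \<noteq> 0" "inverse (cmod z) \<le> 1"
      by (auto simp: inverse_le_1_iff)
    with proj_flip[OF polar_Arg, of z a b y h] show ?thesis
      unfolding x by (intro exI[of _ "\<not> a"] exI conjI) (auto intro: sym)
  qed (use x in blast)
  then obtain a' z' y' where 1: "cmod z' \<le> 1" "proj a b x = proj a' b (of_C5 (z', y', h))"
    by blast
  show ?thesis
  proof (cases "rho2 y' h \<le> 1")
    case True
    with 1 h show ?thesis
      by (intro exI[of _ a'] exI[of _ b] exI[of _ "of_C5 (z', y', h)"]) (simp add: of_C5_halfspace)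
  next
    case False
    let ?x = "of_C5 (z', y', h)"
    have ne: "rho2 y' h \<noteq> 0"
      using False by linarith
    then have dom: "?x \<in> inversion_dom"
      by (simp add: inversion_dom_def)
    have "inverse (rho2 y' h) \<le> 1"
      using False by (simp add: inverse_le_1_iff)
    moreover have "to_C5 (inversion ?x) = (z', y' /\<^sub>R rho2 y' h, h /\<^sub>R rho2 y' h)"
      by (simp add: inversion_def)
    ultimately show ?thesis
      using 1 h rho2_inverse[OF ne] proj_inversion[OF dom, of a' b]
      by (intro exI[of _ a'] exI[of _ "\<not> b"] exI[of _ "inversion ?x"])
        (simp add: inversion_halfspace of_C5_halfspace del: real_scaleR_def)
  qed
qed

lemma compact_bordism: "compact_space (glue_topology atlas)"
proof -
  define K where "K = {x \<in> halfspace. cmod (z_of x) \<le> 1 \<and> rho2 (y_of x) (h_of x) \<le> 1}"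
  have "compact K"
    unfolding compact_eq_bounded_closed
  proof
    show "bounded K"
    proof (rule boundedI)
      fix x assume "x \<in> K"
      then have "(cmod (z_of x))\<^sup>2 \<le> 1" "rho2 (y_of x) (h_of x) \<le> 1"
        by (auto simp: K_def power_le_one)
      then have "(norm x)\<^sup>2 \<le> 2\<^sup>2"
        using norm_of_C5[of "to_C5 x"] by (simp add: rho2_def)
      then show "norm x \<le> 2"
        by (rule power2_le_imp_le) simp
    qed
    show "closed K"
      unfolding K_def halfspace_iff rho2_def
      by (intro closed_Collect_conj closed_Collect_le continuous_intros)
  qed
  then have K: "compactin (top_of_set halfspace) K"
    by (auto simp: compactin_subtopology K_def)
  have "compactin (glue_topology atlas) (\<Union>c\<in>atlas. cproj c ` K)"
  proof (rule compactin_Union)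
    show "finite ((\<lambda>c. cproj c ` K) ` atlas)"
      using finite_atlas by simp
    fix S assume "S \<in> (\<lambda>c. cproj c ` K) ` atlas"
    then obtain a b where S: "S = proj a b ` K"
      by (auto elim!: atlasE)
    have "continuous_map (top_of_set halfspace) (glue_topology atlas) (proj a b)"
      using glue_topology_continuous_map[OF atlasI[of a b]] by simp
    then show "compactin (glue_topology atlas) S"
      unfolding S using image_compactin[OF K] by blast
  qed
  moreover have "topspace (glue_topology atlas) = (\<Union>c\<in>atlas. cproj c ` K)"
  proof (intro equalityI subsetI)
    fix p assume "p \<in> topspace (glue_topology atlas)"
    then obtain a b x where "x \<in> halfspace" "p = proj a b x"
      unfolding topspace_bordism by blast
    then obtain a' b' x' where "x' \<in> K" "p = proj a' b' x'"
      using proj_in_core[of x a b] unfolding K_def by blast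
    then show "p \<in> (\<Union>c\<in>atlas. cproj c ` K)"
      by (intro UN_I[of "chart a' b'"]) auto
  next
    fix p assume "p \<in> (\<Union>c\<in>atlas. cproj c ` K)"
    then obtain c x where c: "c \<in> atlas" "x \<in> K" "p = cproj c x"
      by blast
    obtain a b where "c = chart a b"
      using c(1) by (rule atlasE)
    with c show "p \<in> topspace (glue_topology atlas)"
      unfolding topspace_bordism by (auto simp: K_def)
  qed
  ultimately show ?thesis
    by (simp add: compact_space_def)
qed

end

section \<open>The quasitoric orbifold\<close>

definition qt_dir :: "(nat \<Rightarrow> int \<times> int) \<Rightarrow> real \<times> real \<Rightarrow> (real \<times> real) set" where
  "qt_dir xi p = (rvec \<circ> xi) ` {i. i < 4 \<and> p \<in> edge i}"

lemma qt_class_eq: "qt_class xi (t, p) = torus_coset (qt_dir xi) t p"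
  by (simp add: qt_class_def torus_coset_def face_stab_def torus_stab_def qt_dir_def)

text \<open>The predicate in \<open>qt_space\<close> first has to be recognised as a topology. For
  intersections this uses that distinct classes are disjoint.\<close>

lemma topspace_qt_space: "topspace (qt_space xi) = qt_class xi ` (UNIV \<times> rectangle)"
proof -
  let ?R = "UNIV \<times> rectangle :: ((real \<times> real) \<times> real \<times> real) set"
  let ?P = "\<lambda>U. U \<subseteq> qt_class xi ` ?R \<and> openin (top_of_set ?R) (\<Union>U)"
  have class_unique: "c = qt_class xi e" if "c \<in> qt_class xi ` ?R" "e \<in> c" for c e
  proof -
    obtain t p where c: "c = torus_coset (qt_dir xi) t p"
      using \<open>c \<in> qt_class xi ` ?R\<close> by (auto simp: qt_class_eq)
    then show ?thesis
      using \<open>e \<in> c\<close> by (cases e) (auto simp: torus_coset_def qt_class_eq[unfolded torus_coset_def]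
        intro!: torus_coset_eq_iff[THEN iffD2, unfolded torus_coset_def])
  qed
  have istop: "istopology ?P"
    unfolding istopology_def
  proof (rule conjI; intro allI impI)
    fix S T assume S: "?P S" and T: "?P T"
    have "\<Union>(S \<inter> T) = \<Union>S \<inter> \<Union>T"
    proof (intro equalityI subsetI)
      fix e assume "e \<in> \<Union>S \<inter> \<Union>T"
      then obtain c d where cd: "c \<in> S" "e \<in> c" "d \<in> T" "e \<in> d"
        by blast
      then have "c = d"
        using class_unique[of c e] class_unique[of d e] S T by blast
      with cd show "e \<in> \<Union>(S \<inter> T)" by blast
    qed blast
    with S T show "?P (S \<inter> T)"
      by (auto intro: openin_Int)
  next
    fix \<K> assume K: "\<forall>K\<in>\<K>. ?P K"
    have "openin (top_of_set ?R) (\<Union>(Union ` \<K>))"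
      by (rule openin_Union) (use K in blast)
    moreover have "\<Union>(Union ` \<K>) = \<Union>(\<Union>\<K>)" by blast
    moreover have "\<Union>\<K> \<subseteq> qt_class xi ` ?R"
      using K by blast
    ultimately show "?P (\<Union>\<K>)"
      by simp
  qed
  have opn: "openin (qt_space xi) U \<longleftrightarrow> ?P U" for U
    unfolding qt_space_def by (simp only: topology_inverse'[OF istop])
  have "\<Union>(qt_class xi ` ?R) = ?R"
  proof (intro equalityI subsetI)
    fix e assume "e \<in> ?R"
    then have "e \<in> qt_class xi e"
      by (cases e) (simp add: qt_class_eq torus_coset_def lattice_subset_torus_stab)
    with \<open>e \<in> ?R\<close> show "e \<in> \<Union>(qt_class xi ` ?R)" by blast
  qed (auto simp: qt_class_def)
  then have "openin (qt_space xi) (qt_class xi ` ?R)"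
    unfolding opn by simp
  moreover have "topspace (qt_space xi) \<subseteq> qt_class xi ` ?R"
    by (rule opn[THEN iffD1, OF openin_topspace, THEN conjunct1])
  ultimately show ?thesis
    by (meson openin_subset subset_antisym)
qed

lemma torus_stab_span_eq: "span B = span B' \<Longrightarrow> torus_stab B = torus_stab B'"
  by (simp add: torus_stab_def)

lemma corner_point_edges:
  assumes "i < 4"
  shows "fst z = 0 \<Longrightarrow> corner_point i z \<in> edge ((i + 3) mod 4)" "snd z = 0 \<Longrightarrow> corner_point i z \<in> edge i"
proof -
  show "corner_point i z \<in> edge ((i + 3) mod 4)" if "fst z = 0"
  proof -
    have "vertex ((i + 3) mod 4) = vertex (i + 3)" "vertex ((i + 3) mod 4 + 1) = vertex i"
      using assms by (auto simp: vertex_def mod_simps)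
    then have "edge ((i + 3) mod 4) = closed_segment (vertex i) (vertex (i + 3))"
      by (simp add: edge_def closed_segment_commute)
    moreover have "radial (fst z) = 0"
      using that by (simp add: radial_def)
    moreover have "0 \<le> radial (snd z)" "radial (snd z) \<le> 1"
      by (auto simp: radial_def divide_le_eq add_pos_nonneg)
    ultimately show ?thesis
      by (auto simp: corner_point_def in_segment algebra_simps intro!: exI[of _ "radial (snd z)"])
  qed
  show "corner_point i z \<in> edge i" if "snd z = 0"
  proof -
    have "radial (snd z) = 0"
      using that by (simp add: radial_def)
    moreover have "0 \<le> radial (fst z)" "radial (fst z) \<le> 1"
      by (auto simp: radial_def divide_le_eq add_pos_nonneg)
    ultimately show ?thesis
      by (auto simp: corner_point_def edge_def in_segment algebra_simps intro!: exI[of _ "radial (fst z)"])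
  qed
qed

text \<open>The boundary of the bordism is compared with the quasitoric orbifold in these charts
  only. Their domains are all of \<open>real^4\<close>, so the comparison maps are global.\<close>

definition vertex_chart ::
  "(nat \<Rightarrow> int \<times> int) \<Rightarrow> nat \<Rightarrow> (real^4, ((real \<times> real) \<times> (real \<times> real)) set) orb_chart" where
  "vertex_chart xi i = qt_chart xi i UNIV (xi ((i + 3) mod 4)) (xi i)"

lemma vertex_chart_in_atlas: "i < 4 \<Longrightarrow> vertex_chart xi i \<in> qt_atlas xi"
  by (auto simp: vertex_chart_def qt_atlas_def)

lemma cdom_vertex_chart [simp]: "cdom (vertex_chart xi i) = UNIV"
  by (simp add: vertex_chart_def qt_chart_def)

lemma to_of_C2 [simp]: "to_C2 (of_C2 p) = p"
  by (simp add: to_C2_def of_C2_def)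

lemma of_to_C2 [simp]: "of_C2 (to_C2 x) = x"
  by (simp add: vec_eq_iff forall_4 to_C2_def of_C2_def)

context null_bordism
begin

text \<open>The counterpart of \<open>proj_polar\<close>. It suffices that a vanishing coordinate
  puts its frame vector into \<open>qt_dir\<close>.\<close>

lemma cproj_vertex_chart:
  assumes i: "i < 4" and "z = cmod z *\<^sub>R cis (2 * pi * \<alpha>)" "y = cmod y *\<^sub>R cis (2 * pi * \<beta>)"
  shows "cproj (vertex_chart xi i) (of_C2 (z, y)) =
    qt_class xi (\<alpha> *\<^sub>R rvec (xi ((i + 3) mod 4)) + \<beta> *\<^sub>R rvec (xi i), corner_point i (z, y))"
proof -
  define v1 v2 p where "v1 = rvec (xi ((i + 3) mod 4))" and "v2 = rvec (xi i)" and "p = corner_point i (z, y)"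
  define d e where "d = \<alpha> - Arg z / (2 * pi)" and "e = \<beta> - Arg y / (2 * pi)"
  have d: "z \<noteq> 0 \<Longrightarrow> d \<in> \<int>" and e: "y \<noteq> 0 \<Longrightarrow> e \<in> \<int>"
    using Arg_diff_Ints assms by (auto simp: d_def e_def)
  have v1: "z = 0 \<Longrightarrow> v1 \<in> qt_dir xi p" and v2: "y = 0 \<Longrightarrow> v2 \<in> qt_dir xi p"
    using corner_point_edges[OF i, of "(z, y)"] i by (auto simp: qt_dir_def v1_def v2_def p_def)
  have "d *\<^sub>R v1 \<in> torus_stab (qt_dir xi p)"
  proof (cases "z = 0")
    case True
    then show ?thesis
      using v1 by (intro torus_stabI[of "d *\<^sub>R v1"]) (auto intro: span_base span_scale)
  qed (use d in \<open>auto intro!: lattice_subset_torus_stab simp: v1_def\<close>)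
  moreover have "e *\<^sub>R v2 \<in> torus_stab (qt_dir xi p)"
  proof (cases "y = 0")
    case True
    then show ?thesis
      using v2 by (intro torus_stabI[of "e *\<^sub>R v2"]) (auto intro: span_base span_scale)
  qed (use e in \<open>auto intro!: lattice_subset_torus_stab simp: v2_def\<close>)
  ultimately have "d *\<^sub>R v1 + e *\<^sub>R v2 \<in> torus_stab (qt_dir xi p)"
    by (rule torus_stab_add)
  moreover have "d *\<^sub>R v1 + e *\<^sub>R v2 =
      (\<alpha> *\<^sub>R v1 + \<beta> *\<^sub>R v2) - ((Arg z / (2 * pi)) *\<^sub>R v1 + (Arg y / (2 * pi)) *\<^sub>R v2)"
    by (simp add: d_def e_def algebra_simps)
  ultimately show ?thesis
    by (simp add: vertex_chart_def qt_chart_def qt_class_eq torus_coset_eq_iff v1_def v2_def p_def)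
qed

section \<open>The boundary of the null-bordism\<close>

lemma to_C5_bd_emb: "to_C5 (bd_emb x) = (fst (to_C2 x), snd (to_C2 x), 0)"
  by (simp add: to_C5_def bd_emb_def to_C2_def)

lemma bd_emb_halfspace [simp]: "bd_emb x \<in> halfspace"
  by (simp add: halfspace_def bd_emb_def)

lemma bd_emb_drop: "y $ None = 0 \<Longrightarrow> bd_emb (bd_drop y) = y"
  by (auto simp: vec_eq_iff bd_emb_def bd_drop_def split: option.split)

lemma bd_drop_emb: "bd_drop (bd_emb x) = x"
  by (simp add: vec_eq_iff bd_emb_def bd_drop_def)

lemma continuous_bd: "continuous_on UNIV (bd_emb :: real^4 \<Rightarrow> _)" "continuous_on UNIV (bd_drop :: _ \<Rightarrow> real^4)"
proof -
  have "linear (bd_emb :: real^4 \<Rightarrow> _)"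
    by (intro linearI) (auto simp: vec_eq_iff bd_emb_def split: option.split)
  then show "continuous_on UNIV (bd_emb :: real^4 \<Rightarrow> _)"
    by (rule linear_continuous_on_compose[OF continuous_on_id])
  have "linear (bd_drop :: _ \<Rightarrow> real^4)"
    by (intro linearI) (auto simp: vec_eq_iff bd_drop_def)
  then show "continuous_on UNIV (bd_drop :: _ \<Rightarrow> real^4)"
    by (rule linear_continuous_on_compose[OF continuous_on_id])
qed

lemma bd_chart_simps [simp]:
  "cdom (bd_chart (chart a b)) = UNIV" "cproj (bd_chart (chart a b)) = (\<lambda>x. proj a b (bd_emb x))"
  by (auto simp: bd_chart_def)

definition bd_points :: "big_point set" where
  "bd_points = {torus_coset dir t (x, s, 0) | t x s. x \<in> {0..1} \<and> s \<in> {0..1}}"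

lemma orbit_pt_boundary:
  "orbit_pt a b (z, y, 0) = (if a then 1 - radial z else radial z, if b then 1 - radial y else radial y, 0)"
proof -
  have "1 + (cmod y)\<^sup>2 > 0"
    by (simp add: add_pos_nonneg)
  then show ?thesis
    by (auto simp: orbit_pt_def rho2_def radial_def field_simps)
qed

lemma proj_bd_emb_in_bd_points: "proj a b (bd_emb x) \<in> bd_points"
proof -
  have "(if c then 1 - radial z else radial z) \<in> {0..1}" for c z
    using radial_bounds[of z] by auto
  then show ?thesis
    unfolding bd_points_def proj_def to_C5_bd_emb orbit_pt_boundary by blast
qed

lemma radial_surj:
  assumes "r \<in> {0..1}"
  obtains z where "z = cmod z *\<^sub>R cis (2 * pi * \<alpha>)" "(if r = 1 then 1 - radial z else radial z) = r"
proof -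
  \<comment> \<open>The value that \<open>radial\<close> has to take: since \<open>radial\<close>
    stays below 1, the end \<open>r = 1\<close> is reached from the chart centred there, where it
    corresponds to 0.\<close>
  define q where "q = (if r = 1 then 0 else r)"
  have q: "0 \<le> q" "q < 1"
    using assms by (auto simp: q_def)
  \<comment> \<open>Solves \<open>m^2 / (1 + m^2) = q\<close> for the modulus
    \<open>m\<close>.\<close>
  let ?z = "sqrt (q / (1 - q)) *\<^sub>R cis (2 * pi * \<alpha>)"
  have "?z = cmod ?z *\<^sub>R cis (2 * pi * \<alpha>)"
    using q by simp
  moreover have "(cmod ?z)\<^sup>2 = q / (1 - q)"
    using q by simp
  then have "radial ?z = q"
    using q by (simp add: radial_def field_simps)
  then have "(if r = 1 then 1 - radial ?z else radial ?z) = r"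
    by (simp only:) (simp add: q_def)
  ultimately show thesis
    by (rule that)
qed

lemma bd_points_eq: "bd_points = (\<Union>c\<in>atlas. cproj (bd_chart c) ` cdom (bd_chart c))"
proof (intro equalityI subsetI)
  fix p assume "p \<in> bd_points"
  then obtain t x s where p: "p = torus_coset dir t (x, s, 0)" "x \<in> {0..1}" "s \<in> {0..1}"
    by (auto simp: bd_points_def)
  define a b where "a = (x = 1)" and "b = (s = 1)"
  obtain z where z: "z = cmod z *\<^sub>R cis (2 * pi * coord_w a t)" "(if a then 1 - radial z else radial z) = x"
    using radial_surj[OF p(2)] unfolding a_def by metis
  obtain y where y: "y = cmod y *\<^sub>R cis (2 * pi * coord_u a t)" "(if b then 1 - radial y else radial y) = s"
    using radial_surj[OF p(3)] unfolding b_def by metis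
  have "proj a b (of_C5 (z, y, 0)) = torus_coset dir (coord_w a t *\<^sub>R rvec (w a) + coord_u a t *\<^sub>R rvec u) (orbit_pt a b (z, y, 0))"
    by (rule proj_polar[OF z(1) y(1)])
  then have "proj a b (of_C5 (z, y, 0)) = p"
    unfolding frame_expand[of t a, symmetric] orbit_pt_boundary z(2) y(2) p(1) .
  moreover have "of_C5 (z, y, 0) = bd_emb (of_C2 (z, y))"
    by (simp add: vec_eq_iff forall_option_4 bd_emb_def of_C2_def)
  ultimately show "p \<in> (\<Union>c\<in>atlas. cproj (bd_chart c) ` cdom (bd_chart c))"
    by (intro UN_I[OF atlasI[of a b]]) auto
next
  fix p assume "p \<in> (\<Union>c\<in>atlas. cproj (bd_chart c) ` cdom (bd_chart c))"
  then obtain c where c: "c \<in> atlas" "p \<in> cproj (bd_chart c) ` cdom (bd_chart c)"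
    by blast
  obtain a b where "c = chart a b"
    using c(1) by (rule atlasE)
  with c(2) proj_bd_emb_in_bd_points show "p \<in> bd_points"
    by auto
qed

lemma boundary_continuous_map:
  "continuous_map (top_of_set (cdom (bd_chart (chart a b)))) (subtopology (glue_topology atlas) bd_points)
     (cproj (bd_chart (chart a b)))"
proof -
  have "continuous_map euclidean (top_of_set halfspace) (bd_emb :: real^4 \<Rightarrow> _)"
    using continuous_bd(1) by (auto simp: continuous_map_in_subtopology)
  moreover have "continuous_map (top_of_set halfspace) (glue_topology atlas) (proj a b)"
    using glue_topology_continuous_map[OF atlasI[of a b]] by simp
  ultimately have "continuous_map euclidean (glue_topology atlas) (\<lambda>x. proj a b (bd_emb x))"
    using continuous_map_compose by (fastforce simp: o_def)
  then show ?thesis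
    using proj_bd_emb_in_bd_points by (auto simp: continuous_map_in_subtopology)
qed

text \<open>\<open>V\<close> is thickened to an open subset of the half-space. On its image,
  \<open>k = 0\<close> forces \<open>h = 0\<close>, so intersecting with \<open>bd_points\<close>
  gives back the image of \<open>V\<close>.\<close>

lemma boundary_open_image:
  assumes "open V"
  shows "openin (subtopology (glue_topology atlas) bd_points) (cproj (bd_chart (chart a b)) ` V)"
proof -
  let ?V = "halfspace \<inter> bd_drop -` V"
  have "openin (top_of_set halfspace) ?V"
    using assms continuous_bd(2) by (intro openin_halfspace_Int open_vimage)
  then have "openin (glue_topology atlas) (proj a b ` ?V)"
    using glue_topology_open_image[OF compatible_atlas atlasI[of a b]] by simp
  moreover have "cproj (bd_chart (chart a b)) ` V = proj a b ` ?V \<inter> bd_points"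
  proof (intro equalityI subsetI)
    fix p assume "p \<in> cproj (bd_chart (chart a b)) ` V"
    then obtain x where "x \<in> V" "p = proj a b (bd_emb x)"
      by auto
    then show "p \<in> proj a b ` ?V \<inter> bd_points"
      using proj_bd_emb_in_bd_points by (auto simp: bd_drop_emb intro!: image_eqI[of _ _ "bd_emb x"])
  next
    fix p assume "p \<in> proj a b ` ?V \<inter> bd_points"
    then obtain y where y: "y \<in> ?V" "p = proj a b y" "p \<in> bd_points"
      by blast
    then have "snd (snd (orbit_of p)) = 0"
      by (auto simp: bd_points_def)
    obtain z c h where yC: "to_C5 y = (z, c, h)"
      by (metis prod_cases3)
    have "h / (1 + rho2 c h) = 0"
      using \<open>snd (snd (orbit_of p)) = 0\<close> by (simp add: y(2) orbit_of_proj yC orbit_pt_def)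
    moreover have "1 + rho2 c h > 0"
      using rho2_nonneg[of c h] by linarith
    ultimately have "h = 0"
      by simp
    then have "y $ None = 0"
      using yC by (simp add: to_C5_def)
    then have "bd_emb (bd_drop y) = y"
      by (rule bd_emb_drop)
    with y show "p \<in> cproj (bd_chart (chart a b)) ` V"
      by (auto intro!: image_eqI[of _ _ "bd_drop y"])
  qed
  ultimately show ?thesis
    by (auto simp: openin_subtopology)
qed

lemma bd_points_subset: "bd_points \<subseteq> topspace (glue_topology atlas)"
proof
  fix p assume "p \<in> bd_points"
  then obtain c where c: "c \<in> atlas" "p \<in> cproj (bd_chart c) ` cdom (bd_chart c)"
    unfolding bd_points_eq by blast
  obtain a b where "c = chart a b"
    using c(1) by (rule atlasE)
  with c(2) obtain x where "p = proj a b (bd_emb x)"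
    by auto
  then show "p \<in> topspace (glue_topology atlas)"
    unfolding topspace_bordism using bd_emb_halfspace by blast
qed

lemma tspace_boundary: "tspace (boundary_orb bordism) = subtopology (glue_topology atlas) bd_points"
  by (simp add: boundary_orb_def bd_points_eq del: bd_chart_simps)

lemma topspace_boundary: "topspace (tspace (boundary_orb bordism)) = bd_points"
  using bd_points_subset by (simp add: tspace_boundary inf.absorb2)

text \<open>The map is the inverse of \<open>f2\<close> after \<open>f1\<close>. A lift of it to a
  chart of X is the global lift of \<open>f1\<close> followed by the inverse of a lift of
  \<open>f2\<close>. Continuity both ways is read off from such lifts, so \<open>Q\<close> need not
  be known to be an orbifold.\<close>

lemma boundary_equivariant_diffeo:
  fixes X :: "(real^4, 'a) torus_orb" and f1 :: "big_point \<Rightarrow> 'q"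
    and Q :: "(real^4, 'q) torus_orb"
  assumes X: "is_torus_orbifold UNIV X" and f2: "equivariant_diffeo UNIV X Q f2"
    and bij: "bij_betw f1 bd_points (topspace (tspace Q))"
    and equi: "\<And>t p. p \<in> bd_points \<Longrightarrow> f1 (act t p) = tact Q t (f1 p)"
    and lifts: "\<And>a b. \<exists>e\<in>tatlas Q. \<exists>L. is_lift UNIV f1 (bd_chart (chart a b)) e UNIV L \<and> cdom e = UNIV"
  shows "\<exists>f. equivariant_diffeo UNIV (boundary_orb bordism) X f"
proof -
  let ?T = "topspace (tspace X)"
  note orb = X[unfolded is_torus_orbifold_def, THEN conjunct1]
  have act_X: "tact X t p \<in> ?T" if "p \<in> ?T" for t p
    using X[unfolded is_torus_orbifold_def, THEN conjunct2, THEN conjunct1] that by blast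
  have topX: "?T = (\<Union>c\<in>tatlas X. cproj c ` cdom c)" and chX: "\<And>c. c \<in> tatlas X \<Longrightarrow> is_orb_chart UNIV (tspace X) c"
    using orb by (auto simp: is_orbifold_def)
  have homeo2: "homeomorphic_map (tspace X) (tspace Q) f2"
    by (rule f2[unfolded equivariant_diffeo_def, THEN conjunct1])
  have equi2: "f2 (tact X t p) = tact Q t (f2 p)" if "p \<in> ?T" for t p
    using f2[unfolded equivariant_diffeo_def, THEN conjunct2, THEN conjunct1] that by blast
  have lift2: "\<exists>N h. x \<in> N \<and> h x = y \<and> is_lift UNIV f2 c d N h"
    if "c \<in> tatlas X" "d \<in> tatlas Q" "x \<in> cdom c" "y \<in> cdom d" "f2 (cproj c x) = cproj d y" for c d x y
    using f2[unfolded equivariant_diffeo_def, THEN conjunct2, THEN conjunct2] that by blast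
  have bij2: "bij_betw f2 ?T (topspace (tspace Q))"
    using homeo2 by (simp add: bij_betw_def homeomorphic_imp_surjective_map homeomorphic_imp_injective_map)
  define g where "g = inv_into ?T f2"
  define f where "f = (\<lambda>p. g (f1 p))"
  have gf2: "g (f2 q) = q" if "q \<in> ?T" for q
    using bij2 that by (simp add: g_def bij_betw_inv_into_left)
  have f2g: "f2 (g r) = r" if "r \<in> topspace (tspace Q)" for r
    using bij2 that by (simp add: g_def bij_betw_inv_into_right)
  have bijf: "bij_betw f bd_points ?T"
    unfolding f_def g_def using bij_betw_trans[OF bij bij_betw_inv_into[OF bij2]] by (simp add: o_def)
  have f2f: "f2 (f p) = f1 p" if "p \<in> bd_points" for p
    using f2g bij that by (auto simp: f_def bij_betw_def)
  have liftf: "\<exists>N h. x \<in> N \<and> h x = y \<and> is_lift UNIV f (bd_chart (chart a b)) d N h"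
    if d: "d \<in> tatlas X" and y: "y \<in> cdom d" and eq: "f (cproj (bd_chart (chart a b)) x) = cproj d y" for a b d x y
  proof -
    obtain e L where e: "e \<in> tatlas Q" and L: "is_lift UNIV f1 (bd_chart (chart a b)) e UNIV L" and dome: "cdom e = UNIV"
      using lifts by blast
    have "f2 (cproj d y) = f1 (cproj (bd_chart (chart a b)) x)"
      using f2f[of "proj a b (bd_emb x)"] eq proj_bd_emb_in_bd_points by simp
    also have "\<dots> = cproj e (L x)"
      using L by (simp add: is_lift_def)
    finally obtain N h where h: "y \<in> N" "h y = L x" "is_lift UNIV f2 d e N h"
      using lift2[OF d e y, of "L x"] dome by blast
    have Nd: "N \<subseteq> cdom d" and inj: "inj_on h N"
      using h(3) by (simp_all add: is_lift_def diffeo_onto_image_def)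
    \<comment> \<open>Near \<open>L x\<close>, the inverse of the lift of \<open>f2\<close> from
      \<open>d\<close> to \<open>e\<close> lifts \<open>g\<close>.\<close>
    have "is_lift UNIV g e d (h ` N) (inv_into N h)"
      by (rule is_lift_inverse[OF h(3)]) (use Nd d topX gf2 in blast)
    with L have "is_lift UNIV (\<lambda>p. g (f1 p)) (bd_chart (chart a b)) d (UNIV \<inter> L -` (h ` N)) (\<lambda>x. inv_into N h (L x))"
      by (rule is_lift_compose) (simp add: dome)
    moreover have "inv_into N h (L x) = y"
      using h(1,2) inj by (metis inv_into_f_f)
    moreover have "x \<in> UNIV \<inter> L -` (h ` N)"
      using imageI[OF h(1), of h] h(2) by simp
    ultimately show ?thesis
      unfolding f_def
      by (intro exI[of _ "UNIV \<inter> L -` (h ` N)"] exI[of _ "\<lambda>x. inv_into N h (L x)"] conjI)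
  qed
  have homeo: "homeomorphic_maps (tspace (boundary_orb bordism)) (tspace X) f (inv_into bd_points f)"
    unfolding homeomorphic_maps_def
  proof (intro conjI ballI)
    show "continuous_map (tspace (boundary_orb bordism)) (tspace X) f"
    proof (rule continuous_map_from_lifts[where M = "UNIV :: (real^4) set"])
      fix p assume "p \<in> topspace (tspace (boundary_orb bordism))"
      then have p: "p \<in> bd_points"
        by (simp add: topspace_boundary)
      then obtain c x where c: "c \<in> atlas" "p = cproj (bd_chart c) x"
        unfolding bd_points_eq by blast
      obtain a b where ab: "c = chart a b"
        using c(1) by (rule atlasE)
      have "f p \<in> ?T"
        using bijf p by (auto simp: bij_betw_def)
      then obtain d y where d: "d \<in> tatlas X" "y \<in> cdom d" "f p = cproj d y"
        unfolding topX by blast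
      obtain N h where h: "x \<in> N" "is_lift UNIV f (bd_chart (chart a b)) d N h"
        using liftf[OF d(1,2), of a b x] d(3) c(2) ab by auto
      show "\<exists>c d (N :: (real^4) set) h x. x \<in> N \<and> p = cproj c x \<and> is_lift UNIV f c d N h \<and> openin (top_of_set UNIV) (cdom c) \<and>
          (\<forall>V. openin (top_of_set (cdom c)) V \<longrightarrow> openin (tspace (boundary_orb bordism)) (cproj c ` V)) \<and>
          continuous_map (top_of_set (cdom d)) (tspace X) (cproj d)"
      proof (rule exI[of _ "bd_chart (chart a b)"], rule exI[of _ d], rule exI[of _ N], rule exI[of _ h],
          rule exI[of _ x], intro conjI allI impI)
        show "x \<in> N" "is_lift UNIV f (bd_chart (chart a b)) d N h" by fact+
        show "p = cproj (bd_chart (chart a b)) x"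
          using c(2) ab by simp
        show "continuous_map (top_of_set (cdom d)) (tspace X) (cproj d)"
          by (rule is_orb_chart_continuous_map[OF chX[OF d(1)]])
        show "openin (tspace (boundary_orb bordism)) (cproj (bd_chart (chart a b)) ` V)"
          if "openin (top_of_set (cdom (bd_chart (chart a b)))) V" for V
          unfolding tspace_boundary using that by (intro boundary_open_image) simp
      qed simp
    qed
    show "continuous_map (tspace X) (tspace (boundary_orb bordism)) (inv_into bd_points f)"
    proof (rule continuous_map_from_lifts[where M = "UNIV :: (real^4) set"])
      fix q assume q: "q \<in> ?T"
      then obtain d y where d: "d \<in> tatlas X" "y \<in> cdom d" "q = cproj d y"
        unfolding topX by blast
      have "q \<in> f ` bd_points"
        using q by (simp only: bij_betw_imp_surj_on[OF bijf])
      then obtain p where p: "p \<in> bd_points" "f p = q"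
        by (metis imageE)
      then obtain c x where c: "c \<in> atlas" "p = cproj (bd_chart c) x"
        unfolding bd_points_eq by blast
      obtain a b where ab: "c = chart a b"
        using c(1) by (rule atlasE)
      obtain N h where h: "x \<in> N" "h x = y" "is_lift UNIV f (bd_chart (chart a b)) d N h"
        using liftf[OF d(1,2), of a b x] d(3) c(2) ab p(2) by auto
      have "inv_into bd_points f (f (proj a b (bd_emb z))) = proj a b (bd_emb z)" for z
        using bijf proj_bd_emb_in_bd_points by (simp add: bij_betw_inv_into_left)
      then have l: "is_lift UNIV (inv_into bd_points f) d (bd_chart (chart a b)) (h ` N) (inv_into N h)"
        by (intro is_lift_inverse[OF h(3)]) simp
      show "\<exists>c d (N :: (real^4) set) h x. x \<in> N \<and> q = cproj c x \<and> is_lift UNIV (inv_into bd_points f) c d N h \<and> openin (top_of_set UNIV) (cdom c) \<and>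
          (\<forall>V. openin (top_of_set (cdom c)) V \<longrightarrow> openin (tspace X) (cproj c ` V)) \<and>
          continuous_map (top_of_set (cdom d)) (tspace (boundary_orb bordism)) (cproj d)"
      proof (rule exI[of _ d], rule exI[of _ "bd_chart (chart a b)"], rule exI[of _ "h ` N"],
          rule exI[of _ "inv_into N h"], rule exI[of _ y], intro conjI allI impI)
        show "y \<in> h ` N"
          using imageI[OF h(1), of h] h(2) by simp
        show "q = cproj d y" by fact
        show "is_lift UNIV (inv_into bd_points f) d (bd_chart (chart a b)) (h ` N) (inv_into N h)" by fact
        show "openin (top_of_set UNIV) (cdom d)"
          using chX[OF d(1)] by (simp add: is_orb_chart_def)
        show "openin (tspace X) (cproj d ` V)" if "openin (top_of_set (cdom d)) V" for V
          by (rule is_orb_chart_open_image[OF chX[OF d(1)] that])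
        show "continuous_map (top_of_set (cdom (bd_chart (chart a b)))) (tspace (boundary_orb bordism)) (cproj (bd_chart (chart a b)))"
          unfolding tspace_boundary by (rule boundary_continuous_map)
      qed
    qed
    show "inv_into bd_points f (f p) = p" if "p \<in> topspace (tspace (boundary_orb bordism))" for p
      using bijf that by (simp add: topspace_boundary bij_betw_inv_into_left)
    show "f (inv_into bd_points f q) = q" if "q \<in> ?T" for q
      using bijf that by (simp add: bij_betw_inv_into_right)
  qed
  have "equivariant_diffeo UNIV (boundary_orb bordism) X f"
    unfolding equivariant_diffeo_def
  proof (intro conjI ballI allI impI)
    show "homeomorphic_map (tspace (boundary_orb bordism)) (tspace X) f"
      using homeo homeomorphic_map_maps by blast
    show "f (tact (boundary_orb bordism) t p) = tact X t (f p)" if "p \<in> topspace (tspace (boundary_orb bordism))" for t p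
    proof -
      have p: "p \<in> bd_points"
        using that by (simp add: topspace_boundary)
      then have fp: "f p \<in> ?T"
        using bijf by (auto simp: bij_betw_def)
      have "f (act t p) = g (tact Q t (f2 (f p)))"
        using equi[OF p] f2f[OF p] by (simp add: f_def)
      also have "\<dots> = g (f2 (tact X t (f p)))"
        using equi2[OF fp] by simp
      also have "\<dots> = tact X t (f p)"
        by (rule gf2[OF act_X[OF fp]])
      finally show ?thesis
        by (simp add: boundary_orb_def)
    qed
    show "\<exists>N h. x \<in> N \<and> h x = y \<and> is_lift UNIV f c d N h"
      if c: "c \<in> tatlas (boundary_orb bordism)" and d: "d \<in> tatlas X" and y: "y \<in> cdom d" and eq: "f (cproj c x) = cproj d y" for c d x y
    proof -
      obtain c' where c': "c' \<in> atlas" "c = bd_chart c'"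
        using c by (auto simp: boundary_orb_def)
      obtain a b where "c' = chart a b"
        using c'(1) by (rule atlasE)
      with liftf[OF d y, of a b x] eq c'(2) show ?thesis
        by simp
    qed
  qed
  then show ?thesis by (rule exI[of _ f])
qed

end

section \<open>Matching the boundary charts with the vertex charts\<close>

definition bd_map :: "(real \<times> real \<Rightarrow> real \<times> real) \<Rightarrow> big_point \<Rightarrow> ((real \<times> real) \<times> (real \<times> real)) set" where
  "bd_map \<sigma> C = (\<lambda>(t, x, s, k). (t, \<sigma> (x, s))) ` C"

definition rect_pt :: "bool \<Rightarrow> bool \<Rightarrow> complex \<Rightarrow> complex \<Rightarrow> real \<times> real" where
  "rect_pt a b z y = (if a then 1 - radial z else radial z, if b then 1 - radial y else radial y)"

text \<open>Conjugation reverses the circle that rotates a coordinate. It is needed because opposite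
  edges carry the same direction only up to sign.\<close>

definition cnj_if :: "bool \<Rightarrow> complex \<Rightarrow> complex" where
  "cnj_if e y = (if e then cnj y else y)"

definition sign_if :: "bool \<Rightarrow> real" where
  "sign_if e = (if e then -1 else 1)"

lemma cnj_if_cnj_if [simp]: "cnj_if e (cnj_if e y) = y"
  by (simp add: cnj_if_def)

lemma radial_cnj_if [simp]: "radial (cnj_if e y) = radial y"
  by (simp add: radial_def cnj_if_def)

lemma cnj_if_polar:
  assumes "y = cmod y *\<^sub>R cis (2 * pi * \<beta>)"
  shows "cnj_if e y = cmod (cnj_if e y) *\<^sub>R cis (2 * pi * (sign_if e * \<beta>))"
proof (cases e)
  case True
  have "cnj y = cmod y *\<^sub>R cis (- (2 * pi * \<beta>))"
    by (subst assms) (simp add: cis_cnj)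
  with True show ?thesis
    by (simp add: cnj_if_def sign_if_def)
qed (use assms in \<open>simp add: cnj_if_def sign_if_def\<close>)

text \<open>Near a vertex, the boundary of the null-bordism and the quasitoric orbifold have the same chart up to
  the order of the coordinates and a complex conjugation.\<close>

definition relabel :: "bool \<Rightarrow> bool \<Rightarrow> real^4 \<Rightarrow> real^4" where
  "relabel sw e x = (let (z, y) = to_C2 x in of_C2 (if sw then (cnj_if e y, z) else (z, cnj_if e y)))"

definition unrelabel :: "bool \<Rightarrow> bool \<Rightarrow> real^4 \<Rightarrow> real^4" where
  "unrelabel sw e x = (let (z, y) = to_C2 x in of_C2 (if sw then (y, cnj_if e z) else (z, cnj_if e y)))"

lemma unrelabel_relabel: "unrelabel sw e (relabel sw e x) = x" "relabel sw e (unrelabel sw e x) = x"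
  by (auto simp: relabel_def unrelabel_def Let_def split: prod.splits) (metis of_to_C2)+

lemma bounded_linear_relabel: "bounded_linear (relabel sw e)" "bounded_linear (unrelabel sw e)"
  unfolding linear_conv_bounded_linear[symmetric]
  by (auto intro!: linearI simp: relabel_def unrelabel_def to_C2_def of_C2_def cnj_if_def vec_eq_iff forall_4)

lemma diffeo_relabel: "diffeo_onto_image UNIV (relabel sw e)"
  by (rule diffeo_onto_imageI[where k = "unrelabel sw e"])
    (auto simp: unrelabel_relabel intro: smooth_on_Cinf[OF Cinf_on_bounded_linear[OF bounded_linear_relabel(1) open_UNIV]]
      smooth_on_Cinf[OF Cinf_on_bounded_linear[OF bounded_linear_relabel(2) open_UNIV]])

lemma range_relabel: "range (relabel sw e) = UNIV"
  by (rule surjI[where f = "unrelabel sw e"]) (rule unrelabel_relabel)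

lemma edge_iff:
  assumes "p \<in> rectangle"
  shows "p \<in> edge 0 \<longleftrightarrow> snd p = 0" "p \<in> edge (Suc 0) \<longleftrightarrow> fst p = 1" "p \<in> edge 2 \<longleftrightarrow> snd p = 1" "p \<in> edge 3 \<longleftrightarrow> fst p = 0"
proof -
  obtain x y where p: "p = (x, y)"
    by (cases p)
  have xy: "0 \<le> x" "x \<le> 1" "0 \<le> y" "y \<le> 1"
    using assms by (auto simp: rectangle_def p)
  show "p \<in> edge 0 \<longleftrightarrow> snd p = 0"
    using xy by (auto simp: edge_def vertex_def in_segment p intro!: exI[of _ x])
  show "p \<in> edge (Suc 0) \<longleftrightarrow> fst p = 1"
    using xy by (auto simp: edge_def vertex_def in_segment p intro!: exI[of _ y])
  show "p \<in> edge 2 \<longleftrightarrow> snd p = 1"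
    \<comment> \<open>Edges 2 and 3 run against the coordinate axes, hence the parameters
      \<open>1 - x\<close> and \<open>1 - y\<close>.\<close>
    using xy by (auto simp: edge_def vertex_def in_segment p numeral_3_eq_3[symmetric] intro!: exI[of _ "1 - x"])
  show "p \<in> edge 3 \<longleftrightarrow> fst p = 0"
    using xy by (auto simp: edge_def vertex_def in_segment p intro!: exI[of _ "1 - y"])
qed

lemma qt_dir_rectangle:
  assumes "p \<in> rectangle"
  shows "qt_dir xi p = {v. v = rvec (xi 0) \<and> snd p = 0} \<union> {v. v = rvec (xi 1) \<and> fst p = 1}
    \<union> {v. v = rvec (xi 2) \<and> snd p = 1} \<union> {v. v = rvec (xi 3) \<and> fst p = 0}"
proof -
  have less_4: "i < 4 \<longleftrightarrow> i = 0 \<or> i = 1 \<or> i = 2 \<or> i = 3" for i :: nat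
    by linarith
  have "{i. i < 4 \<and> p \<in> edge i} = {i. i = 0 \<and> snd p = 0} \<union> {i. i = 1 \<and> fst p = 1} \<union> {i. i = 2 \<and> snd p = 1} \<union> {i. i = 3 \<and> fst p = 0}"
    unfolding less_4 using edge_iff[OF assms] by auto
  then show ?thesis
    unfolding qt_dir_def by auto
qed

lemma rvec_uminus: "rvec (- v) = - rvec v"
  by (simp add: rvec_def prod_eq_iff)

text \<open>Going around the rectangle, the chart axes turn with the vertex, so at odd vertices they
  are exchanged. This is the origin of the flag \<open>sw\<close> in \<open>relabel\<close>.\<close>

lemma corner_point_simps:
  "corner_point 0 p = (radial (fst p), radial (snd p))"
  "corner_point (Suc 0) p = (1 - radial (snd p), radial (fst p))"
  "corner_point 2 p = (1 - radial (fst p), 1 - radial (snd p))"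
  "corner_point 3 p = (radial (snd p), 1 - radial (fst p))"
  by (simp_all add: corner_point_def vertex_def prod_eq_iff)

context null_bordism
begin

lemma bd_map_torus_coset:
  assumes "span (qt_dir xi (\<sigma> (x, s))) = span (dir (x, s, 0))"
  shows "bd_map \<sigma> (torus_coset dir t (x, s, 0)) = qt_class xi (t, \<sigma> (x, s))"
proof -
  have "torus_stab (qt_dir xi (\<sigma> (x, s))) = torus_stab (dir (x, s, 0))"
    by (rule torus_stab_span_eq[OF assms])
  then show ?thesis
    unfolding qt_class_eq by (force simp: bd_map_def torus_coset_def image_iff)
qed

lemma dir_boundary: "dir (x, s, 0) = {v. v = rvec (w False) \<and> x = 0} \<union> {v. v = rvec (w True) \<and> x = 1}
    \<union> {v. v = rvec u \<and> (s = 0 \<or> s = 1)}"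
  unfolding dir_def by (auto split: bool.splits)

text \<open>The parameter \<open>\<sigma>\<close> identifies the coordinates (x, s) of the boundary
  with those of the rectangle. The condition \<open>corner\<close> finds, for each chart, the vertex
  with the same frame up to order and the sign of \<open>u\<close>; \<open>relabel\<close> is then a
  global lift of \<open>bd_map \<sigma>\<close>.\<close>

lemma bordism_boundary_quasitoric:
  fixes X :: "(real^4, 'a) torus_orb"
  assumes X: "is_torus_orbifold UNIV X" "equivariant_diffeo UNIV X (quasitoric xi) f2"
    and span: "\<And>x s. x \<in> {0..1} \<Longrightarrow> s \<in> {0..1} \<Longrightarrow> span (qt_dir xi (\<sigma> (x, s))) = span (dir (x, s, 0))"
    and bij: "bij_betw \<sigma> rectangle rectangle"
    and corner: "\<And>a b. \<exists>i<4. \<exists>sw e.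
      rvec (xi ((i + 3) mod 4)) = (if sw then sign_if e *\<^sub>R rvec u else rvec (w a)) \<and>
      rvec (xi i) = (if sw then rvec (w a) else sign_if e *\<^sub>R rvec u) \<and>
      (\<forall>z y. corner_point i (if sw then (y, z) else (z, y)) = \<sigma> (rect_pt a b z y))"
  shows "\<exists>f. equivariant_diffeo UNIV (boundary_orb bordism) X f"
proof (rule boundary_equivariant_diffeo[OF X, where ?f1.0 = "bd_map \<sigma>"])
  have Q: "tspace (quasitoric xi) = qt_space xi" "tatlas (quasitoric xi) = qt_atlas xi" "tact (quasitoric xi) = qt_act"
    by (simp_all add: quasitoric_def)
  have coset: "bd_map \<sigma> (torus_coset dir t (x, s, 0)) = qt_class xi (t, \<sigma> (x, s))" if "x \<in> {0..1}" "s \<in> {0..1}" for t x s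
    by (rule bd_map_torus_coset[where xi = xi and \<sigma> = \<sigma> and x = x and s = s, OF span[OF that]])
  show "bij_betw (bd_map \<sigma>) bd_points (topspace (tspace (quasitoric xi)))"
    unfolding bij_betw_def Q topspace_qt_space
  proof
    show "inj_on (bd_map \<sigma>) bd_points"
    proof (rule inj_onI)
      fix p q assume "p \<in> bd_points" "q \<in> bd_points" and eq: "bd_map \<sigma> p = bd_map \<sigma> q"
      then obtain t x s t' x' s' where p: "p = torus_coset dir t (x, s, 0)" "x \<in> {0..1}" "s \<in> {0..1}"
        and q: "q = torus_coset dir t' (x', s', 0)" "x' \<in> {0..1}" "s' \<in> {0..1}"
        unfolding bd_points_def by blast
      have e: "\<sigma> (x, s) = \<sigma> (x', s')" "t' - t \<in> torus_stab (qt_dir xi (\<sigma> (x, s)))"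
        using eq unfolding p(1) q(1) coset[OF p(2,3)] coset[OF q(2,3)] qt_class_eq torus_coset_eq_iff by auto
      have "(x, s) = (x', s')"
        using bij e(1) p(2,3) q(2,3) unfolding bij_betw_def rectangle_def by (auto dest: inj_onD)
      moreover have "t' - t \<in> torus_stab (dir (x, s, 0))"
        using e(2) torus_stab_span_eq[OF span[OF p(2,3)]] by simp
      ultimately show "p = q"
        unfolding p(1) q(1) torus_coset_eq_iff by simp
    qed
    show "bd_map \<sigma> ` bd_points = qt_class xi ` (UNIV \<times> rectangle)"
    proof (intro equalityI subsetI)
      fix c assume "c \<in> bd_map \<sigma> ` bd_points"
      then obtain t x s where "c = bd_map \<sigma> (torus_coset dir t (x, s, 0))" "x \<in> {0..1}" "s \<in> {0..1}"
        unfolding bd_points_def by blast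
      moreover from this have "\<sigma> (x, s) \<in> rectangle"
        by (intro bij_betw_apply[OF bij]) (simp add: rectangle_def)
      ultimately show "c \<in> qt_class xi ` (UNIV \<times> rectangle)"
        using coset by auto
    next
      fix c assume "c \<in> qt_class xi ` (UNIV \<times> rectangle)"
      then obtain t p where c: "c = qt_class xi (t, p)" "p \<in> rectangle"
        by blast
      then obtain x s where p: "p = \<sigma> (x, s)" "x \<in> {0..1}" "s \<in> {0..1}"
        using bij unfolding bij_betw_def rectangle_def by blast
      then have "torus_coset dir t (x, s, 0) \<in> bd_points"
        unfolding bd_points_def by blast
      then show "c \<in> bd_map \<sigma> ` bd_points"
        by (rule rev_image_eqI) (simp only: c(1) p(1) coset[OF p(2,3)])
    qed
  qed
  show "bd_map \<sigma> (act t p) = tact (quasitoric xi) t (bd_map \<sigma> p)" if "p \<in> bd_points" for t p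
  proof -
    obtain s x r where p: "p = torus_coset dir s (x, r, 0)" "x \<in> {0..1}" "r \<in> {0..1}"
      using \<open>p \<in> bd_points\<close> unfolding bd_points_def by blast
    show ?thesis
      unfolding p(1) act_torus_coset coset[OF p(2,3)] Q qt_act_def qt_class_eq torus_coset_translate ..
  qed
  show "\<exists>e\<in>tatlas (quasitoric xi). \<exists>L. is_lift UNIV (bd_map \<sigma>) (bd_chart (chart a b)) e UNIV L \<and> cdom e = UNIV" for a b
  proof -
    obtain i sw e where i: "i < 4" and
      xi: "rvec (xi ((i + 3) mod 4)) = (if sw then sign_if e *\<^sub>R rvec u else rvec (w a))"
        "rvec (xi i) = (if sw then rvec (w a) else sign_if e *\<^sub>R rvec u)" and
      cp: "\<And>z y. corner_point i (if sw then (y, z) else (z, y)) = \<sigma> (rect_pt a b z y)"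
      using corner[of a b] by blast
    have "cproj (vertex_chart xi i) (relabel sw e x) = bd_map \<sigma> (proj a b (bd_emb x))" for x
    proof -
      obtain z y where x: "to_C2 x = (z, y)"
        by (cases "to_C2 x")
      let ?\<alpha> = "Arg z / (2 * pi)" and ?\<beta> = "Arg y / (2 * pi)"
      let ?t = "?\<alpha> *\<^sub>R rvec (w a) + ?\<beta> *\<^sub>R rvec u"
      have "rect_pt a b z y \<in> {0..1} \<times> {0..1}"
        using radial_bounds[of z] radial_bounds[of y] by (auto simp: rect_pt_def)
      moreover have "proj a b (bd_emb x) = torus_coset dir ?t (fst (rect_pt a b z y), snd (rect_pt a b z y), 0)"
        by (simp add: proj_def to_C5_bd_emb x orbit_pt_boundary rect_pt_def)
      ultimately have 1: "bd_map \<sigma> (proj a b (bd_emb x)) = qt_class xi (?t, \<sigma> (rect_pt a b z y))"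
        using coset[of "fst (rect_pt a b z y)" "snd (rect_pt a b z y)" ?t] by (simp add: mem_Times_iff)
      \<comment> \<open>Conjugation reverses the angle and the frame vector has the opposite sign;
        the two effects cancel.\<close>
      have e2: "sign_if e * ?\<beta> * sign_if e = ?\<beta>"
        by (simp add: sign_if_def)
      show ?thesis
      proof (cases sw)
        case True
        have "cproj (vertex_chart xi i) (of_C2 (cnj_if e y, z)) =
            qt_class xi ((sign_if e * ?\<beta>) *\<^sub>R rvec (xi ((i + 3) mod 4)) + ?\<alpha> *\<^sub>R rvec (xi i), corner_point i (cnj_if e y, z))"
          by (rule cproj_vertex_chart[OF i cnj_if_polar[OF polar_Arg] polar_Arg])
        also have "(sign_if e * ?\<beta>) *\<^sub>R rvec (xi ((i + 3) mod 4)) + ?\<alpha> *\<^sub>R rvec (xi i) = ?t"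
          unfolding xi using True by (simp only: if_True scaleR_scaleR e2 add.commute)
        also have "corner_point i (cnj_if e y, z) = \<sigma> (rect_pt a b z y)"
          using cp[of "cnj_if e y" z] True by (simp add: rect_pt_def)
        finally show ?thesis
          using 1 True by (simp add: relabel_def x)
      next
        case False
        have "cproj (vertex_chart xi i) (of_C2 (z, cnj_if e y)) =
            qt_class xi (?\<alpha> *\<^sub>R rvec (xi ((i + 3) mod 4)) + (sign_if e * ?\<beta>) *\<^sub>R rvec (xi i), corner_point i (z, cnj_if e y))"
          by (rule cproj_vertex_chart[OF i polar_Arg cnj_if_polar[OF polar_Arg]])
        also have "?\<alpha> *\<^sub>R rvec (xi ((i + 3) mod 4)) + (sign_if e * ?\<beta>) *\<^sub>R rvec (xi i) = ?t"
          unfolding xi using False by (simp only: if_False scaleR_scaleR e2)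
        also have "corner_point i (z, cnj_if e y) = \<sigma> (rect_pt a b z y)"
          using cp[of "cnj_if e y" z] False by (simp add: rect_pt_def)
        finally show ?thesis
          using 1 False by (simp add: relabel_def x)
      qed
    qed
    then have "is_lift UNIV (bd_map \<sigma>) (bd_chart (chart a b)) (vertex_chart xi i) UNIV (relabel sw e)"
      by (simp add: is_lift_def diffeo_relabel range_relabel)
    then show ?thesis
      unfolding Q using vertex_chart_in_atlas[OF i] by (intro bexI[of _ "vertex_chart xi i"]) auto
  qed
qed

lemma equivariantly_a_boundaryI:
  assumes "equivariant_diffeo UNIV (boundary_orb bordism) X f"
  shows "equivariantly_a_boundary X"
  unfolding equivariantly_a_boundary_def
  using assms is_torus_orbifold_bordism compact_bordism orientable_bordism
  by (intro exI[of _ bordism] exI[of _ f]) simp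

end

section \<open>The two cases for Hirzebruch surfaces\<close>

lemma null_bordismI:
  assumes "idet w0 u \<noteq> 0" "idet w1 u \<noteq> 0"
  shows "null_bordism u (\<lambda>a. if a then w1 else w0)"
  using assms by unfold_locales simp

text \<open>Merges the directions of two opposite edges, which agree up to sign, into the single
  direction \<open>u\<close> of \<open>dir\<close>. The sets \<open>A\<close>, \<open>B\<close>,
  \<open>C\<close> accommodate the order of the edges in \<open>qt_dir_rectangle\<close>.\<close>

lemma span_eq_if_signs:
  assumes "v = u \<or> v = - u"
  shows "span (A \<union> {x. x = u \<and> P} \<union> B \<union> {x. x = v \<and> Q} \<union> C) = span (A \<union> B \<union> C \<union> {x. x = u \<and> (P \<or> Q)})"
    (is "span ?S = span ?T")
proof (cases "v = u")
  case True
  then have "?S = ?T" by auto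
  then show ?thesis by (rule arg_cong)
next
  case False
  with assms have v: "v = - u" "u = - v" by auto
  show ?thesis
    unfolding span_eq
  proof (intro conjI subsetI)
    fix x assume "x \<in> ?S"
    then consider "x \<in> ?T" | "x = v" "u \<in> ?T" by auto
    then show "x \<in> span ?T"
      using v(1) by cases (auto intro: span_base span_neg[OF span_base] simp del: Un_iff)
  next
    fix x assume "x \<in> ?T"
    then consider "x \<in> ?S" | "x = u" "v \<in> ?S" by auto
    then show "x \<in> span ?S"
      using v(2) by cases (metis span_base, metis span_base span_neg)
  qed
qed

theorem theorem5p10:
  fixes v :: "nat \<Rightarrow> int \<times> int"
    and X :: "(real^4, 'a) torus_orb"
  assumes "orbifold_hirzebruch_surface v X"
    and "(v 1 = v 3 \<or> v 1 = - v 3) \<or> (v 2 = v 4 \<or> v 2 = - v 4)"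
  shows "equivariantly_a_boundary X"
proof -
  obtain xi f2 where hf: "hirzebruch_fan v" and X: "is_torus_orbifold UNIV X"
    and xi: "\<forall>i<4. xi i = v (i + 1) \<or> xi i = - v (i + 1)" and f2: "equivariant_diffeo UNIV X (quasitoric xi) f2"
    using assms(1) unfolding orbifold_hirzebruch_surface_def by blast
  have xis: "xi 0 = v 1 \<or> xi 0 = - v 1" "xi 1 = v 2 \<or> xi 1 = - v 2"
    "xi 2 = v 3 \<or> xi 2 = - v 3" "xi 3 = v 4 \<or> xi 3 = - v 4"
    using xi[rule_format, of 0] xi[rule_format, of 1] xi[rule_format, of 2] xi[rule_format, of 3]
    by (simp_all add: numeral_eq_Suc)
  have "\<forall>i\<in>{1..4}. idet (v i) (v (i mod 4 + 1)) \<noteq> 0"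
    using hf by (simp add: hirzebruch_fan_def)
  note fan = this[THEN bspec]
  have succ: "(1 :: nat) mod 4 + 1 = 2" "(2 :: nat) mod 4 + 1 = 3" "(3 :: nat) mod 4 + 1 = 4" "(4 :: nat) mod 4 + 1 = 1"
    by simp_all
  note vs = fan[of 1, unfolded succ] fan[of 2, unfolded succ] fan[of 3, unfolded succ] fan[of 4, unfolded succ]
  have vs: "idet (v 1) (v 2) \<noteq> 0" "idet (v 2) (v 3) \<noteq> 0" "idet (v 3) (v 4) \<noteq> 0" "idet (v 4) (v 1) \<noteq> 0"
    by (rule vs; simp)+
  have idet_signs: "idet p q \<noteq> 0" "idet q p \<noteq> 0"
    if "p = p' \<or> p = - p'" "q = q' \<or> q = - q'" "idet p' q' \<noteq> 0" for p q p' q'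
    using that by (auto simp: idet_def algebra_simps)
  show ?thesis
  proof (cases "v 1 = v 3 \<or> v 1 = - v 3")
    case True
    then have xi2: "xi 2 = xi 0 \<or> xi 2 = - xi 0"
      using xis by auto
    interpret null_bordism "xi 0" "\<lambda>a. if a then xi 1 else xi 3"
      by (intro null_bordismI idet_signs(1)[OF xis(4,1) vs(4)] idet_signs(2)[OF xis(1,2) vs(1)])
    have "\<exists>f. equivariant_diffeo UNIV (boundary_orb bordism) X f"
    \<comment> \<open>Edges 0 and 2 are horizontal and carry the direction \<open>u\<close>, so
      \<open>s\<close> is the vertical and \<open>x\<close> the horizontal coordinate; nothing has
      to be exchanged.\<close>
    proof (rule bordism_boundary_quasitoric[OF X f2, where \<sigma> = "\<lambda>p. p"])
      show "span (qt_dir xi (x, s)) = span (dir (x, s, 0))" if "x \<in> {0..1}" "s \<in> {0..1}" for x s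
      proof -
        have "(x, s) \<in> rectangle"
          using that by (simp add: rectangle_def)
        from qt_dir_rectangle[OF this, of xi] show ?thesis
          unfolding dir_boundary
          using span_eq_if_signs[of "rvec (xi 2)" "rvec (xi 0)" "{}" "s = 0" "{v. v = rvec (xi 1) \<and> x = 1}" "s = 1" "{v. v = rvec (xi 3) \<and> x = 0}"] xi2
          by (auto simp: rvec_uminus Un_ac)
      qed
    next
      fix a b
      \<comment> \<open>The corner at the horizontal end \<open>a\<close> and the vertical end
        \<open>b\<close>. The axes are exchanged at the odd corners, where \<open>a\<close> and
        \<open>b\<close> differ, and a conjugation can be needed only on edge 2, since
        \<open>u\<close> is \<open>xi 0\<close>.\<close>
      define i :: nat where "i = (if a then if b then 2 else 1 else if b then 3 else 0)"
      have "i < 4 \<and> rvec (xi ((i + 3) mod 4)) = (if a \<noteq> b then sign_if (b \<and> xi 2 = - xi 0) *\<^sub>R rvec (xi 0) else rvec (if a then xi 1 else xi 3)) \<and>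
        rvec (xi i) = (if a \<noteq> b then rvec (if a then xi 1 else xi 3) else sign_if (b \<and> xi 2 = - xi 0) *\<^sub>R rvec (xi 0)) \<and>
        (\<forall>z y. corner_point i (if a \<noteq> b then (y, z) else (z, y)) = rect_pt a b z y)"
        using xi2 by (cases a; cases b) (auto simp: i_def rect_pt_def corner_point_simps sign_if_def rvec_uminus)
      then show "\<exists>i<4. \<exists>sw e. rvec (xi ((i + 3) mod 4)) = (if sw then sign_if e *\<^sub>R rvec (xi 0) else rvec (if a then xi 1 else xi 3)) \<and>
        rvec (xi i) = (if sw then rvec (if a then xi 1 else xi 3) else sign_if e *\<^sub>R rvec (xi 0)) \<and>
        (\<forall>z y. corner_point i (if sw then (y, z) else (z, y)) = rect_pt a b z y)"
        by blast
    qed (simp add: bij_betw_def)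
    then show ?thesis
      using equivariantly_a_boundaryI by blast
  next
    case False
    then have xi1: "xi 1 = xi 3 \<or> xi 1 = - xi 3"
      using assms(2) xis by auto
    interpret null_bordism "xi 3" "\<lambda>a. if a then xi 2 else xi 0"
      by (intro null_bordismI idet_signs(2)[OF xis(4,1) vs(4)] idet_signs(1)[OF xis(3,4) vs(3)])
    have "\<exists>f. equivariant_diffeo UNIV (boundary_orb bordism) X f"
    \<comment> \<open>Now the vertical edges 1 and 3 carry the direction \<open>u\<close>, so
      \<open>s\<close> is the horizontal coordinate and the two coordinates are swapped.\<close>
    proof (rule bordism_boundary_quasitoric[OF X f2, where \<sigma> = prod.swap])
      show "span (qt_dir xi (prod.swap (x, s))) = span (dir (x, s, 0))" if "x \<in> {0..1}" "s \<in> {0..1}" for x s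
      proof -
        have "(s, x) \<in> rectangle"
          using that by (simp add: rectangle_def)
        from qt_dir_rectangle[OF this, of xi] show ?thesis
          unfolding dir_boundary
          using span_eq_if_signs[of "rvec (xi 1)" "rvec (xi 3)" "{}" "s = 0" "{v. v = rvec (xi 0) \<and> x = 0}" "s = 1" "{v. v = rvec (xi 2) \<and> x = 1}"] xi1
          by (auto simp: rvec_uminus Un_ac)
      qed
      show "bij_betw prod.swap rectangle rectangle"
        by (rule bij_betwI[where g = prod.swap]) (auto simp: rectangle_def)
    next
      fix a b
      \<comment> \<open>After the swap \<open>a\<close> is the vertical end and \<open>b\<close> the
        horizontal one, so the axes are exchanged at the even corners, where
        \<open>a = b\<close>.\<close>
      define i :: nat where "i = (if a then if b then 2 else 3 else if b then 1 else 0)"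
      have "i < 4 \<and> rvec (xi ((i + 3) mod 4)) = (if a = b then sign_if (b \<and> xi 1 = - xi 3) *\<^sub>R rvec (xi 3) else rvec (if a then xi 2 else xi 0)) \<and>
        rvec (xi i) = (if a = b then rvec (if a then xi 2 else xi 0) else sign_if (b \<and> xi 1 = - xi 3) *\<^sub>R rvec (xi 3)) \<and>
        (\<forall>z y. corner_point i (if a = b then (y, z) else (z, y)) = prod.swap (rect_pt a b z y))"
        using xi1 by (cases a; cases b) (auto simp: i_def rect_pt_def corner_point_simps sign_if_def rvec_uminus)
      then show "\<exists>i<4. \<exists>sw e. rvec (xi ((i + 3) mod 4)) = (if sw then sign_if e *\<^sub>R rvec (xi 3) else rvec (if a then xi 2 else xi 0)) \<and>
        rvec (xi i) = (if sw then rvec (if a then xi 2 else xi 0) else sign_if e *\<^sub>R rvec (xi 3)) \<and>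
        (\<forall>z y. corner_point i (if sw then (y, z) else (z, y)) = prod.swap (rect_pt a b z y))"
        by blast
    qed
    then show ?thesis
      using equivariantly_a_boundaryI by blast
  qed
qed

end
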